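(* For each $\alpha\ge\beta>0$, the elliptical orbit $$\mathbf{X}_0(s)=(\alpha\cos s,\ \beta\sin s,\ 0)$$ locally minimizes $\mathcal{L}$ under the constraint $\int_0^{2\pi}\frac{\mathbf{X}(s)}{|\mathbf{X}(s)|}\,ds=0$, in the following precise sense. There exists a positive constant $c=c(\alpha,\beta)$ such that for every perturbation $$\mathbf{X}(\mu,s)=\mathbf{X}_0(s)+\mu\,\mathbf{x}_1(s)+\mu^2\mathbf{x}_2(s)+o(\mu^2)\quad\text{in }H^1\quad(\mu\to0)$$ with $\mathbf{x}_1,\mathbf{x}_2$ in $H^1$, which satisfies the constraint to order $o(\mu)$, i.e. $\int_0^{2\pi}\frac{\mathbf{X}(\mu,s)}{|\mathbf{X}(\mu,s)|}\,ds=o(\mu)$, the second variation $\mathcal{L}_2$ satisfies $$\mathcal{L}_2=\mathcal{L}(\mathbf{x}_1)\ \ge\ c(\alpha,\beta)\,\|P_{n\neq\pm1}\mathbf{x}_1\|^2 .$$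
   Context: All functions are $2\pi$-periodic with values in $\mathbb{R}^3$, and $H^1$ is the Sobolev space of such functions. The functional is $$\mathcal{L}(\mathbf{X})=\frac12\int_0^{2\pi}\big\{|\mathbf{X}'(s)|^2-|\mathbf{X}(s)|^2\big\}\,ds .$$ The second variation $\mathcal{L}_2$ is the coefficient of $\mu^2$ in the expansion $\mathcal{L}(\mathbf{X}(\mu,\cdot))=\mathcal{L}(\mathbf{X}_0)+\mu\mathcal{L}_1+\mu^2\mathcal{L}_2+o(\mu^2)$. $P_{n\ne\pm1}$ is the orthogonal projection onto the space of functions whose first order Fourier coefficients (those of $e^{\pm is}$) vanish, and $\|\cdot\|$ is the norm of $L^2([0,2\pi];\mathbb{R}^3)$. *)

theory Defs
  imports "HOL-Analysis.Analysis" "HOL-Library.Landau_Symbols"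
begin

section \<open>Periodic Lebesgue and Sobolev spaces\<close>

text \<open>
  Elements of the function spaces are represented by pointwise \<open>2\<pi>\<close>-periodic functions on the
  line; functions that agree almost everywhere are not identified.
\<close>

definition periodic_2pi :: "(real \<Rightarrow> 'a) \<Rightarrow> bool" where
  "periodic_2pi f \<longleftrightarrow> (\<forall>s. f (s + 2 * pi) = f s)"

definition L2_per :: "(real \<Rightarrow> 'a::euclidean_space) set" where
  "L2_per = {f. periodic_2pi f \<and> set_borel_measurable lebesgue {0..2*pi} f
               \<and> set_integrable lebesgue {0..2*pi} (\<lambda>s. (norm (f s))\<^sup>2)}"

definition L2_inner :: "(real \<Rightarrow> 'a::euclidean_space) \<Rightarrow> (real \<Rightarrow> 'a) \<Rightarrow> real" where
  "L2_inner f g = (LINT s:{0..2*pi}|lebesgue. f s \<bullet> g s)"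

definition L2_norm_per :: "(real \<Rightarrow> 'a::euclidean_space) \<Rightarrow> real" where
  "L2_norm_per f = sqrt (LINT s:{0..2*pi}|lebesgue. (norm (f s))\<^sup>2)"

definition test_function :: "(real \<Rightarrow> real) \<Rightarrow> bool" where
  "test_function \<phi> \<longleftrightarrow> periodic_2pi \<phi> \<and> (\<forall>k. (deriv ^^ k) \<phi> differentiable_on UNIV)"

definition has_weak_deriv ::
    "(real \<Rightarrow> 'a::euclidean_space) \<Rightarrow> (real \<Rightarrow> 'a) \<Rightarrow> bool" where
  "has_weak_deriv f g \<longleftrightarrow>
     (\<forall>\<phi>. test_function \<phi> \<longrightarrow>
        (LINT s:{0..2*pi}|lebesgue. deriv \<phi> s *\<^sub>R f s)
          = - (LINT s:{0..2*pi}|lebesgue. \<phi> s *\<^sub>R g s))"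

definition H1_per :: "(real \<Rightarrow> 'a::euclidean_space) set" where
  "H1_per = {f \<in> L2_per. \<exists>g \<in> L2_per. has_weak_deriv f g}"

text \<open>
  The weak derivative of an element of \<open>H1_per\<close> is determined only almost everywhere; below it
  occurs only inside integrals, so the choice of representative is immaterial.
\<close>

definition weak_deriv :: "(real \<Rightarrow> 'a::euclidean_space) \<Rightarrow> real \<Rightarrow> 'a" where
  "weak_deriv f = (SOME g. g \<in> L2_per \<and> has_weak_deriv f g)"

definition H1_norm :: "(real \<Rightarrow> 'a::euclidean_space) \<Rightarrow> real" where
  "H1_norm f = sqrt ((L2_norm_per f)\<^sup>2 + (L2_norm_per (weak_deriv f))\<^sup>2)"


section \<open>Fourier coefficients and the projection off the first modes\<close>

definition fourier_coeff :: "int \<Rightarrow> (real \<Rightarrow> real^3) \<Rightarrow> complex^3" where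
  "fourier_coeff n f =
     (\<chi> j. (LINT s:{0..2*pi}|lebesgue. complex_of_real (f s $ j) * cis (- (of_int n * s)))
            / complex_of_real (2 * pi))"

definition no_first_modes :: "(real \<Rightarrow> real^3) set" where
  "no_first_modes = {h \<in> L2_per. fourier_coeff 1 h = 0 \<and> fourier_coeff (-1) h = 0}"

text \<open>
  Orthogonal projection in \<open>L2\<close> onto \<open>no_first_modes\<close>, again determined up to equality almost
  everywhere.
\<close>

definition proj_no_first_modes :: "(real \<Rightarrow> real^3) \<Rightarrow> real \<Rightarrow> real^3" where
  "proj_no_first_modes f =
     (SOME h. h \<in> no_first_modes \<and> (\<forall>k \<in> no_first_modes. L2_inner (\<lambda>s. f s - h s) k = 0))"


section \<open>The functional, the ellipse and the second variation\<close>

definition action :: "(real \<Rightarrow> real^3) \<Rightarrow> real" where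
  "action X =
     1/2 * (LINT s:{0..2*pi}|lebesgue. (norm (weak_deriv X s))\<^sup>2 - (norm (X s))\<^sup>2)"

definition ellipse :: "real \<Rightarrow> real \<Rightarrow> real \<Rightarrow> real^3" where
  "ellipse \<alpha> \<beta> s = vector [\<alpha> * cos s, \<beta> * sin s, 0]"

definition constraint_integral :: "(real \<Rightarrow> real^3) \<Rightarrow> real^3" where
  "constraint_integral X = (LINT s:{0..2*pi}|lebesgue. X s /\<^sub>R norm (X s))"

definition has_second_variation ::
    "(real \<Rightarrow> real^3) \<Rightarrow> (real \<Rightarrow> real \<Rightarrow> real^3) \<Rightarrow> real \<Rightarrow> bool" where
  "has_second_variation X\<^sub>0 X L\<^sub>2 \<longleftrightarrow>
     (\<exists>L\<^sub>1. (\<lambda>\<mu>. action (X \<mu>) - (action X\<^sub>0 + \<mu> * L\<^sub>1 + \<mu>\<^sup>2 * L\<^sub>2)) \<in> o[at 0](\<lambda>\<mu>. \<mu>\<^sup>2))"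

lemma has_second_variation_unique:
  assumes "has_second_variation X\<^sub>0 X a" "has_second_variation X\<^sub>0 X b"
  shows "a = b"
proof -
  obtain p where p: "(\<lambda>\<mu>. action (X \<mu>) - (action X\<^sub>0 + \<mu> * p + \<mu>\<^sup>2 * a)) \<in> o[at 0](\<lambda>\<mu>. \<mu>\<^sup>2)"
    using assms(1) unfolding has_second_variation_def by blast
  obtain q where q: "(\<lambda>\<mu>. action (X \<mu>) - (action X\<^sub>0 + \<mu> * q + \<mu>\<^sup>2 * b)) \<in> o[at 0](\<lambda>\<mu>. \<mu>\<^sup>2)"
    using assms(2) unfolding has_second_variation_def by blast
  have "(\<lambda>\<mu>. \<mu> * (q - p) + \<mu>\<^sup>2 * (b - a)) \<in> o[at 0](\<lambda>\<mu>::real. \<mu>\<^sup>2)"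
    using sum_in_smallo(2)[OF p q] by (simp add: algebra_simps)
  then have lim: "((\<lambda>\<mu>::real. (\<mu> * (q - p) + \<mu>\<^sup>2 * (b - a)) / \<mu>\<^sup>2) \<longlongrightarrow> 0) (at 0)"
    by (rule smalloD_tendsto)
  have "((\<lambda>\<mu>::real. \<mu> * ((\<mu> * (q - p) + \<mu>\<^sup>2 * (b - a)) / \<mu>\<^sup>2)) \<longlongrightarrow> 0 * 0) (at 0)"
    by (intro tendsto_mult lim tendsto_ident_at)
  moreover have "\<forall>\<^sub>F \<mu> in at (0::real).
      \<mu> * ((\<mu> * (q - p) + \<mu>\<^sup>2 * (b - a)) / \<mu>\<^sup>2) = (q - p) + \<mu> * (b - a)"
    by (auto simp: eventually_at_filter field_simps power2_eq_square)
  ultimately have "((\<lambda>\<mu>::real. (q - p) + \<mu> * (b - a)) \<longlongrightarrow> 0) (at 0)"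
    using tendsto_cong by fastforce
  moreover have "((\<lambda>\<mu>::real. (q - p) + \<mu> * (b - a)) \<longlongrightarrow> (q - p) + 0 * (b - a)) (at 0)"
    by (intro tendsto_intros)
  ultimately have "q = p"
    using tendsto_unique[OF trivial_limit_at] by fastforce
  with lim have "((\<lambda>\<mu>::real. \<mu>\<^sup>2 * (b - a) / \<mu>\<^sup>2) \<longlongrightarrow> 0) (at 0)"
    by simp
  moreover have "\<forall>\<^sub>F \<mu> in at (0::real). \<mu>\<^sup>2 * (b - a) / \<mu>\<^sup>2 = b - a"
    by (auto simp: eventually_at_filter)
  ultimately have "((\<lambda>\<mu>::real. b - a) \<longlongrightarrow> 0) (at 0)"
    using tendsto_cong by fastforce
  then show ?thesis
    by (simp add: tendsto_const_iff)
qed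

end

theory Submission
  imports Defs
begin

text \<open>The functional is quadratic, so the expansion of \<open>action (X \<mu>)\<close> only produces inner products of
the terms of \<open>X \<mu>\<close>. The ellipse solves \<open>X'' = - X\<close>; hence it is a critical point, the mixed
terms with \<open>x\<^sub>2\<close> cancel, and the coefficient of \<open>\<mu>\<^sup>2\<close> is \<open>action x\<^sub>1\<close>. The constraint to first order
says that the derivative of \<open>X \<mapsto> \<integral> X/|X|\<close> at the ellipse vanishes in the direction \<open>x\<^sub>1\<close>. The
remaining problem is linear: \<open>\<integral> |x'|\<^sup>2 - |x|\<^sup>2\<close> has to be bounded below by the squared norm of \<open>x\<close>
without its first Fourier modes, for all \<open>x\<close> in the kernel of that derivative.

Let \<open>\<xi> = \<alpha> cos s + i \<beta> sin s = r u\<close> be the ellipse in polar form. In complex notation the planar part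
\<open>y\<close> of \<open>x\<close> and its vertical part \<open>z\<close> decouple: the linearised constraint reads
\<open>\<integral> Im (cnj u * y) / r * u = 0\<close> and \<open>\<integral> z / r = 0\<close> (\<open>linearized_split\<close>). The half-period shift
\<open>s \<mapsto> s + \<pi>\<close> preserves both conditions. The antiperiodic half of a function contains the modes
\<open>\<plusminus>1\<close>, has mean value zero, and satisfies the estimate with the constant \<open>3\<close> because the next modes
contribute at least \<open>2\<^sup>2 - 1\<close>. So the only danger lies in functions of period \<open>\<pi>\<close>, where the
constant mode makes the form negative, and the constraint has to exclude it (\<open>half_period_gap\<close>).

For those, Liouville's transformation \<open>z = r p\<close>, \<open>y = \<xi> (g + i f)\<close> passes to the polar angle of the
ellipse as the independent variable, whose speed is \<open>\<omega> = \<alpha>\<beta> / r\<^sup>2\<close>. Up to total derivatives the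
form becomes \<open>\<integral> p'\<^sup>2/\<omega> - \<omega> p\<^sup>2\<close> for the vertical part (\<open>liouville_scalar\<close>) and, after completing a
square in \<open>g\<close>, at least \<open>\<integral> f'\<^sup>2/\<omega> - 4 \<omega> f\<^sup>2\<close> for the planar part (\<open>liouville_planar\<close>); both have
constant coefficients in the angle. Among the modes of the admissible parity only
mode \<open>0\<close> of \<open>p\<close> and the modes \<open>\<plusminus>1\<close> of \<open>f\<close> are still negative. The constraints become \<open>\<integral> p = 0\<close> and
\<open>\<integral> f u = 0\<close> with respect to \<open>ds\<close>, not the angle; but \<open>ds\<close> has as density in the angle a Poisson kernel with ratio
\<open>\<rho> = (\<alpha> - \<beta>)/(\<alpha> + \<beta>) < 1\<close> (\<open>poisson\<close>). Expanding it gives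
\<open>p\<^sub>0 = - \<Sum>k\<ge>1. \<rho>\<^sup>k (p\<^sub>2\<^sub>k + p\<^sub>-\<^sub>2\<^sub>k)\<close> and \<open>f\<^sub>-\<^sub>1 = - \<Sum>k\<ge>1. \<rho>\<^sup>k f\<^sub>-\<^sub>2\<^sub>k\<^sub>-\<^sub>1\<close>, and the Cauchy--Schwarz inequality
with the sums \<open>\<Sum> 1/((2k)\<^sup>2 - 1) = 1/2\<close> and \<open>\<Sum> 1/((2k+1)\<^sup>2 - 4) = 1/3\<close> over \<open>k \<ge> 1\<close> shows that the
negative modes cancel at most the fraction \<open>\<rho>\<^sup>2\<close> of the positive ones (\<open>even_energy_gap\<close>,
\<open>odd_energy_gap\<close>). For \<open>\<rho> = 1\<close>, the collision orbit \<open>\<beta> = 0\<close>, this estimate would degenerate.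

This argument needs smooth functions. A function with a weak derivative is approximated by its
partial Fourier sums, corrected by constants that restore the constraint
(\<open>coercive_of_half_period_gap\<close>); the weak derivative enters through its Fourier coefficients. The
constraint can be linearised in the mean square, since the Taylor remainder of \<open>x \<mapsto> x/|x|\<close> is bounded
by a multiple of the squared increment for increments of any size (\<open>normalize_remainder\<close>).\<close>

section \<open>Integration over a period\<close>

abbreviation circ :: "real measure" where
  "circ \<equiv> lebesgue_on {0..2*pi}"

lemma finite_measure_circ: "finite_measure circ"
  by (rule finite_measure_lebesgue_on) (metis cbox_interval lmeasurable_cbox)

interpretation circ: finite_measure circ
  by (rule finite_measure_circ)

lemma set_integral_circ:
  fixes f :: "real \<Rightarrow> 'a::euclidean_space"
  shows "(LINT s:{0..2*pi}|lebesgue. f s) = integral\<^sup>L circ f"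
  unfolding set_lebesgue_integral_def by (subst integral_restrict_space) auto

lemma measurable_circ_continuous:
  fixes f :: "real \<Rightarrow> 'a::euclidean_space"
  assumes "continuous_on UNIV f"
  shows "f \<in> borel_measurable circ"
  by (rule continuous_imp_measurable_on_sets_lebesgue) (use assms continuous_on_subset in auto)

lemma integrable_circ_continuous:
  fixes f :: "real \<Rightarrow> 'a::euclidean_space"
  assumes "continuous_on UNIV f"
  shows "integrable circ f"
  using continuous_imp_integrable[of 0 "2*pi" f] assms continuous_on_subset
  by (metis cbox_interval top_greatest)

lemma integral_circ_eq_HK:
  fixes f :: "real \<Rightarrow> 'a::euclidean_space"
  assumes "continuous_on UNIV f"
  shows "integral\<^sup>L circ f = integral {0..2*pi} f"
  by (rule lebesgue_integral_eq_integral)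
     (use integrable_circ_continuous[OF assms] in auto)

lemma integral_circ_derivative:
  fixes F :: "real \<Rightarrow> 'a::euclidean_space"
  assumes "\<And>s. (F has_vector_derivative F' s) (at s)" "continuous_on UNIV F'"
  shows "integral\<^sup>L circ F' = F (2*pi) - F 0"
proof -
  have "(F' has_integral (F (2*pi) - F 0)) {0..2*pi}"
    by (rule fundamental_theorem_of_calculus)
       (use assms(1) in \<open>auto intro: has_vector_derivative_at_within\<close>)
  then show ?thesis
    using integral_circ_eq_HK[OF assms(2)] by (simp add: integral_unique)
qed

section \<open>Square integrable functions on a period\<close>

definition square_int :: "(real \<Rightarrow> 'a::euclidean_space) \<Rightarrow> bool" where
  "square_int f \<longleftrightarrow> f \<in> borel_measurable circ \<and> integrable circ (\<lambda>s. (norm (f s))\<^sup>2)"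

lemma square_int_continuous:
  fixes f :: "real \<Rightarrow> 'a::euclidean_space"
  assumes "continuous_on UNIV f" shows "square_int f"
  unfolding square_int_def
  by (intro conjI measurable_circ_continuous integrable_circ_continuous assms continuous_intros)

lemma square_int_bound:
  fixes f :: "real \<Rightarrow> 'a::euclidean_space" and g :: "real \<Rightarrow> 'b::euclidean_space"
  assumes "square_int f" "g \<in> borel_measurable circ" "\<And>s. norm (g s) \<le> C * norm (f s)"
  shows "square_int g"
  unfolding square_int_def
proof (intro conjI assms(2))
  have "integrable circ (\<lambda>s. C\<^sup>2 * (norm (f s))\<^sup>2)"
    using assms(1) by (auto simp: square_int_def)
  then show "integrable circ (\<lambda>s. (norm (g s))\<^sup>2)"
  proof (rule Bochner_Integration.integrable_bound)
    show "AE x in circ. norm ((norm (g x))\<^sup>2) \<le> norm (C\<^sup>2 * (norm (f x))\<^sup>2)"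
    proof (rule AE_I2)
      fix x
      have "(norm (g x))\<^sup>2 \<le> (C * norm (f x))\<^sup>2"
        using assms(3)[of x] by (intro power_mono) auto
      then show "norm ((norm (g x))\<^sup>2) \<le> norm (C\<^sup>2 * (norm (f x))\<^sup>2)"
        by (simp add: power_mult_distrib)
    qed
  qed (use assms(2) in auto)
qed

lemma norm_add_square_le:
  fixes a b :: "'a::real_normed_vector"
  shows "(norm (a + b))\<^sup>2 \<le> 2 * (norm a)\<^sup>2 + 2 * (norm b)\<^sup>2"
proof -
  have "(norm (a + b))\<^sup>2 \<le> (norm a + norm b)\<^sup>2"
    by (intro power_mono norm_triangle_ineq) auto
  also have "\<dots> \<le> 2 * (norm a)\<^sup>2 + 2 * (norm b)\<^sup>2"
    using sum_squares_ge_zero[of "norm a - norm b" 0]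
    by (simp add: power2_eq_square algebra_simps)
  finally show ?thesis .
qed

lemma square_int_add:
  fixes f :: "real \<Rightarrow> 'a::euclidean_space"
  assumes "square_int f" "square_int g"
  shows "square_int (\<lambda>s. f s + g s)"
  unfolding square_int_def
proof (intro conjI)
  show "(\<lambda>s. f s + g s) \<in> borel_measurable circ"
    using assms by (auto simp: square_int_def)
  have "integrable circ (\<lambda>s. 2 * (norm (f s))\<^sup>2 + 2 * (norm (g s))\<^sup>2)"
    using assms by (auto simp: square_int_def)
  then show "integrable circ (\<lambda>s. (norm (f s + g s))\<^sup>2)"
    by (rule Bochner_Integration.integrable_bound)
       (use assms norm_add_square_le in \<open>auto simp: square_int_def\<close>)
qed

lemma square_int_scaleR:
  fixes f :: "real \<Rightarrow> 'a::euclidean_space"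
  assumes "square_int f" shows "square_int (\<lambda>s. c *\<^sub>R f s)"
  by (rule square_int_bound[OF assms, of _ "\<bar>c\<bar>"]) (use assms in \<open>auto simp: square_int_def\<close>)

lemma square_int_diff:
  fixes f :: "real \<Rightarrow> 'a::euclidean_space"
  assumes "square_int f" "square_int g"
  shows "square_int (\<lambda>s. f s - g s)"
  using square_int_add[OF assms(1) square_int_scaleR[OF assms(2), of "-1"]] by simp

lemma square_int_sum:
  fixes f :: "'i \<Rightarrow> real \<Rightarrow> 'a::euclidean_space"
  assumes "\<And>i. i \<in> I \<Longrightarrow> square_int (f i)"
  shows "square_int (\<lambda>s. \<Sum>i\<in>I. f i s)"
  using assms
proof (induction I rule: infinite_finite_induct)
  case (insert x F) then show ?case by (auto intro!: square_int_add)
qed (auto simp: square_int_continuous)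

lemma continuous_bounded_on_period:
  fixes f :: "real \<Rightarrow> 'a::euclidean_space"
  assumes "continuous_on UNIV f"
  shows "\<exists>B>0. \<forall>s\<in>{0..2*pi}. norm (f s) \<le> B"
proof -
  have "bounded (f ` {0..2*pi})"
    by (intro compact_imp_bounded compact_continuous_image)
       (use assms continuous_on_subset in auto)
  then show ?thesis by (auto simp: bounded_pos)
qed

text \<open>The elementary bound \<open>2ab \<le> a\<^sup>2 + b\<^sup>2\<close> makes every product of two square integrable
  functions integrable.\<close>

lemma integrable_square_int_prod:
  fixes f :: "real \<Rightarrow> 'a::euclidean_space" and g :: "real \<Rightarrow> 'b::euclidean_space"
    and p :: "real \<Rightarrow> 'c::euclidean_space"
  assumes "square_int f" "square_int g" "p \<in> borel_measurable circ"
    "\<And>s. s \<in> {0..2*pi} \<Longrightarrow> norm (p s) \<le> C * (norm (f s) * norm (g s))"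
  shows "integrable circ p"
proof -
  have "integrable circ (\<lambda>s. \<bar>C\<bar> * ((norm (f s))\<^sup>2 + (norm (g s))\<^sup>2))"
    using assms by (auto simp: square_int_def)
  then show ?thesis
  proof (rule Bochner_Integration.integrable_bound)
    show "AE s in circ. norm (p s) \<le> norm (\<bar>C\<bar> * ((norm (f s))\<^sup>2 + (norm (g s))\<^sup>2))"
    proof (rule AE_I2)
      fix s assume "s \<in> space circ"
      then have "norm (p s) \<le> C * (norm (f s) * norm (g s))"
        using assms(4) by auto
      also have "\<dots> \<le> \<bar>C\<bar> * (norm (f s) * norm (g s))"
        by (intro mult_right_mono) auto
      also have "\<dots> \<le> \<bar>C\<bar> * ((norm (f s))\<^sup>2 + (norm (g s))\<^sup>2)"
      proof (intro mult_left_mono)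
        have "0 \<le> (norm (f s) - norm (g s))\<^sup>2 + (norm (f s))\<^sup>2 + (norm (g s))\<^sup>2" by simp
        then show "norm (f s) * norm (g s) \<le> (norm (f s))\<^sup>2 + (norm (g s))\<^sup>2"
          by (simp add: power2_eq_square algebra_simps)
      qed auto
      finally show "norm (p s) \<le> norm (\<bar>C\<bar> * ((norm (f s))\<^sup>2 + (norm (g s))\<^sup>2))"
        by simp
    qed
  qed (use assms in auto)
qed

lemma integrable_square_int:
  fixes f :: "real \<Rightarrow> 'a::euclidean_space"
  assumes "square_int f" shows "integrable circ f"
  by (rule integrable_square_int_prod[OF assms square_int_continuous[of "\<lambda>_. 1::real"], of _ 1])
     (use assms in \<open>auto simp: square_int_def\<close>)

lemma square_int_mult_continuous:
  fixes f g :: "real \<Rightarrow> complex"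
  assumes "square_int f" "continuous_on UNIV g"
  shows "square_int (\<lambda>s. f s * g s)"
proof -
  obtain B where B: "B > 0" "\<And>s. s \<in> {0..2*pi} \<Longrightarrow> norm (g s) \<le> B"
    using continuous_bounded_on_period[OF assms(2)] by blast
  have m: "(\<lambda>s. f s * g s) \<in> borel_measurable circ"
    using assms measurable_circ_continuous[OF assms(2)] by (auto simp: square_int_def)
  have "integrable circ (\<lambda>s. B\<^sup>2 * (norm (f s))\<^sup>2)"
    using assms(1) by (auto simp: square_int_def)
  then have "integrable circ (\<lambda>s. (norm (f s * g s))\<^sup>2)"
  proof (rule Bochner_Integration.integrable_bound)
    show "AE s in circ. norm ((norm (f s * g s))\<^sup>2) \<le> norm (B\<^sup>2 * (norm (f s))\<^sup>2)"
    proof (rule AE_I2)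
      fix s assume "s \<in> space circ"
      then have "(norm (g s))\<^sup>2 \<le> B\<^sup>2" using B by (intro power_mono) auto
      then show "norm ((norm (f s * g s))\<^sup>2) \<le> norm (B\<^sup>2 * (norm (f s))\<^sup>2)"
        using mult_right_mono[of "(cmod (g s))\<^sup>2" "B\<^sup>2" "(cmod (f s))\<^sup>2"]
        by (simp add: norm_mult power_mult_distrib mult_ac)
    qed
  qed (use m in auto)
  with m show ?thesis by (simp add: square_int_def)
qed

lemma integrable_mult_continuous:
  fixes f g :: "real \<Rightarrow> complex"
  assumes "square_int f" "continuous_on UNIV g"
  shows "integrable circ (\<lambda>s. f s * g s)"
  by (rule integrable_square_int[OF square_int_mult_continuous[OF assms]])

section \<open>Fourier series in a coordinate of the circle\<close>

lemma cmod_square_weighted: "(cmod b)\<^sup>2 * w = Re (b * (cnj b * w))"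
  by (simp only: cmod_power2) (simp add: power2_eq_square algebra_simps)

lemma cmod_diff_square_weighted:
  "(cmod (a - b))\<^sup>2 * w = (cmod a)\<^sup>2 * w - 2 * Re (a * (cnj b * w)) + (cmod b)\<^sup>2 * w"
  by (simp only: cmod_power2) (simp add: power2_eq_square algebra_simps)

lemma integral_three_terms:
  fixes a b c :: "real \<Rightarrow> real"
  assumes "integrable circ a" "integrable circ b" "integrable circ c"
  shows "(LINT s|circ. a s - 2 * b s + c s)
    = integral\<^sup>L circ a - 2 * integral\<^sup>L circ b + integral\<^sup>L circ c"
  using assms by simp

text \<open>The unit vector \<open>u = e\<^sup>i\<^sup>\<theta>\<close> describes a reparametrisation of the circle by an angle \<open>\<theta>\<close> with speed
  \<open>\<theta>' = \<omega>\<close>. Fourier analysis in the powers of \<open>u\<close> with respect to the measure \<open>\<omega> ds = d\<theta>\<close> is needed for two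
  angles: the parameter \<open>s\<close> itself and the polar angle of the ellipse.\<close>

locale circle_coordinate =
  fixes u :: "real \<Rightarrow> complex" and \<omega> :: "real \<Rightarrow> real"
  assumes norm_u [simp]: "cmod (u s) = 1"
    and u_deriv: "(u has_vector_derivative (\<i> * \<omega> s * u s)) (at s)"
    and \<omega>_cont: "continuous_on UNIV \<omega>"
    and \<omega>_pos: "\<omega> s > 0"
    and u_per: "u (2*pi) = u 0"
    and u_inj: "\<lbrakk>s \<in> {0..<2*pi}; t \<in> {0..<2*pi}; u s = u t\<rbrakk> \<Longrightarrow> s = t"
begin

definition W :: real where "W = integral\<^sup>L circ \<omega>"

text \<open>The mean of \<open>|h|\<^sup>2\<close> with respect to the angle; the powers of \<open>u\<close> are orthonormal for it.\<close>

definition energy :: "(real \<Rightarrow> complex) \<Rightarrow> real" where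
  "energy h = (LINT s|circ. (cmod (h s))\<^sup>2 * \<omega> s) / W"

definition coef :: "(real \<Rightarrow> complex) \<Rightarrow> int \<Rightarrow> complex" where
  "coef h m = (LINT s|circ. h s * (u s powi (-m) * \<omega> s)) / W"

lemma u_nz [simp]: "u s \<noteq> 0"
  using norm_u[of s] by force

lemma u_cont: "continuous_on UNIV u"
  by (intro continuous_at_imp_continuous_on ballI has_vector_derivative_continuous[OF u_deriv])

lemma powi_cont: "continuous_on UNIV (\<lambda>s. u s powi m)"
  by (intro continuous_intros u_cont) auto

lemma \<omega>_cont_complex: "continuous_on UNIV (\<lambda>s. complex_of_real (\<omega> s))"
  by (intro continuous_intros \<omega>_cont)

lemma norm_powi [simp]: "cmod (u s powi m) = 1"
  by (simp add: norm_power_int)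

lemma cnj_powi: "cnj (u s powi m) = u s powi (-m)"
proof -
  have "u s powi m * cnj (u s powi m) = 1"
    by (metis complex_norm_square norm_powi of_real_1 power_one)
  moreover have "u s powi m * u s powi (-m) = 1"
    by (simp add: power_int_minus)
  ultimately show ?thesis
    by (metis mult_cancel_left mult_zero_left zero_neq_one)
qed

lemma powi_deriv:
  "((\<lambda>s. u s powi m) has_vector_derivative (\<i> * m * \<omega> s * u s powi m)) (at s)"
proof -
  have "((\<lambda>z. z powi m) has_field_derivative (of_int m * u s powi (m - 1))) (at (u s))"
    by (auto intro!: derivative_eq_intros)
  from field_vector_diff_chain_at[OF u_deriv this]
  show ?thesis
    by (simp add: o_def power_int_diff field_simps)
qed

lemma W_pos: "W > 0"
proof -
  obtain s0 where s0: "s0 \<in> {0..2*pi}" "\<And>s. s \<in> {0..2*pi} \<Longrightarrow> \<omega> s0 \<le> \<omega> s"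
    using continuous_attains_inf[of "{0..2*pi}" \<omega>] continuous_on_subset[OF \<omega>_cont]
    by auto
  have "0 < 2 * pi * \<omega> s0" using \<omega>_pos by simp
  also have "2 * pi * \<omega> s0 = integral\<^sup>L circ (\<lambda>_. \<omega> s0)"
    by (simp add: measure_restrict_space)
  also have "\<dots> \<le> W"
    unfolding W_def
    by (intro integral_mono integrable_circ_continuous \<omega>_cont continuous_intros) (use s0 in auto)
  finally show ?thesis .
qed

lemma integral_powi: "(LINT s|circ. u s powi m * \<omega> s) = (if m = 0 then W else 0)"
proof (cases "m = 0")
  case False
  have "(LINT s|circ. \<i> * m * \<omega> s * u s powi m) = u (2*pi) powi m - u 0 powi m"
    by (intro integral_circ_derivative powi_deriv continuous_intros powi_cont \<omega>_cont)
  moreover have "(\<lambda>s. \<i> * m * \<omega> s * u s powi m) = (\<lambda>s. (\<i> * m) * (u s powi m * \<omega> s))"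
    by (simp add: mult_ac)
  ultimately have "(\<i> * m) * (LINT s|circ. u s powi m * \<omega> s) = 0"
    unfolding u_per by (metis diff_self integral_mult_right_zero)
  with False show ?thesis by simp
qed (simp add: W_def)

definition trig :: "(real \<Rightarrow> complex) set" where
  "trig = {T. \<exists>F c. finite F \<and> T = (\<lambda>s. \<Sum>m\<in>F. c m * u s powi m)}"

lemma coef_integrable:
  assumes "square_int h"
  shows "integrable circ (\<lambda>s. h s * (u s powi m * \<omega> s))"
  by (intro integrable_mult_continuous assms continuous_intros powi_cont \<omega>_cont)

lemma coef_add:
  "square_int f \<Longrightarrow> square_int g \<Longrightarrow> coef (\<lambda>s. f s + g s) m = coef f m + coef g m"
  unfolding coef_def by (simp add: distrib_right coef_integrable add_divide_distrib)

lemma coef_cmult: "coef (\<lambda>s. c * f s) m = c * coef f m"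
  unfolding coef_def by (simp add: mult.assoc)

lemma coef_powi: "coef (\<lambda>s. u s powi n) m = (if n = m then 1 else 0)"
proof -
  have "(\<lambda>s. u s powi n * (u s powi (-m) * \<omega> s)) = (\<lambda>s. u s powi (n - m) * \<omega> s)"
    by (simp add: power_int_add[symmetric] flip: mult.assoc)
  then show ?thesis
    using W_pos by (simp add: coef_def integral_powi)
qed

lemma square_int_powi: "square_int (\<lambda>s. c * u s powi m)"
  by (intro square_int_continuous continuous_intros powi_cont)

lemma square_int_trig_sum: "square_int (\<lambda>s. \<Sum>m\<in>F. c m * u s powi m)"
  by (intro square_int_sum square_int_powi)

lemma coef_sum:
  assumes "finite F"
  shows "coef (\<lambda>s. \<Sum>m\<in>F. c m * u s powi m) n = (if n \<in> F then c n else 0)"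
  using assms
proof (induction F)
  case (insert x F)
  then show ?case
    by (auto simp: coef_add square_int_powi square_int_trig_sum coef_cmult coef_powi)
qed (simp add: coef_def)

lemma integrable_cnj_trig:
  assumes "square_int h"
  shows "integrable circ (\<lambda>s. h s * (cnj (\<Sum>m\<in>F. c m * u s powi m) * \<omega> s))"
  by (intro integrable_mult_continuous assms continuous_intros powi_cont \<omega>_cont)

lemma integral_cnj_trig:
  assumes "square_int h" "finite F"
  shows "(LINT s|circ. h s * (cnj (\<Sum>m\<in>F. c m * u s powi m) * \<omega> s)) = W * (\<Sum>m\<in>F. cnj (c m) * coef h m)"
proof -
  have "(\<lambda>s. h s * (cnj (\<Sum>m\<in>F. c m * u s powi m) * \<omega> s))
      = (\<lambda>s. \<Sum>m\<in>F. cnj (c m) * (h s * (u s powi (-m) * \<omega> s)))"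
    by (simp add: cnj_powi[symmetric] sum_distrib_left sum_distrib_right mult_ac)
  then have "(LINT s|circ. h s * (cnj (\<Sum>m\<in>F. c m * u s powi m) * \<omega> s))
      = (\<Sum>m\<in>F. cnj (c m) * (LINT s|circ. h s * (u s powi (-m) * \<omega> s)))"
    using coef_integrable[OF assms(1)] by simp
  then show ?thesis
    using W_pos by (simp add: coef_def sum_distrib_left mult_ac)
qed

lemma energy_integrable:
  assumes "square_int h" shows "integrable circ (\<lambda>s. (cmod (h s))\<^sup>2 * \<omega> s)"
proof -
  have "integrable circ (\<lambda>s. h s * cnj (h s) * \<omega> s)"
  proof (rule integrable_square_int_prod[of "\<lambda>s. h s * \<omega> s" h _ 1])
    show "square_int (\<lambda>s. h s * \<omega> s)"
      by (intro square_int_mult_continuous assms \<omega>_cont_complex)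
    show "(\<lambda>s. h s * cnj (h s) * \<omega> s) \<in> borel_measurable circ"
    proof -
      have [measurable]: "h \<in> borel_measurable circ" using assms by (auto simp: square_int_def)
      have [measurable]: "\<omega> \<in> borel_measurable circ" by (rule measurable_circ_continuous[OF \<omega>_cont])
      have [measurable]: "(\<lambda>s. cnj (h s)) \<in> borel_measurable circ"
        by (rule borel_measurable_continuous_on[of cnj]) (auto intro: continuous_intros)
      show ?thesis by measurable
    qed
  qed (use assms in \<open>auto simp: norm_mult mult_ac\<close>)
  then have "integrable circ (\<lambda>s. Re (h s * cnj (h s) * \<omega> s))"
    by (rule integrable_Re)
  then show ?thesis
    by (simp add: complex_mult_cnj cmod_power2 distrib_right)
qed

text \<open>Orthogonality of the powers of \<open>u\<close>: the squared distance to a trigonometric sum is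
  smallest when its coefficients are the Fourier coefficients.\<close>

lemma energy_diff_trig:
  assumes "square_int h" "finite F"
  shows "energy (\<lambda>s. h s - (\<Sum>m\<in>F. c m * u s powi m))
       = energy h - (\<Sum>m\<in>F. (cmod (coef h m))\<^sup>2) + (\<Sum>m\<in>F. (cmod (coef h m - c m))\<^sup>2)"
proof -
  let ?T = "\<lambda>s. \<Sum>m\<in>F. c m * u s powi m"
  have sT: "square_int ?T" by (rule square_int_trig_sum)
  have iC: "integrable circ (\<lambda>s. h s * (cnj (?T s) * \<omega> s))"
    by (rule integrable_cnj_trig[OF assms(1)])
  have iR: "integrable circ (\<lambda>s. Re (h s * (cnj (?T s) * \<omega> s)))"
    by (rule integrable_Re[OF iC])
  have pt: "(cmod (h s - ?T s))\<^sup>2 * \<omega> s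
      = (cmod (h s))\<^sup>2 * \<omega> s - 2 * Re (h s * (cnj (?T s) * \<omega> s)) + (cmod (?T s))\<^sup>2 * \<omega> s" for s
    by (rule cmod_diff_square_weighted)
  have e1: "(LINT s|circ. (cmod (?T s))\<^sup>2 * \<omega> s) = W * (\<Sum>m\<in>F. (cmod (c m))\<^sup>2)"
  proof -
    have "(LINT s|circ. (cmod (?T s))\<^sup>2 * \<omega> s) = (LINT s|circ. Re (?T s * (cnj (?T s) * \<omega> s)))"
      by (simp only: cmod_square_weighted)
    also have "\<dots> = Re (LINT s|circ. ?T s * (cnj (?T s) * \<omega> s))"
      by (rule integral_Re[OF integrable_cnj_trig[OF sT]])
    also have "\<dots> = Re (W * (\<Sum>m\<in>F. cnj (c m) * c m))"
      by (subst integral_cnj_trig[OF sT assms(2)]) (simp add: coef_sum assms(2))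
    also have "\<dots> = W * (\<Sum>m\<in>F. (cmod (c m))\<^sup>2)"
      by (simp only: cmod_power2 Re_complex_of_real times_complex.simps mult.commute[of "cnj _"] complex_mult_cnj
            of_real_sum[symmetric] of_real_mult[symmetric])
    finally show ?thesis .
  qed
  have e2: "(LINT s|circ. Re (h s * (cnj (?T s) * \<omega> s))) = W * (\<Sum>m\<in>F. Re (cnj (c m) * coef h m))"
    using integral_Re[OF iC] integral_cnj_trig[OF assms, of c] by simp
  have "energy (\<lambda>s. h s - ?T s) = energy h - 2 * (\<Sum>m\<in>F. Re (cnj (c m) * coef h m)) + (\<Sum>m\<in>F. (cmod (c m))\<^sup>2)"
  proof -
    have "(LINT s|circ. (cmod (h s - ?T s))\<^sup>2 * \<omega> s)
        = (LINT s|circ. (cmod (h s))\<^sup>2 * \<omega> s) - 2 * (LINT s|circ. Re (h s * (cnj (?T s) * \<omega> s)))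
          + (LINT s|circ. (cmod (?T s))\<^sup>2 * \<omega> s)"
      unfolding pt by (rule integral_three_terms[OF energy_integrable[OF assms(1)] iR energy_integrable[OF sT]])
    then show ?thesis
      unfolding energy_def e1 e2 using W_pos by (simp add: field_simps)
  qed
  also have "\<dots> = energy h + (\<Sum>m\<in>F. (cmod (c m))\<^sup>2 - 2 * Re (cnj (c m) * coef h m))"
    by (simp add: sum_subtractf sum_distrib_left)
  also have "(\<Sum>m\<in>F. (cmod (c m))\<^sup>2 - 2 * Re (cnj (c m) * coef h m))
      = (\<Sum>m\<in>F. (cmod (coef h m - c m))\<^sup>2 - (cmod (coef h m))\<^sup>2)"
    by (intro sum.cong refl, simp only: cmod_power2) (simp add: power2_eq_square algebra_simps)
  finally show ?thesis by (simp add: sum_subtractf)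
qed

lemma energy_nonneg: "energy h \<ge> 0"
  unfolding energy_def using W_pos \<omega>_pos
  by (intro divide_nonneg_nonneg integral_nonneg_AE AE_I2 mult_nonneg_nonneg) (auto simp: less_imp_le)

lemma bessel:
  assumes "square_int h" "finite F"
  shows "(\<Sum>m\<in>F. (cmod (coef h m))\<^sup>2) \<le> energy h"
  using energy_diff_trig[OF assms, of "coef h"] energy_nonneg[of "\<lambda>s. h s - (\<Sum>m\<in>F. coef h m * u s powi m)"]
  by simp

end

context circle_coordinate begin

lemma trig_const: "(\<lambda>s. c) \<in> trig"
  unfolding trig_def by (rule CollectI, rule exI[of _ "{0}"], rule exI[of _ "\<lambda>_. c"]) auto

lemma trig_add:
  assumes "S \<in> trig" "T \<in> trig" shows "(\<lambda>s. S s + T s) \<in> trig"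
proof -
  obtain F c where F: "finite F" "S = (\<lambda>s. \<Sum>m\<in>F. c m * u s powi m)"
    using assms(1) by (auto simp: trig_def)
  obtain G d where G: "finite G" "T = (\<lambda>s. \<Sum>m\<in>G. d m * u s powi m)"
    using assms(2) by (auto simp: trig_def)
  let ?e = "\<lambda>m. (if m \<in> F then c m else 0) + (if m \<in> G then d m else 0)"
  have "S s + T s = (\<Sum>m\<in>F \<union> G. ?e m * u s powi m)" for s
  proof -
    have "S s = (\<Sum>m\<in>F \<union> G. (if m \<in> F then c m else 0) * u s powi m)"
      unfolding F(2) using F(1) G(1) by (intro sum.mono_neutral_cong_left) auto
    moreover have "T s = (\<Sum>m\<in>F \<union> G. (if m \<in> G then d m else 0) * u s powi m)"
      unfolding G(2) using F(1) G(1) by (intro sum.mono_neutral_cong_left) auto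
    ultimately show ?thesis by (simp add: sum.distrib distrib_right)
  qed
  then show ?thesis unfolding trig_def
    using F(1) G(1) by (intro CollectI exI[of _ "F \<union> G"] exI[of _ ?e]) auto
qed

lemma trig_shift:
  assumes "T \<in> trig" shows "(\<lambda>s. c * u s powi k * T s) \<in> trig"
proof -
  obtain F d where F: "finite F" "T = (\<lambda>s. \<Sum>m\<in>F. d m * u s powi m)"
    using assms by (auto simp: trig_def)
  have "c * u s powi k * T s = (\<Sum>m\<in>(\<lambda>m. m + k) ` F. (c * d (m - k)) * u s powi m)" for s
    unfolding F(2)
    by (subst sum.reindex) (auto simp: sum_distrib_left power_int_add mult_ac intro!: sum.cong)
  then show ?thesis unfolding trig_def
    using F(1) by (intro CollectI exI[of _ "(\<lambda>m. m + k) ` F"] exI[of _ "\<lambda>m. c * d (m - k)"]) auto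
qed

lemma trig_mult:
  assumes "S \<in> trig" "T \<in> trig" shows "(\<lambda>s. S s * T s) \<in> trig"
proof -
  obtain F c where F: "finite F" "S = (\<lambda>s. \<Sum>m\<in>F. c m * u s powi m)"
    using assms(1) by (auto simp: trig_def)
  have "(\<lambda>s. (\<Sum>m\<in>F. c m * u s powi m) * T s) \<in> trig"
    using F(1)
  proof (induction F)
    case empty
    then show ?case using trig_const[of 0] by simp
  next
    case (insert k F)
    from trig_add[OF trig_shift[OF assms(2), of "c k" k] insert.IH]
    show ?case using insert.hyps by (simp add: distrib_right)
  qed
  then show ?thesis by (simp add: F(2))
qed

lemma trig_continuous: "T \<in> trig \<Longrightarrow> continuous_on UNIV T"
  unfolding trig_def by (auto intro!: continuous_intros powi_cont)

lemma trig_of_polynomial: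
  assumes "real_polynomial_function (p :: complex \<Rightarrow> real)"
  shows "(\<lambda>s. complex_of_real (p (u s))) \<in> trig"
  using assms
proof induction
  case (linear f)
  have lin: "f z = Re z * f 1 + Im z * f \<i>" for z
  proof -
    interpret bounded_linear f by fact
    have "z = Re z *\<^sub>R 1 + Im z *\<^sub>R \<i>" by (simp add: complex_eq_iff)
    then have "f z = f (Re z *\<^sub>R 1 + Im z *\<^sub>R \<i>)" by simp
    also have "\<dots> = Re z * f 1 + Im z * f \<i>" by (simp add: add scaleR)
    finally show ?thesis .
  qed
  have "complex_of_real (f (u s)) = (f 1 / 2 - \<i> * f \<i> / 2) * u s powi 1 * 1
      + (f 1 / 2 + \<i> * f \<i> / 2) * u s powi (-1) * 1" for s
  proof -
    have "u s powi (-1) = cnj (u s)" using cnj_powi[of s 1] by (simp only: power_int_1_right)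
    moreover have "complex_of_real (f (u s)) = Re (u s) * f 1 + Im (u s) * f \<i>"
      by (subst lin) simp
    ultimately show ?thesis by (simp only: power_int_1_right) (simp add: complex_eq_iff field_simps)
  qed
  then show ?case
    by (simp only:) (intro trig_add trig_shift trig_const)
next
  case (const c)
  show ?case by (rule trig_const)
next
  case (add f g)
  then show ?case using trig_add by fastforce
next
  case (mult f g)
  then show ?case using trig_mult by fastforce
qed

text \<open>A periodic continuous function factors through the compact curve traced by \<open>u\<close>; a polynomial
  in \<open>(Re z, Im z)\<close> close to the factor, given by the Stone--Weierstrass theorem, is a
  trigonometric sum in \<open>u\<close>.\<close>

lemma trig_dense_real:
  fixes h :: "real \<Rightarrow> real"
  assumes "continuous_on {0..2*pi} h" "h (2*pi) = h 0" "e > 0"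
  shows "\<exists>T\<in>trig. \<forall>s\<in>{0..2*pi}. cmod (h s - T s) < e"
proof -
  define K where "K = u ` {0..2*pi}"
  define H where "H z = h (SOME s. s \<in> {0..2*pi} \<and> u s = z)" for z
  have same: "h s = h t" if "s \<in> {0..2*pi}" "t \<in> {0..2*pi}" "u s = u t" for s t
  proof -
    define r where "r s = (if s = 2*pi then 0 else s)" for s
    have "\<And>s. s \<in> {0..2*pi} \<Longrightarrow> r s \<in> {0..<2*pi}" "\<And>s. s \<in> {0..2*pi} \<Longrightarrow> h (r s) = h s"
        "\<And>s. s \<in> {0..2*pi} \<Longrightarrow> u (r s) = u s"
      using assms(2) u_per by (auto simp: r_def)
    then have "r s = r t" using that u_inj[of "r s" "r t"] by metis
    then show ?thesis using \<open>\<And>s. s \<in> {0..2*pi} \<Longrightarrow> h (r s) = h s\<close>[OF that(1)]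
        \<open>\<And>s. s \<in> {0..2*pi} \<Longrightarrow> h (r s) = h s\<close>[OF that(2)] by simp
  qed
  have Hu: "H (u s) = h s" if "s \<in> {0..2*pi}" for s
  proof -
    let ?t = "SOME t. t \<in> {0..2*pi} \<and> u t = u s"
    have "?t \<in> {0..2*pi} \<and> u ?t = u s"
      by (rule someI[of "\<lambda>t. t \<in> {0..2*pi} \<and> u t = u s" s]) (use that in blast)
    then show ?thesis unfolding H_def using same[of ?t s] that by blast
  qed
  have K: "compact K" unfolding K_def
    by (intro compact_continuous_image continuous_on_subset[OF u_cont]) auto
  have "continuous_on K H"
  proof (subst continuous_on_closed_vimage[OF compact_imp_closed[OF K]], intro allI impI)
    fix B :: "real set" assume "closed B"
    have "closed (h -` B \<inter> {0..2*pi})"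
      using assms(1) \<open>closed B\<close> by (simp add: continuous_on_closed_vimage)
    moreover have "bounded (h -` B \<inter> {0..2*pi})"
      by (rule bounded_subset[of "{0..2*pi}"]) auto
    ultimately have "compact (h -` B \<inter> {0..2*pi})"
      by (simp add: compact_eq_bounded_closed)
    then have "compact (u ` (h -` B \<inter> {0..2*pi}))"
      by (intro compact_continuous_image continuous_on_subset[OF u_cont]) auto
    moreover have "H -` B \<inter> K = u ` (h -` B \<inter> {0..2*pi})"
      using Hu by (auto simp: K_def)
    ultimately show "closed (H -` B \<inter> K)" by (simp add: compact_imp_closed)
  qed
  from Stone_Weierstrass_real_polynomial_function[OF K this assms(3)]
  obtain p where p: "real_polynomial_function p" "\<And>z. z \<in> K \<Longrightarrow> \<bar>H z - p z\<bar> < e" by blast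
  show ?thesis
  proof (intro bexI[OF _ trig_of_polynomial[OF p(1)]] ballI)
    fix s assume s: "s \<in> {0..2*pi}"
    with p(2)[of "u s"] Hu[OF s] have "\<bar>h s - p (u s)\<bar> < e" by (auto simp: K_def)
    then show "cmod (h s - complex_of_real (p (u s))) < e"
      by (metis norm_of_real of_real_diff)
  qed
qed

lemma trig_dense:
  fixes h :: "real \<Rightarrow> complex"
  assumes "continuous_on {0..2*pi} h" "h (2*pi) = h 0" "e > 0"
  shows "\<exists>T\<in>trig. \<forall>s\<in>{0..2*pi}. cmod (h s - T s) < e"
proof -
  have "continuous_on {0..2*pi} (\<lambda>s. Re (h s))" "continuous_on {0..2*pi} (\<lambda>s. Im (h s))"
    by (intro continuous_intros assms(1))+
  with trig_dense_real[of "\<lambda>s. Re (h s)" "e/2"] trig_dense_real[of "\<lambda>s. Im (h s)" "e/2"] assms(2,3)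
  obtain S T :: "real \<Rightarrow> complex" where S: "S \<in> trig" "\<And>s. s \<in> {0..2*pi} \<Longrightarrow> cmod (Re (h s) - S s) < e/2"
    and T: "T \<in> trig" "\<And>s. s \<in> {0..2*pi} \<Longrightarrow> cmod (Im (h s) - T s) < e/2"
    by auto
  have "(\<lambda>s. S s + \<i> * u s powi 0 * T s) \<in> trig"
    by (rule trig_add[OF S(1) trig_shift[OF T(1)]])
  moreover have "cmod (h s - (S s + \<i> * u s powi 0 * T s)) < e" if "s \<in> {0..2*pi}" for s
  proof -
    have "h s - (S s + \<i> * u s powi 0 * T s) = (Re (h s) - S s) + \<i> * (Im (h s) - T s)"
      by (simp add: complex_eq_iff)
    then have "cmod (h s - (S s + \<i> * u s powi 0 * T s))
        = cmod ((Re (h s) - S s) + \<i> * (Im (h s) - T s))" by (rule arg_cong)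
    also have "\<dots> \<le> cmod (Re (h s) - S s) + cmod (\<i> * (Im (h s) - T s))"
      by (rule norm_triangle_ineq)
    also have "cmod (\<i> * (Im (h s) - T s)) = cmod (Im (h s) - T s)"
      by (simp only: norm_mult norm_ii mult_1)
    also have "cmod (Re (h s) - S s) + cmod (Im (h s) - T s) < e/2 + e/2"
      by (intro add_strict_mono S(2) T(2) that)
    finally show ?thesis by simp
  qed
  ultimately show ?thesis by (intro bexI[of _ "\<lambda>s. S s + \<i> * u s powi 0 * T s"]) auto
qed

lemma energy_add_le:
  assumes "square_int f" "square_int g"
  shows "energy (\<lambda>s. f s + g s) \<le> 2 * energy f + 2 * energy g"
proof -
  have "(LINT s|circ. (cmod (f s + g s))\<^sup>2 * \<omega> s)
      \<le> (LINT s|circ. 2 * ((cmod (f s))\<^sup>2 * \<omega> s) + 2 * ((cmod (g s))\<^sup>2 * \<omega> s))"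
  proof (intro integral_mono energy_integrable square_int_add assms)
    show "integrable circ (\<lambda>s. 2 * ((cmod (f s))\<^sup>2 * \<omega> s) + 2 * ((cmod (g s))\<^sup>2 * \<omega> s))"
      using assms energy_integrable by auto
    fix s
    show "(cmod (f s + g s))\<^sup>2 * \<omega> s \<le> 2 * ((cmod (f s))\<^sup>2 * \<omega> s) + 2 * ((cmod (g s))\<^sup>2 * \<omega> s)"
      using mult_right_mono[OF norm_add_square_le[of "f s" "g s"], of "\<omega> s"] \<omega>_pos[of s]
      by (simp add: algebra_simps)
  qed
  also have "\<dots> = 2 * (LINT s|circ. (cmod (f s))\<^sup>2 * \<omega> s) + 2 * (LINT s|circ. (cmod (g s))\<^sup>2 * \<omega> s)"
    using assms energy_integrable by auto
  finally show ?thesis using W_pos by (simp add: energy_def field_simps)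
qed

lemma energy_le_sup:
  assumes "square_int f" "\<And>s. s \<in> {0..2*pi} \<Longrightarrow> cmod (f s) \<le> e"
  shows "energy f \<le> e\<^sup>2"
proof -
  have "(LINT s|circ. (cmod (f s))\<^sup>2 * \<omega> s) \<le> (LINT s|circ. e\<^sup>2 * \<omega> s)"
    using assms \<omega>_pos
    by (intro integral_mono energy_integrable integrable_circ_continuous continuous_intros \<omega>_cont)
       (auto intro!: mult_right_mono power_mono simp: less_imp_le)
  also have "\<dots> = e\<^sup>2 * W" by (simp add: W_def)
  finally show ?thesis using W_pos by (simp add: energy_def field_simps)
qed

definition tail :: "(real \<Rightarrow> complex) \<Rightarrow> nat \<Rightarrow> real" where
  "tail h N = energy h - (\<Sum>m\<in>{-int N..int N}. (cmod (coef h m))\<^sup>2)"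

lemma energy_partial_sum:
  assumes "square_int h"
  shows "energy (\<lambda>s. h s - (\<Sum>m\<in>{-int N..int N}. coef h m * u s powi m)) = tail h N"
  using energy_diff_trig[OF assms, of "{-int N..int N}" "coef h"] by (simp add: tail_def)

lemma tail_nonneg: "square_int h \<Longrightarrow> tail h N \<ge> 0"
  using bessel by (simp add: tail_def)

text \<open>Among all trigonometric sums with frequencies up to \<open>N\<close> the partial Fourier sum is closest to
  \<open>h\<close>, so approximability by any trigonometric sums is inherited by the Fourier sums.\<close>

lemma tail_tendsto_0:
  assumes h: "square_int h" and approx: "\<And>e. e > 0 \<Longrightarrow> \<exists>T\<in>trig. energy (\<lambda>s. h s - T s) < e"
  shows "(tail h \<longlongrightarrow> 0) sequentially"
proof (rule LIMSEQ_I)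
  fix e :: real assume "e > 0"
  then obtain T where T: "T \<in> trig" "energy (\<lambda>s. h s - T s) < e" using approx by blast
  obtain F c where F: "finite F" "T = (\<lambda>s. \<Sum>m\<in>F. c m * u s powi m)"
    using T(1) by (auto simp: trig_def)
  obtain M where M: "\<And>m. m \<in> F \<Longrightarrow> \<bar>m\<bar> \<le> int M"
  proof -
    have "\<bar>m\<bar> \<le> int (nat (\<Sum>m\<in>F. \<bar>m\<bar>))" if "m \<in> F" for m
      using member_le_sum[of m F abs] F(1) that by simp
    then show ?thesis using that by blast
  qed
  have "norm (tail h N - 0) < e" if "N \<ge> M" for N
  proof -
    have sub: "F \<subseteq> {-int N..int N}" using M that by force
    have "tail h N \<le> energy h - (\<Sum>m\<in>F. (cmod (coef h m))\<^sup>2)"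
      unfolding tail_def using sum_mono2[OF _ sub, of "\<lambda>m. (cmod (coef h m))\<^sup>2"] by simp
    also have "\<dots> \<le> energy (\<lambda>s. h s - T s)"
      unfolding F(2) energy_diff_trig[OF h F(1)] by (simp add: sum_nonneg)
    finally show ?thesis using T(2) tail_nonneg[OF h] by simp
  qed
  then show "\<exists>no. \<forall>n\<ge>no. norm (tail h n - 0) < e" by blast
qed

lemma tail_tendsto_0_continuous:
  assumes "continuous_on UNIV h" "h (2*pi) = h 0"
  shows "(tail h \<longlongrightarrow> 0) sequentially"
proof (rule tail_tendsto_0)
  show sq: "square_int h" by (rule square_int_continuous[OF assms(1)])
  fix e :: real assume "e > 0"
  then obtain T where T: "T \<in> trig" "\<And>s. s \<in> {0..2*pi} \<Longrightarrow> cmod (h s - T s) < sqrt (e/2)"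
    using trig_dense[of h "sqrt (e/2)"] continuous_on_subset[OF assms(1)] assms(2) by auto
  have "energy (\<lambda>s. h s - T s) \<le> (sqrt (e/2))\<^sup>2"
    by (intro energy_le_sup square_int_diff sq square_int_continuous trig_continuous T(1))
       (use T(2) less_imp_le in blast)
  with \<open>e > 0\<close> show "\<exists>T\<in>trig. energy (\<lambda>s. h s - T s) < e" using T(1) by force
qed

lemma sum_symmetric_interval:
  "(\<Sum>m\<in>{-int N..int N}. a m) = a 0 + (\<Sum>k<N. a (int (Suc k)) + (a (- int (Suc k)) :: 'b::comm_monoid_add))"
proof (induction N)
  case (Suc N)
  have "{-int (Suc N)..int (Suc N)} = insert (int (Suc N)) (insert (- int (Suc N)) {-int N..int N})"
    by auto
  then show ?case using Suc by (simp add: add_ac)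
qed simp

text \<open>Splitting off the coefficient of index \<open>0\<close> and pairing \<open>\<plusminus>(k + 1)\<close> gives an ordinary series; its
  terms vanish for half of the indices if \<open>h\<close> has a parity under the half-period shift.\<close>

lemma parseval:
  assumes "continuous_on UNIV h" "h (2*pi) = h 0"
  shows "(\<lambda>k. (cmod (coef h (int (Suc k))))\<^sup>2 + (cmod (coef h (- int (Suc k))))\<^sup>2)
           sums (energy h - (cmod (coef h 0))\<^sup>2)"
proof -
  have "((\<lambda>N. energy h - (cmod (coef h 0))\<^sup>2 - tail h N) \<longlongrightarrow> energy h - (cmod (coef h 0))\<^sup>2 - 0) sequentially"
    by (intro tendsto_intros tail_tendsto_0_continuous assms)
  then show ?thesis
    unfolding sums_def tail_def sum_symmetric_interval by (simp add: algebra_simps)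
qed

lemma integral_periodic_parts:
  fixes F :: "real \<Rightarrow> complex"
  assumes "\<And>s. (F has_vector_derivative F' s) (at s)" "continuous_on UNIV F'" "F (2*pi) = F 0"
  shows "integral\<^sup>L circ F' = 0"
  using integral_circ_derivative[OF assms(1,2)] assms(3) by simp

text \<open>Dividing by \<open>\<omega>\<close> turns the derivative in \<open>s\<close> into the derivative in the angle, which acts
  diagonally on the powers of \<open>u\<close>.\<close>

lemma coef_derivative:
  fixes h h' :: "real \<Rightarrow> complex"
  assumes h': "\<And>s. (h has_vector_derivative h' s) (at s)" and c: "continuous_on UNIV h'"
    and p: "h (2*pi) = h 0"
  shows "coef (\<lambda>s. h' s / \<omega> s) m = \<i> * m * coef h m"
proof -
  have hc: "continuous_on UNIV h"
    by (intro continuous_at_imp_continuous_on ballI has_vector_derivative_continuous[OF h'])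
  have "(LINT s|circ. h s * (\<i> * of_int (-m) * \<omega> s * u s powi (-m)) + h' s * u s powi (-m)) = 0"
    by (intro integral_periodic_parts[of "\<lambda>s. h s * u s powi (-m)"] has_vector_derivative_mult h' powi_deriv
        continuous_intros hc c u_cont \<omega>_cont) (simp_all add: p u_per)
  moreover have "integrable circ (\<lambda>s. h s * (\<i> * of_int (-m) * \<omega> s * u s powi (-m)))"
    "integrable circ (\<lambda>s. h' s * u s powi (-m))"
    by (intro integrable_circ_continuous continuous_intros hc c u_cont \<omega>_cont; simp)+
  ultimately have "(LINT s|circ. h' s * u s powi (-m)) = - (LINT s|circ. h s * (\<i> * of_int (-m) * \<omega> s * u s powi (-m)))"
    by (simp add: eq_neg_iff_add_eq_0 add.commute)
  also have "(\<lambda>s. h s * (\<i> * of_int (-m) * \<omega> s * u s powi (-m))) = (\<lambda>s. (- \<i> * m) * (h s * (u s powi (-m) * \<omega> s)))"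
    by (simp add: mult_ac)
  finally have "(LINT s|circ. h' s * u s powi (-m)) = \<i> * m * (LINT s|circ. h s * (u s powi (-m) * \<omega> s))"
    by simp
  moreover have "(\<lambda>s. h' s / \<omega> s * (u s powi (-m) * \<omega> s)) = (\<lambda>s. h' s * u s powi (-m))"
  proof
    fix s show "h' s / \<omega> s * (u s powi (-m) * \<omega> s) = h' s * u s powi (-m)"
      using \<omega>_pos[of s] by (simp add: field_simps)
  qed
  ultimately show ?thesis by (simp add: coef_def)
qed

lemma parseval_derivative:
  fixes h h' :: "real \<Rightarrow> complex"
  assumes h': "\<And>s. (h has_vector_derivative h' s) (at s)" and c: "continuous_on UNIV h'"
    and p: "h (2*pi) = h 0" "h' (2*pi) / \<omega> (2*pi) = h' 0 / \<omega> 0"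
  shows "(\<lambda>k. (real (Suc k))\<^sup>2 * ((cmod (coef h (int (Suc k))))\<^sup>2 + (cmod (coef h (- int (Suc k))))\<^sup>2))
           sums energy (\<lambda>s. h' s / \<omega> s)"
proof -
  have "continuous_on UNIV (\<lambda>s. h' s / \<omega> s)"
    using \<omega>_pos by (intro continuous_intros c \<omega>_cont) (auto simp: less_imp_neq[symmetric])
  note P = parseval[OF this]
  have "(cmod (coef (\<lambda>s. h' s / \<omega> s) m))\<^sup>2 = (real_of_int m)\<^sup>2 * (cmod (coef h m))\<^sup>2" for m
    by (simp add: coef_derivative[OF h' c p(1)] norm_mult power_mult_distrib)
  note C = this
  have e0: "energy (\<lambda>s. h' s / \<omega> s) - (cmod (coef (\<lambda>s. h' s / \<omega> s) 0))\<^sup>2 = energy (\<lambda>s. h' s / \<omega> s)"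
    unfolding C by simp
  show ?thesis
    using P[OF p(2)] unfolding e0 unfolding C
    by (simp only: of_int_minus of_int_of_nat_eq power2_minus distrib_left)
qed

end

section \<open>Half-period shifts and weighted series\<close>

lemma integral_circ_shift:
  fixes g :: "real \<Rightarrow> 'a::euclidean_space"
  assumes "continuous_on UNIV g" "\<And>s. g (s + 2*pi) = g s"
  shows "(LINT s|circ. g (s + pi)) = integral\<^sup>L circ g"
proof -
  have io: "g integrable_on {a..b}" for a b
    by (intro integrable_continuous_real continuous_on_subset[OF assms(1)]) auto
  have sh: "integral {a..b} (\<lambda>s. g (s + c)) = integral {a+c..b+c} g" for a b c
    using integral_shift_Icc_real[of a b g c] by (simp add: o_def add.commute)
  have "(LINT s|circ. g (s + pi)) = integral {0..2*pi} (\<lambda>s. g (s + pi))"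
    by (intro integral_circ_eq_HK continuous_on_compose2[OF assms(1)] continuous_intros) auto
  also have "\<dots> = integral {pi..3*pi} g"
    using sh[of 0 "2*pi" pi] by (simp add: algebra_simps)
  also have "\<dots> = integral {pi..2*pi} g + integral {2*pi..3*pi} g"
    by (rule Henstock_Kurzweil_Integration.integral_combine[symmetric]) (auto intro: io)
  also have "integral {2*pi..3*pi} g = integral {0..pi} g"
    using sh[of 0 pi "2*pi"] assms(2) by simp
  also have "integral {pi..2*pi} g + integral {0..pi} g = integral {0..2*pi} g"
    by (subst add.commute, rule Henstock_Kurzweil_Integration.integral_combine) (auto intro: io)
  finally show ?thesis using integral_circ_eq_HK[OF assms(1)] by simp
qed

lemma integral_antiperiodic:
  fixes g :: "real \<Rightarrow> complex"
  assumes "continuous_on UNIV g" "\<And>s. g (s + pi) = - g s"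
  shows "integral\<^sup>L circ g = 0"
proof -
  have "g (s + 2*pi) = g s" for s
    using assms(2)[of "s + pi"] assms(2)[of s] by (simp add: algebra_simps)
  from integral_circ_shift[OF assms(1) this] show ?thesis
    by (simp add: assms(2))
qed

text \<open>This is how a linear constraint controls a negative mode: \<open>S\<close> is the coefficient of that mode
  expressed by the others, \<open>l k\<close> are the weights of the others in the quadratic form, and \<open>\<sigma>\<close> is the
  positive part of the form.\<close>

lemma weighted_cauchy_schwarz_series:
  fixes a c :: "nat \<Rightarrow> complex" and e l :: "nat \<Rightarrow> real"
  assumes S: "(\<lambda>k. c k * a k) sums S" and e: "(\<lambda>k. l k * e k) sums \<sigma>"
    and l: "\<And>k. l k > 0" and ae: "\<And>k. (cmod (a k))\<^sup>2 \<le> e k"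
    and L: "\<And>n. (\<Sum>k<n. 1 / l k) \<le> \<Lambda>" and c: "\<And>k. cmod (c k) \<le> \<tau>"
  shows "(cmod S)\<^sup>2 \<le> \<tau>\<^sup>2 * (\<Lambda> * \<sigma>)"
proof -
  have \<tau>: "\<tau> \<ge> 0" using c[of 0] norm_ge_zero[of "c 0"] by linarith
  have le0: "0 \<le> l k * e k" for k
    using l[of k] ae[of k] zero_le_power2[of "cmod (a k)"] by (intro mult_nonneg_nonneg) linarith+
  have part: "(cmod (\<Sum>k<n. c k * a k))\<^sup>2 \<le> \<tau>\<^sup>2 * (\<Lambda> * \<sigma>)" for n
  proof -
    have "cmod (\<Sum>k<n. c k * a k) \<le> (\<Sum>k<n. \<tau> * cmod (a k))"
      by (rule order_trans[OF norm_sum])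
         (auto simp: norm_mult intro!: sum_mono mult_right_mono c)
    also have "\<dots> = \<tau> * (\<Sum>k<n. (1 / sqrt (l k)) * (sqrt (l k) * cmod (a k)))"
      using l by (simp add: sum_distrib_left less_imp_neq[symmetric])
    finally have "(cmod (\<Sum>k<n. c k * a k))\<^sup>2
        \<le> (\<tau> * (\<Sum>k<n. (1 / sqrt (l k)) * (sqrt (l k) * cmod (a k))))\<^sup>2"
      by (intro power_mono) auto
    also have "\<dots> \<le> \<tau>\<^sup>2 * ((\<Sum>k<n. (1 / sqrt (l k))\<^sup>2) * (\<Sum>k<n. (sqrt (l k) * cmod (a k))\<^sup>2))"
      unfolding power_mult_distrib[of \<tau>] by (intro mult_left_mono Cauchy_Schwarz_ineq_sum) auto
    also have "(\<Sum>k<n. (1 / sqrt (l k))\<^sup>2) = (\<Sum>k<n. 1 / l k)"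
      using l by (simp add: power_divide less_imp_le)
    also have "(\<Sum>k<n. (sqrt (l k) * cmod (a k))\<^sup>2) = (\<Sum>k<n. l k * (cmod (a k))\<^sup>2)"
      using l by (simp add: power_mult_distrib less_imp_le)
    also have "\<tau>\<^sup>2 * ((\<Sum>k<n. 1 / l k) * (\<Sum>k<n. l k * (cmod (a k))\<^sup>2)) \<le> \<tau>\<^sup>2 * (\<Lambda> * \<sigma>)"
    proof (intro mult_left_mono mult_mono L)
      have "(\<Sum>k<n. l k * (cmod (a k))\<^sup>2) \<le> (\<Sum>k<n. l k * e k)"
        using l ae by (intro sum_mono mult_left_mono) (auto simp: less_imp_le)
      also have "\<dots> \<le> \<sigma>"
        using sum_le_suminf[OF sums_summable[OF e], of "{..<n}"] le0 sums_unique[OF e] by simp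
      finally show "(\<Sum>k<n. l k * (cmod (a k))\<^sup>2) \<le> \<sigma>" .
      show "0 \<le> \<Lambda>" using L[of 0] by simp
      show "0 \<le> (\<Sum>k<n. l k * (cmod (a k))\<^sup>2)"
        using l by (intro sum_nonneg) (auto simp: less_imp_le)
    qed auto
    finally show ?thesis .
  qed
  have "(\<lambda>n. (cmod (\<Sum>k<n. c k * a k))\<^sup>2) \<longlonglongrightarrow> (cmod S)\<^sup>2"
    using S unfolding sums_def by (intro tendsto_intros)
  then show ?thesis by (rule LIMSEQ_le_const2) (use part in auto)
qed

context circle_coordinate begin

lemma one_minus_nz: "0 \<le> \<rho> \<Longrightarrow> \<rho> < 1 \<Longrightarrow> 1 - complex_of_real \<rho> * u s powi d \<noteq> 0"
proof
  assume "0 \<le> \<rho>" "\<rho> < 1" "1 - complex_of_real \<rho> * u s powi d = 0"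
  then have "cmod (complex_of_real \<rho> * u s powi d) = 1" by (metis norm_one right_minus_eq)
  with \<open>\<rho> < 1\<close> \<open>0 \<le> \<rho>\<close> show False by (simp add: norm_mult)
qed

text \<open>The geometric series of \<open>1 / (1 - \<rho> u\<^sup>d)\<close> may be integrated term by term, since its remainder
  after \<open>n\<close> terms carries the factor \<open>\<rho>\<^sup>n\<close>.\<close>

lemma geometric_coef_sums:
  assumes h: "continuous_on UNIV h" and \<rho>: "0 \<le> \<rho>" "\<rho> < 1"
  shows "(\<lambda>k. complex_of_real (\<rho> ^ k) * coef h (- (j + d * int k)))
    sums ((LINT s|circ. h s * (u s powi j / (1 - \<rho> * u s powi d) * \<omega> s)) / W)"
proof -
  let ?q = "\<lambda>s. complex_of_real \<rho> * u s powi d"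
  let ?g = "\<lambda>s. h s * (u s powi j / (1 - ?q s) * \<omega> s)"
  let ?R = "\<lambda>n. LINT s|circ. ?q s ^ n * ?g s"
  have gc: "continuous_on UNIV ?g"
    using one_minus_nz[OF \<rho>] by (intro continuous_intros h powi_cont \<omega>_cont) auto
  have qc: "continuous_on UNIV (\<lambda>s. ?q s ^ n * ?g s)" for n
    by (intro continuous_intros gc powi_cont)
  have step: "complex_of_real (\<rho> ^ n) * coef h (- (j + d * int n)) = ?R n / W - ?R (Suc n) / W" for n
  proof -
    have "?R n - ?R (Suc n) = (LINT s|circ. ?q s ^ n * ?g s - ?q s ^ Suc n * ?g s)"
      by (rule Bochner_Integration.integral_diff[symmetric]; rule integrable_circ_continuous[OF qc])
    also have "(\<lambda>s. ?q s ^ n * ?g s - ?q s ^ Suc n * ?g s)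
        = (\<lambda>s. complex_of_real (\<rho> ^ n) * (h s * (u s powi (- (- (j + d * int n))) * \<omega> s)))"
    proof
      fix s
      have "?q s ^ n * ?g s - ?q s ^ Suc n * ?g s = ?q s ^ n * (h s * (u s powi j * \<omega> s)) * ((1 - ?q s) / (1 - ?q s))"
      proof -
        have alg: "q ^ n * (X / D) - q ^ Suc n * (X / D) = q ^ n * X * ((1 - q) / D)" for q X D :: complex
          by (simp add: algebra_simps diff_divide_distrib)
        have g: "?g s = h s * (u s powi j * \<omega> s) / (1 - ?q s)" by simp
        show ?thesis unfolding g by (rule alg)
      qed
      also have "\<dots> = ?q s ^ n * (h s * (u s powi j * \<omega> s))"
        using one_minus_nz[OF \<rho>, of s d] by simp
      also have "\<dots> = complex_of_real (\<rho> ^ n) * (h s * (u s powi (- (- (j + d * int n))) * \<omega> s))"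
        by (simp add: power_int_add power_mult_distrib power_int_mult mult_ac)
      finally show "?q s ^ n * ?g s - ?q s ^ Suc n * ?g s
          = complex_of_real (\<rho> ^ n) * (h s * (u s powi (- (- (j + d * int n))) * \<omega> s))" .
    qed
    finally show ?thesis
      unfolding coef_def diff_divide_distrib[symmetric] by (simp only: integral_mult_right_zero times_divide_eq_right)
  qed
  have "?R \<longlonglongrightarrow> 0"
  proof (rule Lim_null_comparison)
    show "\<forall>\<^sub>F n in sequentially. norm (?R n) \<le> \<rho> ^ n * (LINT s|circ. cmod (?g s))"
    proof (rule eventuallyI)
      fix n
      have "norm (?R n) \<le> (LINT s|circ. cmod (?q s ^ n * ?g s))"
        by (rule integral_norm_bound)
      also have "(\<lambda>s. cmod (?q s ^ n * ?g s)) = (\<lambda>s. \<rho> ^ n * cmod (?g s))"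
        using \<rho> by (intro ext) (simp only: norm_mult norm_power norm_powi norm_of_real abs_of_nonneg mult_1_right)
      finally show "norm (?R n) \<le> \<rho> ^ n * (LINT s|circ. cmod (?g s))" by simp
    qed
    show "(\<lambda>n. \<rho> ^ n * (LINT s|circ. cmod (?g s))) \<longlonglongrightarrow> 0"
      using \<rho> by (intro tendsto_mult_left_zero LIMSEQ_realpow_zero)
  qed
  then have "(\<lambda>n. ?R n / complex_of_real W) \<longlonglongrightarrow> 0 / complex_of_real W"
    using W_pos by (intro tendsto_intros) auto
  from telescope_sums'[OF this] show ?thesis
    unfolding step by simp
qed

end

text \<open>Trigonometric series are the case of the standard parametrisation.\<close>

interpretation cis: circle_coordinate cis "\<lambda>_. 1"
proof
  show "cmod (cis s) = 1" for s by simp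
  show "(cis has_vector_derivative \<i> * complex_of_real 1 * cis s) (at s)" for s
    using has_derivative_cis[OF has_derivative_ident, of s UNIV] by (simp add: has_vector_derivative_def)
  show "cis (2 * pi) = cis 0" by simp
  show "s = t" if "s \<in> {0..<2*pi}" "t \<in> {0..<2*pi}" "cis s = cis t" for s t
  proof -
    have "cos s = cos t" "sin s = sin t" using that(3) by (auto simp: complex_eq_iff)
    then obtain n :: int where n: "s = t + 2 * pi * n" using sin_cos_eq_iff[of s t] by auto
    have "\<bar>2 * pi * n\<bar> < 2 * pi * 1" using that(1,2) unfolding n by auto
    then have "\<bar>real_of_int n\<bar> < 1" by (simp add: abs_mult)
    then show ?thesis using n by simp
  qed
qed auto

section \<open>The angular coordinate of an ellipse\<close>

text \<open>The ellipse as a curve \<open>\<xi>\<close> in the complex plane with velocity \<open>\<eta>\<close>, in polar form \<open>\<xi> = r u\<close>. The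
  angular speed \<open>\<omega>\<close> follows from Kepler's area law, and \<open>\<rho>\<close> is the ratio of the amplitudes of \<open>e\<^sup>-\<^sup>i\<^sup>s\<close>
  and \<open>e\<^sup>i\<^sup>s\<close> in \<open>\<xi>\<close>.\<close>

locale ellipse_geometry =
  fixes \<alpha> \<beta> :: real
  assumes \<alpha>\<beta>: "\<alpha> \<ge> \<beta>" "\<beta> > 0"
begin

definition \<xi> :: "real \<Rightarrow> complex" where
  "\<xi> s = complex_of_real (\<alpha> * cos s) + \<i> * complex_of_real (\<beta> * sin s)"

definition \<eta> :: "real \<Rightarrow> complex" where
  "\<eta> s = - complex_of_real (\<alpha> * sin s) + \<i> * complex_of_real (\<beta> * cos s)"

definition r :: "real \<Rightarrow> real" where "r s = cmod (\<xi> s)"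

definition u :: "real \<Rightarrow> complex" where "u s = \<xi> s / r s"

definition \<omega> :: "real \<Rightarrow> real" where "\<omega> s = \<alpha> * \<beta> / (r s)\<^sup>2"

definition \<rho> :: real where "\<rho> = (\<alpha> - \<beta>) / (\<alpha> + \<beta>)"

lemma \<alpha>_pos: "\<alpha> > 0" using \<alpha>\<beta> by simp

lemma \<rho>: "0 \<le> \<rho>" "\<rho> < 1"
  using \<alpha>\<beta> by (auto simp: \<rho>_def)

lemma r_square: "(r s)\<^sup>2 = (\<alpha> * cos s)\<^sup>2 + (\<beta> * sin s)\<^sup>2"
  unfolding r_def cmod_power2 by (simp add: \<xi>_def)

lemma r_bounds: "\<beta> \<le> r s" "r s \<le> \<alpha>"
proof -
  have "(\<beta>::real)\<^sup>2 = \<beta>\<^sup>2 * (cos s)\<^sup>2 + \<beta>\<^sup>2 * (sin s)\<^sup>2" "\<alpha>\<^sup>2 = \<alpha>\<^sup>2 * (cos s)\<^sup>2 + \<alpha>\<^sup>2 * (sin s)\<^sup>2"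
    by (simp_all flip: distrib_left)
  moreover have "\<beta>\<^sup>2 \<le> \<alpha>\<^sup>2" using \<alpha>\<beta> by (intro power_mono) auto
  ultimately have "\<beta>\<^sup>2 \<le> (r s)\<^sup>2" "(r s)\<^sup>2 \<le> \<alpha>\<^sup>2"
    unfolding r_square power_mult_distrib
    using mult_right_mono[of "\<beta>\<^sup>2" "\<alpha>\<^sup>2" "(cos s)\<^sup>2"] mult_right_mono[of "\<beta>\<^sup>2" "\<alpha>\<^sup>2" "(sin s)\<^sup>2"]
    by auto
  then show "\<beta> \<le> r s" "r s \<le> \<alpha>"
    using \<alpha>\<beta> \<alpha>_pos by (auto simp: r_def intro: power2_le_imp_le)
qed

lemma r_pos: "r s > 0" using r_bounds(1)[of s] \<alpha>\<beta> by linarith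

lemma \<xi>_nz: "\<xi> s \<noteq> 0" using r_pos[of s] by (auto simp: r_def)

lemma \<xi>_eq: "\<xi> s = r s * u s" using r_pos[of s] by (simp add: u_def)

lemma \<xi>_deriv: "(\<xi> has_vector_derivative \<eta> s) (at s)"
  unfolding has_vector_derivative_complex_iff
  by (auto simp: \<xi>_def \<eta>_def intro!: derivative_eq_intros)

lemma \<xi>_cont: "continuous_on UNIV \<xi>" unfolding \<xi>_def by (intro continuous_intros)
lemma \<eta>_cont: "continuous_on UNIV \<eta>" unfolding \<eta>_def by (intro continuous_intros)
lemma r_cont: "continuous_on UNIV r" unfolding r_def by (intro continuous_intros \<xi>_cont)
lemma \<omega>_cont: "continuous_on UNIV \<omega>"
  unfolding \<omega>_def using r_pos by (intro continuous_intros r_cont) (auto simp: less_imp_neq[symmetric])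

lemma \<omega>_pos: "\<omega> s > 0" using \<alpha>\<beta> \<alpha>_pos r_pos[of s] by (simp add: \<omega>_def)

text \<open>\<open>r r'\<close> is the real part and the conserved angular momentum \<open>\<alpha>\<beta>\<close> the imaginary part of
  the same product.\<close>

definition rr' :: "real \<Rightarrow> real" where "rr' s = (\<beta>\<^sup>2 - \<alpha>\<^sup>2) * sin s * cos s"

lemma cnj_\<xi>_\<eta>: "cnj (\<xi> s) * \<eta> s = rr' s + \<i> * (\<alpha> * \<beta>)"
proof (rule complex_eqI)
  show "Re (cnj (\<xi> s) * \<eta> s) = Re (rr' s + \<i> * (\<alpha> * \<beta>))"
    by (simp add: \<xi>_def \<eta>_def rr'_def power2_eq_square algebra_simps)
  have "Im (cnj (\<xi> s) * \<eta> s) = (\<alpha> * cos s) * (\<beta> * cos s) + (\<beta> * sin s) * (\<alpha> * sin s)"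
    by (simp add: \<xi>_def \<eta>_def)
  also have "\<dots> = \<alpha> * \<beta> * ((cos s)\<^sup>2 + (sin s)\<^sup>2)"
    by (simp only: power2_eq_square distrib_left mult_ac)
  also have "\<dots> = \<alpha> * \<beta>" by simp
  finally show "Im (cnj (\<xi> s) * \<eta> s) = Im (rr' s + \<i> * (\<alpha> * \<beta>))"
    by simp
qed

lemma r_deriv: "(r has_real_derivative (rr' s / r s)) (at s)"
proof -
  have rs: "r = (\<lambda>s. sqrt ((\<alpha> * cos s)\<^sup>2 + (\<beta> * sin s)\<^sup>2))"
    using r_pos by (auto simp: r_square[symmetric] less_imp_le)
  have p: "(\<alpha> * cos s)\<^sup>2 + (\<beta> * sin s)\<^sup>2 > 0" using r_pos[of s] by (simp flip: r_square)
  have q: "sqrt ((\<alpha> * cos s)\<^sup>2 + (\<beta> * sin s)\<^sup>2) = r s" using rs by metis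
  have "((\<lambda>s. (\<alpha> * cos s)\<^sup>2 + (\<beta> * sin s)\<^sup>2) has_real_derivative 2 * rr' s) (at s)"
    by (rule derivative_eq_intros refl)+ (simp add: rr'_def power2_eq_square algebra_simps)
  from DERIV_chain2[OF DERIV_real_sqrt[OF p] this]
  have "((\<lambda>s. sqrt ((\<alpha> * cos s)\<^sup>2 + (\<beta> * sin s)\<^sup>2)) has_real_derivative (inverse (r s) / 2 * (2 * rr' s))) (at s)"
    unfolding q .
  then have "(r has_real_derivative (inverse (r s) / 2 * (2 * rr' s))) (at s)"
    unfolding rs[symmetric] .
  then show ?thesis
    by (rule DERIV_cong) (simp add: field_simps)
qed

lemma rr'_deriv: "(rr' has_real_derivative ((cmod (\<eta> s))\<^sup>2 - (r s)\<^sup>2)) (at s)"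
  unfolding r_square cmod_power2 rr'_def
  by (rule derivative_eq_intros refl)+ (simp add: \<eta>_def power2_eq_square algebra_simps)

lemma rr'_cont: "continuous_on UNIV rr'" unfolding rr'_def by (intro continuous_intros)

lemma norm_\<eta>_r: "(r s)\<^sup>2 * (cmod (\<eta> s))\<^sup>2 = (rr' s)\<^sup>2 + (\<alpha> * \<beta>)\<^sup>2"
proof -
  have "(r s)\<^sup>2 * (cmod (\<eta> s))\<^sup>2 = (cmod (cnj (\<xi> s) * \<eta> s))\<^sup>2"
    by (simp add: norm_mult r_def power_mult_distrib)
  also have "\<dots> = (rr' s)\<^sup>2 + (\<alpha> * \<beta>)\<^sup>2"
    unfolding cnj_\<xi>_\<eta> cmod_power2 by simp
  finally show ?thesis .
qed

lemma u_deriv: "(u has_vector_derivative (\<i> * \<omega> s * u s)) (at s)"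
proof -
  have "((\<lambda>s. inverse (r s) *\<^sub>R \<xi> s) has_vector_derivative
      (inverse (r s) *\<^sub>R \<eta> s + (- (rr' s / r s) / (r s)\<^sup>2) *\<^sub>R \<xi> s)) (at s)"
  proof (rule has_vector_derivative_scaleR)
    show "((\<lambda>s. inverse (r s)) has_real_derivative - (rr' s / r s) / (r s)\<^sup>2) (at s)"
      using r_pos[of s]
      by (auto intro!: derivative_eq_intros r_deriv simp: power2_eq_square divide_inverse)
  qed (rule \<xi>_deriv)
  moreover have "(\<lambda>s. inverse (r s) *\<^sub>R \<xi> s) = u"
    by (auto simp: u_def scaleR_conv_of_real divide_inverse mult.commute)
  moreover have "inverse (r s) *\<^sub>R \<eta> s + (- (rr' s / r s) / (r s)\<^sup>2) *\<^sub>R \<xi> s = \<i> * \<omega> s * u s"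
  proof -
    have "complex_of_real ((r s)\<^sup>2) = \<xi> s * cnj (\<xi> s)"
      unfolding r_def by (rule complex_norm_square)
    then have "of_real ((r s)\<^sup>2) * \<eta> s = \<xi> s * (cnj (\<xi> s) * \<eta> s)"
      by (simp only: mult.assoc)
    also have "\<dots> = \<xi> s * (rr' s + \<i> * (\<alpha> * \<beta>))" by (simp only: cnj_\<xi>_\<eta>)
    finally have "\<eta> s = \<xi> s * (rr' s + \<i> * (\<alpha> * \<beta>)) / of_real ((r s)\<^sup>2)"
      using r_pos[of s] by (simp add: field_simps)
    then show ?thesis
      using r_pos[of s]
      by (simp add: u_def \<omega>_def scaleR_conv_of_real field_simps power2_eq_square)
  qed
  ultimately show ?thesis by simp
qed

lemma \<xi>_antiper: "\<xi> (s + pi) = - \<xi> s" by (simp add: \<xi>_def)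
lemma \<eta>_antiper: "\<eta> (s + pi) = - \<eta> s" by (simp add: \<eta>_def)
lemma r_per: "r (s + pi) = r s" by (simp add: r_def \<xi>_antiper)
lemma u_antiper: "u (s + pi) = - u s" by (simp add: u_def \<xi>_antiper r_per)
lemma \<omega>_per: "\<omega> (s + pi) = \<omega> s" by (simp add: \<omega>_def r_per)

sublocale ang: circle_coordinate u \<omega>
proof
  show "cmod (u s) = 1" for s
    unfolding u_def norm_divide norm_of_real abs_of_pos[OF r_pos] unfolding r_def
    by (rule divide_self) (simp add: \<xi>_nz)
  show "(u has_vector_derivative \<i> * complex_of_real (\<omega> s) * u s) (at s)" for s by (rule u_deriv)
  show "continuous_on UNIV \<omega>" by (rule \<omega>_cont)
  show "0 < \<omega> s" for s by (rule \<omega>_pos)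
  show "u (2 * pi) = u 0" using u_antiper[of 0] u_antiper[of pi] by simp
  show "s = t" if st: "s \<in> {0..<2*pi}" "t \<in> {0..<2*pi}" "u s = u t" for s t
  proof -
    have e: "cos s = (r s / r t) * cos t" "sin s = (r s / r t) * sin t"
    proof -
      have "\<xi> s = r s * u t" using st(3) by (simp add: \<xi>_eq)
      also have "\<dots> = complex_of_real (r s / r t) * \<xi> t" using r_pos[of t] by (simp add: u_def)
      finally have "Re (\<xi> s) = (r s / r t) * Re (\<xi> t)" "Im (\<xi> s) = (r s / r t) * Im (\<xi> t)"
        by (simp_all only: Re_complex_of_real Im_complex_of_real times_complex.simps mult_zero_left diff_0_right add_0_right)
      then have "\<alpha> * cos s = \<alpha> * ((r s / r t) * cos t)" "\<beta> * sin s = \<beta> * ((r s / r t) * sin t)"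
        by (simp_all add: \<xi>_def)
      then show "cos s = (r s / r t) * cos t" "sin s = (r s / r t) * sin t"
        by (simp_all only: mult_cancel_left less_imp_neq[OF \<alpha>_pos, symmetric]
            less_imp_neq[OF \<alpha>\<beta>(2), symmetric] simp_thms)
    qed
    have "1 = (cos s)\<^sup>2 + (sin s)\<^sup>2" by simp
    also have "\<dots> = (r s / r t)\<^sup>2 * ((cos t)\<^sup>2 + (sin t)\<^sup>2)"
      by (subst e(1), subst e(2)) (simp only: power_mult_distrib distrib_left)
    finally have "(r s / r t)\<^sup>2 = 1" by simp
    then have one: "r s / r t = 1"
      using power2_eq_imp_eq[of "r s / r t" 1] divide_pos_pos[OF r_pos[of s] r_pos[of t]]
      by (metis less_imp_le one_power2 zero_le_one)
    have "cis s = cis t"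
      using e unfolding one by (simp add: complex_eq_iff)
    then show ?thesis by (rule cis.u_inj[OF st(1,2)])
  qed
qed

text \<open>The weight \<open>r\<^sup>2\<close> is a Poisson kernel in the angular coordinate: \<open>1 - \<rho> u\<^sup>2\<close> is, up to a
  constant and a phase, \<open>1 / conj \<xi>\<close>.\<close>

lemma poisson: "(r s)\<^sup>2 = \<alpha> * \<beta> * Re (1 / (1 - \<rho> * (u s)\<^sup>2) + 1 / (1 - \<rho> * (cnj (u s))\<^sup>2) - 1)"
proof -
  let ?w = "1 - \<rho> * (u s)\<^sup>2"
  have sum: "\<alpha> + \<beta> \<noteq> 0" using \<alpha>\<beta> by simp
  have uu: "(u s)\<^sup>2 * cnj (\<xi> s) = \<xi> s"
  proof -
    have "u s * cnj (u s) = 1" using ang.norm_u[of s] by (metis complex_norm_square of_real_1 power_one)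
    then have "(u s * cnj (u s)) * (r s * u s) = r s * u s" by (simp only: mult_1_left)
    then show ?thesis by (simp only: \<xi>_eq power2_eq_square complex_cnj_mult complex_cnj_complex_of_real mult_ac)
  qed
  have "?w * cnj (\<xi> s) = cnj (\<xi> s) - \<rho> * \<xi> s"
    by (simp add: left_diff_distrib uu mult.assoc)
  also have "\<dots> = (2 * \<alpha> * \<beta> / (\<alpha> + \<beta>)) * cis (- s)"
    using sum by (simp add: \<xi>_def \<rho>_def complex_eq_iff field_simps)
  finally have "cmod (?w * cnj (\<xi> s)) = cmod ((2 * \<alpha> * \<beta> / (\<alpha> + \<beta>)) * cis (- s))" by simp
  then have "cmod ?w * r s = 2 * \<alpha> * \<beta> / (\<alpha> + \<beta>)"
    using \<alpha>\<beta> \<alpha>_pos by (simp add: norm_mult norm_divide r_def flip: of_real_add of_real_mult of_real_divide)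
  then have wr: "(cmod ?w)\<^sup>2 * (r s)\<^sup>2 = (2 * \<alpha> * \<beta> / (\<alpha> + \<beta>))\<^sup>2"
    by (metis power_mult_distrib)
  have wnz: "?w \<noteq> 0"
    using ang.one_minus_nz[OF \<rho>, of s 2] by simp
  have "Re (1 / ?w + 1 / cnj ?w - 1) = (2 * Re ?w - (cmod ?w)\<^sup>2) / (cmod ?w)\<^sup>2"
  proof -
    have inv: "Re (1 / z) = Re z / (cmod z)\<^sup>2" for z
      by (simp add: Re_divide cmod_power2)
    have "(cmod ?w)\<^sup>2 / (cmod ?w)\<^sup>2 = 1" using wnz by simp
    then have "(2 * Re ?w - (cmod ?w)\<^sup>2) / (cmod ?w)\<^sup>2 = 2 * Re ?w / (cmod ?w)\<^sup>2 - 1"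
      by (simp only: diff_divide_distrib)
    moreover have "Re (1 / ?w + 1 / cnj ?w - 1) = 2 * Re ?w / (cmod ?w)\<^sup>2 - 1"
      by (simp only: minus_complex.simps plus_complex.simps one_complex.simps inv complex_cnj cnj.simps complex_mod_cnj)
    ultimately show ?thesis by simp
  qed
  also have "2 * Re ?w - (cmod ?w)\<^sup>2 = 1 - \<rho>\<^sup>2"
  proof -
    have "(cmod (\<rho> * (u s)\<^sup>2))\<^sup>2 = \<rho>\<^sup>2" by (simp add: norm_mult norm_power)
    then show ?thesis unfolding cmod_power2 by (simp add: power2_eq_square algebra_simps)
  qed
  also have "1 - \<rho>\<^sup>2 = 4 * \<alpha> * \<beta> / (\<alpha> + \<beta>)\<^sup>2"
    using sum by (simp add: \<rho>_def power_divide field_simps) (simp add: power2_eq_square algebra_simps)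
  finally have "\<alpha> * \<beta> * Re (1 / ?w + 1 / cnj ?w - 1) = (2 * \<alpha> * \<beta> / (\<alpha> + \<beta>))\<^sup>2 / (cmod ?w)\<^sup>2"
    by (simp add: power_divide power2_eq_square)
  also have "\<dots> = (r s)\<^sup>2"
    using wnz unfolding wr[symmetric] by simp
  finally show ?thesis by simp
qed

end

section \<open>Spectral gaps under the constraints\<close>

text \<open>Both sums telescope. Their limits \<open>1/2\<close> and \<open>1/3\<close> balance the weights and multiplicities of the
  negative modes below, so that of the Cauchy--Schwarz estimate only the factor \<open>\<rho>\<^sup>2\<close> remains.\<close>

lemma sum_inverse_even: "(\<Sum>k<n. 1 / ((2 * real k + 2)\<^sup>2 - 1)) = 1/2 - 1 / (2 * (2 * real n + 1))"
proof (induction n)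
  case (Suc n)
  have "1 / ((2 * real n + 2)\<^sup>2 - 1) = 1 / ((2 * real n + 1) * (2 * real n + 3))"
    by (simp add: power2_eq_square algebra_simps)
  also have "\<dots> = 1 / (2 * (2 * real n + 1)) - 1 / (2 * (2 * real (Suc n) + 1))"
    by (simp add: field_split_simps)
  finally show ?case using Suc by simp
qed simp

lemma sum_inverse_odd:
  "(\<Sum>k<n. 1 / ((2 * real k + 3)\<^sup>2 - 4)) = 1/3 - (1 / (2 * real n + 1) + 1 / (2 * real n + 3)) / 4"
proof (induction n)
  case (Suc n)
  have "1 / ((2 * real n + 3)\<^sup>2 - 4) = 1 / ((2 * real n + 1) * (2 * real n + 5))"
    by (simp add: power2_eq_square algebra_simps)
  also have "\<dots> = (1 / (2 * real n + 1) - 1 / (2 * real n + 5)) / 4"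
    by (simp add: field_split_simps)
  finally have step: "1 / ((2 * real n + 3)\<^sup>2 - 4) = (1 / (2 * real n + 1) - 1 / (2 * real n + 5)) / 4" .
  have nxt: "2 * real (Suc n) + 1 = 2 * real n + 3" "2 * real (Suc n) + 3 = 2 * real n + 5" by simp_all
  show ?case unfolding sum.lessThan_Suc Suc step nxt by argo
qed simp

context ellipse_geometry begin

lemma coef_parity:
  assumes "continuous_on UNIV h" "\<And>s. h (s + pi) = \<epsilon> * h s" "\<epsilon> * (if even m then 1 else -1) = -1"
  shows "ang.coef h m = 0"
proof -
  have "(LINT s|circ. h s * (u s powi (-m) * \<omega> s)) = 0"
  proof (rule integral_antiperiodic)
    show "continuous_on UNIV (\<lambda>s. h s * (u s powi (-m) * \<omega> s))"
      by (intro continuous_intros assms(1) ang.u_cont \<omega>_cont) simp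
    fix s
    have "h (s + pi) * (u (s + pi) powi (-m) * \<omega> (s + pi))
        = (\<epsilon> * (if even m then 1 else -1)) * (h s * (u s powi (-m) * \<omega> s))"
      by (simp add: assms(2) u_antiper \<omega>_per power_int_minus_left)
    then show "h (s + pi) * (u (s + pi) powi (-m) * \<omega> (s + pi)) = - (h s * (u s powi (-m) * \<omega> s))"
      unfolding assms(3) by simp
  qed
  then show ?thesis by (simp add: ang.coef_def)
qed

text \<open>Integration with respect to \<open>s\<close> is integration with respect to the angle against the Poisson
  kernel \<open>1/(1 - \<rho> u\<^sup>2) + 1/(1 - \<rho> u\<^sup>-\<^sup>2) - 1\<close>. The two fractions are kept separate because each
  of them expands into a geometric series.\<close>

lemma integral_poisson:
  fixes h :: "real \<Rightarrow> complex"
  assumes "continuous_on UNIV h"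
  shows "(LINT s|circ. h s) = (LINT s|circ. h s * (1 / (1 - \<rho> * u s powi 2) * \<omega> s))
     + (LINT s|circ. h s * (1 / (1 - \<rho> * u s powi (-2)) * \<omega> s)) - (LINT s|circ. h s * \<omega> s)"
proof -
  let ?a = "\<lambda>s. h s * (1 / (1 - \<rho> * u s powi 2) * \<omega> s)" and ?b = "\<lambda>s. h s * (1 / (1 - \<rho> * u s powi (-2)) * \<omega> s)"
  have i: "integrable circ ?a" "integrable circ ?b" "integrable circ (\<lambda>s. h s * \<omega> s)"
    using ang.one_minus_nz[OF \<rho>, of _ 2] ang.one_minus_nz[OF \<rho>, of _ "-2"]
    by (intro integrable_circ_continuous continuous_intros assms ang.u_cont \<omega>_cont; simp)+
  have "h s = ?a s + ?b s - h s * \<omega> s" for s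
  proof -
    let ?z = "1 - \<rho> * (u s)\<^sup>2"
    have c: "u s powi 2 = (u s)\<^sup>2" "u s powi (-2) = (cnj (u s))\<^sup>2"
      using ang.cnj_powi[of s 2] by simp_all
    have "1 / ?z + 1 / (1 - \<rho> * (cnj (u s))\<^sup>2) - 1
        = complex_of_real (Re (1 / ?z + 1 / (1 - \<rho> * (cnj (u s))\<^sup>2) - 1))"
    proof -
      have "cnj (1 / ?z) = 1 / (1 - \<rho> * (cnj (u s))\<^sup>2)" by simp
      then have "1 / ?z + 1 / (1 - \<rho> * (cnj (u s))\<^sup>2) = complex_of_real (2 * Re (1 / ?z))"
        using complex_add_cnj[of "1 / ?z"] by metis
      then show ?thesis by simp
    qed
    then have "(1 / ?z + 1 / (1 - \<rho> * (cnj (u s))\<^sup>2) - 1) * \<omega> s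
       = complex_of_real (Re (1 / ?z + 1 / (1 - \<rho> * (cnj (u s))\<^sup>2) - 1) * \<omega> s)"
      by (simp only: of_real_mult)
    also have "Re (1 / ?z + 1 / (1 - \<rho> * (cnj (u s))\<^sup>2) - 1) * \<omega> s = 1"
      using poisson[of s] \<alpha>_pos \<alpha>\<beta> r_pos[of s] by (simp add: \<omega>_def field_simps)
    finally have "h s = h s * ((1 / ?z + 1 / (1 - \<rho> * (cnj (u s))\<^sup>2) - 1) * \<omega> s)" by simp
    also have "\<dots> = ?a s + ?b s - h s * \<omega> s"
      unfolding c by (simp only: left_diff_distrib distrib_right distrib_left right_diff_distrib mult_1_left)
    finally show ?thesis .
  qed
  then have "(LINT s|circ. h s) = (LINT s|circ. ?a s + ?b s - h s * \<omega> s)" by presburger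
  also have "\<dots> = integral\<^sup>L circ ?a + integral\<^sup>L circ ?b - (LINT s|circ. h s * \<omega> s)"
    by (simp only: Bochner_Integration.integral_diff Bochner_Integration.integral_add
        Bochner_Integration.integrable_add i)
  finally show ?thesis .
qed

text \<open>Only even modes occur. Mode \<open>0\<close> contributes \<open>-|c\<^sub>0|\<^sup>2\<close> to the left-hand side, the modes \<open>\<plusminus>(2j + 2)\<close>
  contribute with weight \<open>l j = (2j + 2)\<^sup>2 - 1\<close>, in total \<open>\<sigma>\<close>. The vanishing integral expresses \<open>c\<^sub>0\<close> by
  the other modes, which yields \<open>|c\<^sub>0|\<^sup>2 \<le> \<rho>\<^sup>2 \<sigma>\<close>; so the left-hand side is at least \<open>(1 - \<rho>\<^sup>2) \<sigma>\<close>.\<close>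

lemma even_energy_gap:
  fixes p p' :: "real \<Rightarrow> complex"
  assumes p': "\<And>s. (p has_vector_derivative p' s) (at s)" and c': "continuous_on UNIV p'"
    and per: "\<And>s. p (s + pi) = p s" "\<And>s. p' (s + pi) = p' s" and zero: "(LINT s|circ. p s) = 0"
  shows "ang.energy (\<lambda>s. p' s / \<omega> s) - ang.energy p \<ge> (1 - \<rho>\<^sup>2) / 2 * ang.energy p"
proof -
  have pc: "continuous_on UNIV p"
    by (intro continuous_at_imp_continuous_on ballI has_vector_derivative_continuous[OF p'])
  define c where "c = ang.coef p"
  define A where "A = ang.energy p"
  define A' where "A' = ang.energy (\<lambda>s. p' s / \<omega> s)"
  define E where "E j = (cmod (c (2 * int j + 2)))\<^sup>2 + (cmod (c (- (2 * int j + 2))))\<^sup>2" for j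
  define l where "l j = (2 * real j + 2)\<^sup>2 - 1" for j
  have odd0: "c m = 0" if "odd m" for m
    unfolding c_def by (rule coef_parity[OF pc, of 1]) (use per that in auto)
  have p2: "p (2*pi) = p 0" using per(1)[of pi] per(1)[of 0] by simp
  have q2: "p' (2*pi) / \<omega> (2*pi) = p' 0 / \<omega> 0"
    using per(2)[of pi] per(2)[of 0] \<omega>_per[of pi] \<omega>_per[of 0] by simp
  have sub: "strict_mono (\<lambda>j::nat. 2 * j + 1)" by (simp add: strict_mono_def)
  have out: "even n" if "n \<notin> range (\<lambda>j::nat. 2 * j + 1)" for n using that by (metis oddE rangeI)
  have vanish: "(cmod (c (int (Suc n))))\<^sup>2 + (cmod (c (- int (Suc n))))\<^sup>2 = 0"
    if "n \<notin> range (\<lambda>j::nat. 2 * j + 1)" for n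
    using out[OF that] odd0[of "int (Suc n)"] odd0[of "- int (Suc n)"] by auto
  have S1: "E sums (A - (cmod (c 0))\<^sup>2)"
  proof -
    have "(\<lambda>j. (\<lambda>k. (cmod (c (int (Suc k))))\<^sup>2 + (cmod (c (- int (Suc k))))\<^sup>2) (2 * j + 1)) sums (A - (cmod (c 0))\<^sup>2)"
      using ang.parseval[OF pc p2] unfolding c_def[symmetric] A_def[symmetric]
      by (subst sums_mono_reindex[OF sub]) (erule vanish | assumption)+
    then show ?thesis by (simp add: E_def[abs_def] algebra_simps)
  qed
  have S2: "(\<lambda>j. (2 * real j + 2)\<^sup>2 * E j) sums A'"
  proof -
    have "(\<lambda>j. (\<lambda>k. (real (Suc k))\<^sup>2 * ((cmod (c (int (Suc k))))\<^sup>2 + (cmod (c (- int (Suc k))))\<^sup>2)) (2 * j + 1)) sums A'"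
      using ang.parseval_derivative[OF p' c' p2 q2] unfolding c_def[symmetric] A'_def[symmetric]
      by (subst sums_mono_reindex[OF sub]) ((subst vanish, assumption, rule mult_zero_right) | assumption)+
    moreover have "int (Suc (2 * j + 1)) = 2 * int j + 2" "real (Suc (2 * j + 1)) = 2 * real j + 2" for j
      by simp_all
    ultimately show ?thesis by (simp only: E_def)
  qed
  define \<sigma> where "\<sigma> = A' - (A - (cmod (c 0))\<^sup>2)"
  have S3: "(\<lambda>j. l j * E j) sums \<sigma>"
    using sums_diff[OF S2 S1] by (simp add: l_def \<sigma>_def left_diff_distrib)
  have series: "(\<lambda>k. complex_of_real (\<rho> ^ Suc k) * (c (2 * int k + 2) + c (- (2 * int k + 2)))) sums (- c 0)"
  proof -
    have "(\<lambda>k. complex_of_real (\<rho> ^ k) * c (- (0 + 2 * int k)) + complex_of_real (\<rho> ^ k) * c (- (0 + - 2 * int k)))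
      sums ((LINT s|circ. p s * (u s powi 0 / (1 - \<rho> * u s powi 2) * \<omega> s)) / ang.W
          + (LINT s|circ. p s * (u s powi 0 / (1 - \<rho> * u s powi (-2)) * \<omega> s)) / ang.W)"
      unfolding c_def by (intro sums_add ang.geometric_coef_sums pc \<rho>)
    also have "(LINT s|circ. p s * (u s powi 0 / (1 - \<rho> * u s powi 2) * \<omega> s)) / ang.W
          + (LINT s|circ. p s * (u s powi 0 / (1 - \<rho> * u s powi (-2)) * \<omega> s)) / ang.W = c 0"
    proof -
      have "(LINT s|circ. p s * (1 / (1 - \<rho> * u s powi 2) * \<omega> s))
          + (LINT s|circ. p s * (1 / (1 - \<rho> * u s powi (-2)) * \<omega> s)) = (LINT s|circ. p s * \<omega> s)"
        by (rule iffD2[OF eq_iff_diff_eq_0]) (rule trans[OF integral_poisson[OF pc, symmetric] zero])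
      then show ?thesis
        unfolding c_def ang.coef_def add_divide_distrib[symmetric] power_int_0_right minus_zero mult_1_left
        by (rule arg_cong)
    qed
    finally have "(\<lambda>k. complex_of_real (\<rho> ^ k) * c (- (0 + 2 * int k)) + complex_of_real (\<rho> ^ k) * c (- (0 + - 2 * int k))) sums c 0" .
    then have "(\<lambda>k. complex_of_real (\<rho> ^ Suc k) * c (- (0 + 2 * int (Suc k))) + complex_of_real (\<rho> ^ Suc k) * c (- (0 + - 2 * int (Suc k)))) sums (c 0 - (c 0 + c 0))"
      by (subst sums_Suc_iff) simp
    then show ?thesis by (simp add: algebra_simps)
  qed
  have E0: "E j \<ge> 0" for j by (simp add: E_def)
  have l3: "l j \<ge> 3" for j
  proof -
    have "(2::real)\<^sup>2 \<le> (2 * real j + 2)\<^sup>2" by (intro power_mono) auto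
    then show ?thesis by (simp add: l_def)
  qed
  \<comment> \<open>the factor \<open>2\<close> accounts for the pair \<open>\<plusminus>(2k + 2)\<close> in each term of the series\<close>
  have "(cmod (- c 0))\<^sup>2 \<le> \<rho>\<^sup>2 * (1/2 * (2 * \<sigma>))"
  proof (rule weighted_cauchy_schwarz_series[OF series, of l "\<lambda>j. 2 * E j"])
    show "(\<lambda>k. l k * (2 * E k)) sums (2 * \<sigma>)"
      using sums_mult[OF S3, of 2] by (simp add: mult_ac)
    show "0 < l k" for k using l3[of k] by linarith
    show "(cmod (c (2 * int k + 2) + c (- (2 * int k + 2))))\<^sup>2 \<le> 2 * E k" for k
      using norm_add_square_le[of "c (2 * int k + 2)" "c (- (2 * int k + 2))"] by (simp add: E_def)
    show "(\<Sum>k<n. 1 / l k) \<le> 1/2" for n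
      unfolding l_def sum_inverse_even by simp
    show "cmod (complex_of_real (\<rho> ^ Suc k)) \<le> \<rho>" for k
      using \<rho> power_decreasing[of 1 "Suc k" \<rho>] by (simp add: norm_mult norm_power)
  qed
  then have c0: "(cmod (c 0))\<^sup>2 \<le> \<rho>\<^sup>2 * \<sigma>" by simp
  have "A - (cmod (c 0))\<^sup>2 \<le> \<sigma>"
  proof (rule sums_le[OF _ S1 S3])
    show "E j \<le> l j * E j" for j
      using mult_right_mono[of 1 "l j" "E j"] l3[of j] E0[of j] by simp
  qed
  moreover have \<rho>1: "\<rho>\<^sup>2 \<le> 1" using \<rho> by (simp add: power_le_one)
  moreover have \<sigma>0: "\<sigma> \<ge> 0" using c0 calculation(1) S3 E0 l3
    by (intro sums_le[OF _ sums_zero S3]) (smt (verit) mult_nonneg_nonneg)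
  ultimately have "A \<le> 2 * \<sigma>"
    using c0 mult_right_mono[of "\<rho>\<^sup>2" 1 \<sigma>] by simp
  then have "(1 - \<rho>\<^sup>2) / 2 * A \<le> (1 - \<rho>\<^sup>2) / 2 * (2 * \<sigma>)"
    using \<rho>1 by (intro mult_left_mono) auto
  also have "\<dots> = (1 - \<rho>\<^sup>2) * \<sigma>" by simp
  also have "\<dots> \<le> \<sigma> - (cmod (c 0))\<^sup>2" using c0 by (simp add: algebra_simps)
  also have "\<dots> = A' - A" by (simp add: \<sigma>_def)
  finally show ?thesis by (simp add: A_def A'_def)
qed

text \<open>Only odd modes occur, and \<open>\<plusminus>m\<close> have the same modulus because \<open>f\<close> is real. The modes \<open>\<plusminus>1\<close> have the
  negative weight \<open>1 - 4\<close>, all others, with weights \<open>l j = (2j + 3)\<^sup>2 - 4\<close>, add up to \<open>\<sigma>\<close>. As in the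
  even case the constraint expresses the mode \<open>-1\<close> by the others, now giving \<open>6 |c\<^sub>1|\<^sup>2 \<le> \<rho>\<^sup>2 \<sigma>\<close>. Reality of
  \<open>f\<close> is essential: it turns one complex constraint into a condition on both modes.\<close>

lemma odd_energy_gap:
  fixes f f' :: "real \<Rightarrow> real"
  assumes f': "\<And>s. (f has_real_derivative f' s) (at s)" and c': "continuous_on UNIV f'"
    and per: "\<And>s. f (s + pi) = - f s" "\<And>s. f' (s + pi) = - f' s" and zero: "(LINT s|circ. f s * u s) = 0"
  shows "ang.energy (\<lambda>s. complex_of_real (f' s) / \<omega> s) - 4 * ang.energy (\<lambda>s. complex_of_real (f s))
     \<ge> (1 - \<rho>\<^sup>2) * ang.energy (\<lambda>s. complex_of_real (f s))"
proof -
  have fc: "continuous_on UNIV f"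
    by (intro continuous_at_imp_continuous_on ballI DERIV_isCont[OF f'])
  define h h' where "h s = complex_of_real (f s)" and "h' s = complex_of_real (f' s)" for s
  have h': "(h has_vector_derivative h' s) (at s)" for s
    unfolding h_def[abs_def] h'_def by (rule has_vector_derivative_of_real[OF f'])
  have hc: "continuous_on UNIV h" and hc': "continuous_on UNIV h'"
    unfolding h_def[abs_def] h'_def[abs_def] by (intro continuous_intros fc c')+
  define c where "c = ang.coef h"
  define A where "A = ang.energy h"
  define A' where "A' = ang.energy (\<lambda>s. h' s / \<omega> s)"
  define B where "B j = (cmod (c (- (2 * int j + 1))))\<^sup>2" for j
  define l where "l j = (2 * real j + 3)\<^sup>2 - 4" for j
  have even0: "c m = 0" if "even m" for m
    unfolding c_def by (rule coef_parity[OF hc, of "-1"]) (use per that in \<open>auto simp: h_def\<close>)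
  have conj: "cmod (c (- m)) = cmod (c m)" for m
  proof -
    have "cnj (LINT s|circ. h s * (u s powi (-m) * \<omega> s)) = (LINT s|circ. cnj (h s * (u s powi (-m) * \<omega> s)))"
      by (rule Bochner_Integration.integral_cnj[symmetric])
    also have "(\<lambda>s. cnj (h s * (u s powi (-m) * \<omega> s))) = (\<lambda>s. h s * (u s powi (- (-m)) * \<omega> s))"
      by (simp only: complex_cnj_mult ang.cnj_powi complex_cnj_complex_of_real h_def)
    finally have "c (-m) = cnj (c m)" by (simp add: c_def ang.coef_def)
    then show ?thesis by simp
  qed
  have p2: "h (2*pi) = h 0" using per(1)[of pi] per(1)[of 0] by (simp add: h_def)
  have q2: "h' (2*pi) / \<omega> (2*pi) = h' 0 / \<omega> 0"
    using per(2)[of pi] per(2)[of 0] \<omega>_per[of pi] \<omega>_per[of 0] by (simp add: h'_def)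
  have sub: "strict_mono (\<lambda>j::nat. 2 * j)" by (simp add: strict_mono_def)
  have out: "odd n" if "n \<notin> range (\<lambda>j::nat. 2 * j)" for n using that by (metis evenE rangeI)
  have vanish: "(cmod (c (int (Suc n))))\<^sup>2 + (cmod (c (- int (Suc n))))\<^sup>2 = 0"
    if "n \<notin> range (\<lambda>j::nat. 2 * j)" for n
    using out[OF that] even0[of "int (Suc n)"] even0[of "- int (Suc n)"] by auto
  have idx: "int (Suc (2 * j)) = 2 * int j + 1" "real (Suc (2 * j)) = 2 * real j + 1" for j
    by simp_all
  have twoB: "(cmod (c (2 * int j + 1)))\<^sup>2 + (cmod (c (- (2 * int j + 1))))\<^sup>2 = 2 * B j" for j
    using conj[of "2 * int j + 1"] by (simp add: B_def)
  have S1: "(\<lambda>j. 2 * B j) sums A"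
  proof -
    have "(\<lambda>j. (\<lambda>k. (cmod (c (int (Suc k))))\<^sup>2 + (cmod (c (- int (Suc k))))\<^sup>2) (2 * j)) sums (A - (cmod (c 0))\<^sup>2)"
      using ang.parseval[OF hc p2] unfolding c_def[symmetric] A_def[symmetric]
      by (subst sums_mono_reindex[OF sub]) (erule vanish | assumption)+
    then show ?thesis by (simp only: idx twoB even0[of 0, simplified] norm_zero zero_power2 diff_zero)
  qed
  have S2: "(\<lambda>j. (2 * real j + 1)\<^sup>2 * (2 * B j)) sums A'"
  proof -
    have "(\<lambda>j. (\<lambda>k. (real (Suc k))\<^sup>2 * ((cmod (c (int (Suc k))))\<^sup>2 + (cmod (c (- int (Suc k))))\<^sup>2)) (2 * j)) sums A'"
      using ang.parseval_derivative[OF h' hc' p2 q2] unfolding c_def[symmetric] A'_def[symmetric]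
      by (subst sums_mono_reindex[OF sub]) ((subst vanish, assumption, rule mult_zero_right) | assumption)+
    then show ?thesis by (simp only: idx twoB)
  qed
  define \<sigma> where "\<sigma> = A' - 4 * A + 6 * B 0"
  have S3: "(\<lambda>j. l j * (2 * B (Suc j))) sums \<sigma>"
  proof -
    have "(\<lambda>j. ((2 * real j + 1)\<^sup>2 - 4) * (2 * B j)) sums (A' - 4 * A)"
      using sums_diff[OF S2 sums_mult[OF S1, of 4]] by (simp add: left_diff_distrib)
    then have "(\<lambda>j. ((2 * real (Suc j) + 1)\<^sup>2 - 4) * (2 * B (Suc j))) sums \<sigma>"
      by (subst sums_Suc_iff) (simp add: \<sigma>_def)
    moreover have "2 * real (Suc j) + 1 = 2 * real j + 3" for j by simp
    ultimately show ?thesis by (simp only: l_def)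
  qed
  have S1': "(\<lambda>j. 2 * B (Suc j)) sums (A - 2 * B 0)"
    using S1 by (subst sums_Suc_iff) simp
  define I where "I = (LINT s|circ. h s * (u s powi 1 / (1 - \<rho> * u s powi 2) * \<omega> s))"
  \<comment> \<open>the Poisson kernel splits the constraint into \<open>I + \<rho> cnj I = 0\<close>, and \<open>\<rho> < 1\<close> forces \<open>I = 0\<close>\<close>
  have "I = 0"
  proof -
    have kc: "continuous_on UNIV (\<lambda>s. h s * u s)" by (intro continuous_intros hc ang.u_cont)
    have i: "integrable circ (\<lambda>s. h s * u s * (1 / (1 - \<rho> * u s powi (-2)) * \<omega> s))" "integrable circ (\<lambda>s. h s * u s * \<omega> s)"
      using ang.one_minus_nz[OF \<rho>, of _ "-2"]
      by (intro integrable_circ_continuous continuous_intros kc ang.u_cont \<omega>_cont; simp)+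
    have "(LINT s|circ. h s * u s * (1 / (1 - \<rho> * u s powi (-2)) * \<omega> s)) - (LINT s|circ. h s * u s * \<omega> s)
        = (LINT s|circ. h s * u s * (1 / (1 - \<rho> * u s powi (-2)) * \<omega> s) - h s * u s * \<omega> s)"
      by (rule Bochner_Integration.integral_diff[symmetric, OF i])
    also have "\<dots> = (LINT s|circ. \<rho> * cnj (h s * (u s powi 1 / (1 - \<rho> * u s powi 2) * \<omega> s)))"
    proof (intro Bochner_Integration.integral_cong refl)
      fix s
      have c: "u s powi (-2) = (cnj (u s))\<^sup>2" using ang.cnj_powi[of s 2] by simp
      have uc: "u s * cnj (u s) = 1" using ang.norm_u[of s] by (metis complex_norm_square of_real_1 power_one)
      have nz: "1 - \<rho> * (cnj (u s))\<^sup>2 \<noteq> 0" using ang.one_minus_nz[OF \<rho>, of s "-2"] unfolding c .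
      have alg: "X * U * (1 / D * w) - X * U * w = R * (X * (V / D * w))"
        if "D = 1 - R * V\<^sup>2" "D \<noteq> 0" "U * V = 1" for X U V D w R :: complex
      proof -
        have "X * U * (1 / D * w) - X * U * w = X * w * (U * (1 - D)) / D"
          using that(2) by (simp add: field_simps)
        also have "U * (1 - D) = R * V * (U * V)" unfolding that(1) by (simp add: power2_eq_square mult_ac)
        also have "\<dots> = R * V" by (simp add: that(3))
        finally show ?thesis by (simp add: mult_ac)
      qed
      have "h s * u s * (1 / (1 - \<rho> * u s powi (-2)) * \<omega> s) - h s * u s * \<omega> s
          = \<rho> * (h s * (cnj (u s) / (1 - \<rho> * (cnj (u s))\<^sup>2) * \<omega> s))"
        unfolding c by (rule alg[OF refl nz uc])
      also have "\<dots> = \<rho> * cnj (h s * (u s powi 1 / (1 - \<rho> * u s powi 2) * \<omega> s))"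
        by (simp add: h_def)
      finally show "h s * u s * (1 / (1 - \<rho> * u s powi (-2)) * \<omega> s) - h s * u s * \<omega> s
          = \<rho> * cnj (h s * (u s powi 1 / (1 - \<rho> * u s powi 2) * \<omega> s))" .
    qed
    also have "\<dots> = \<rho> * cnj I" unfolding I_def by (simp only: integral_mult_right_zero Bochner_Integration.integral_cnj)
    finally have e: "(LINT s|circ. h s * u s * (1 / (1 - \<rho> * u s powi (-2)) * \<omega> s)) - (LINT s|circ. h s * u s * \<omega> s) = \<rho> * cnj I" .
    have "I = (LINT s|circ. h s * u s * (1 / (1 - \<rho> * u s powi 2) * \<omega> s))"
      unfolding I_def by (simp add: mult_ac)
    then have "0 = I + \<rho> * cnj I"
      using integral_poisson[OF kc] zero e by (simp add: h_def algebra_simps)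
    then have "cmod I = cmod (\<rho> * cnj I)" by (metis add.inverse_unique add.commute norm_minus_cancel)
    then have "(1 - \<rho>) * cmod I = 0" using \<rho> by (simp add: norm_mult algebra_simps)
    then show "I = 0" using \<rho> by simp
  qed
  have series: "(\<lambda>k. complex_of_real (\<rho> ^ Suc k) * c (- (2 * int k + 3))) sums (- c (-1))"
  proof -
    have "(\<lambda>k. complex_of_real (\<rho> ^ k) * c (- (1 + 2 * int k))) sums (I / ang.W)"
      unfolding c_def I_def by (rule ang.geometric_coef_sums[OF hc \<rho>])
    then have "(\<lambda>k. complex_of_real (\<rho> ^ Suc k) * c (- (1 + 2 * int (Suc k)))) sums (0 - c (-1))"
      by (subst sums_Suc_iff) (simp add: \<open>I = 0\<close>)
    moreover have "1 + 2 * int (Suc k) = 2 * int k + 3" for k by simp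
    ultimately show ?thesis by (simp only: diff_0)
  qed
  have B0: "B j \<ge> 0" for j by (simp add: B_def)
  have l5: "l j \<ge> 5" for j
  proof -
    have "(3::real)\<^sup>2 \<le> (2 * real j + 3)\<^sup>2" by (intro power_mono) auto
    then show ?thesis by (simp add: l_def)
  qed
  have "(cmod (- c (-1)))\<^sup>2 \<le> \<rho>\<^sup>2 * (1/3 * (\<sigma> / 2))"
  proof (rule weighted_cauchy_schwarz_series[OF series, of l "\<lambda>j. B (Suc j)"])
    show "(\<lambda>k. l k * B (Suc k)) sums (\<sigma> / 2)"
      using sums_divide[OF S3, of 2] by simp
    show "0 < l k" for k using l5[of k] by linarith
    show "(cmod (c (- (2 * int k + 3))))\<^sup>2 \<le> B (Suc k)" for k
    proof -
      have "2 * int (Suc k) + 1 = 2 * int k + 3" by simp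
      then show ?thesis unfolding B_def by (simp only:)
    qed
    show "(\<Sum>k<n. 1 / l k) \<le> 1/3" for n
      unfolding l_def sum_inverse_odd by simp
    show "cmod (complex_of_real (\<rho> ^ Suc k)) \<le> \<rho>" for k
      using \<rho> power_decreasing[of 1 "Suc k" \<rho>] by (simp add: norm_mult norm_power)
  qed
  then have c0: "6 * B 0 \<le> \<rho>\<^sup>2 * \<sigma>" by (simp add: B_def)
  have "5 * (A - 2 * B 0) \<le> \<sigma>"
  proof (rule sums_le[OF _ sums_mult[OF S1', of 5] S3])
    show "5 * (2 * B (Suc j)) \<le> l j * (2 * B (Suc j))" for j
      using l5[of j] B0[of "Suc j"] by (intro mult_right_mono) auto
  qed
  moreover have \<rho>1: "\<rho>\<^sup>2 \<le> 1" using \<rho> by (simp add: power_le_one)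
  moreover have \<sigma>0: "\<sigma> \<ge> 0"
  proof (rule sums_le[OF _ sums_zero S3])
    show "0 \<le> l j * (2 * B (Suc j))" for j
      using l5[of j] B0[of "Suc j"] by (intro mult_nonneg_nonneg) auto
  qed
  ultimately have "A \<le> \<sigma>"
    using c0 mult_right_mono[of "\<rho>\<^sup>2" 1 \<sigma>] by simp
  then have "(1 - \<rho>\<^sup>2) * A \<le> (1 - \<rho>\<^sup>2) * \<sigma>"
    using \<rho>1 by (intro mult_left_mono) auto
  also have "\<dots> \<le> \<sigma> - 6 * B 0" using c0 by (simp add: algebra_simps)
  also have "\<dots> = A' - 4 * A" by (simp add: \<sigma>_def)
  finally show ?thesis by (simp add: A_def A'_def h_def[abs_def] h'_def[abs_def])
qed

end

section \<open>Periodic and antiperiodic halves\<close>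

lemma cis_energy: "cis.energy h = (LINT s|circ. (cmod (h s))\<^sup>2) / (2 * pi)"
  by (simp add: cis.energy_def cis.W_def measure_restrict_space)

text \<open>Once the modes \<open>0\<close> and \<open>\<plusminus>1\<close> are gone the smallest weight \<open>m\<^sup>2 - 1\<close> is that of \<open>m = \<plusminus>2\<close>.\<close>

lemma mean_zero_gap:
  assumes y': "\<And>s. (y has_vector_derivative y' s) (at s)" and c': "continuous_on UNIV y'"
    and per: "y (2*pi) = y 0" "y' (2*pi) = y' 0" and zero: "cis.coef y 0 = 0"
  shows "cis.energy y' - cis.energy y
    \<ge> 3 * (cis.energy y - ((cmod (cis.coef y 1))\<^sup>2 + (cmod (cis.coef y (-1)))\<^sup>2))"
proof -
  have yc: "continuous_on UNIV y"
    by (intro continuous_at_imp_continuous_on ballI has_vector_derivative_continuous[OF y'])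
  define e where "e k = (cmod (cis.coef y (int (Suc k))))\<^sup>2 + (cmod (cis.coef y (- int (Suc k))))\<^sup>2" for k
  have S1: "e sums cis.energy y"
    using cis.parseval[OF yc per(1)] by (simp add: e_def[abs_def] zero)
  have S2: "(\<lambda>k. (real (Suc k))\<^sup>2 * e k) sums cis.energy y'"
    using cis.parseval_derivative[OF y' c' per(1)] per(2) by (simp add: e_def)
  have "(\<lambda>k. ((real (Suc k))\<^sup>2 - 1) * e k) sums (cis.energy y' - cis.energy y)"
    using sums_diff[OF S2 S1] by (simp only: left_diff_distrib mult_1_left)
  then have T1: "(\<lambda>k. ((real (Suc (Suc k)))\<^sup>2 - 1) * e (Suc k)) sums (cis.energy y' - cis.energy y)"
    by (subst sums_Suc_iff) simp
  have T2: "(\<lambda>k. 3 * e (Suc k)) sums (3 * (cis.energy y - e 0))"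
    using S1 by (intro sums_mult) (simp add: sums_Suc_iff)
  have "3 * (cis.energy y - e 0) \<le> cis.energy y' - cis.energy y"
  proof (rule sums_le[OF _ T2 T1])
    fix k
    have "(2::real)\<^sup>2 \<le> (real (Suc (Suc k)))\<^sup>2" by (intro power_mono) auto
    then show "3 * e (Suc k) \<le> ((real (Suc (Suc k)))\<^sup>2 - 1) * e (Suc k)"
      by (intro mult_right_mono) (auto simp: e_def)
  qed
  then show ?thesis by (simp add: e_def)
qed

lemma norm_parallelogram_half:
  fixes a b :: complex
  shows "(cmod ((a + b) / 2))\<^sup>2 + (cmod ((a - b) / 2))\<^sup>2 = ((cmod a)\<^sup>2 + (cmod b)\<^sup>2) / 2"
  by (simp only: cmod_power2) (simp add: power2_eq_square field_simps)

lemma energy_half_period_split: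
  assumes "continuous_on UNIV y" "\<And>s. y (s + 2*pi) = y s"
  shows "cis.energy (\<lambda>s. (y s + y (s + pi)) / 2) + cis.energy (\<lambda>s. (y s - y (s + pi)) / 2) = cis.energy y"
proof -
  have sc: "continuous_on UNIV (\<lambda>s. y (s + pi))"
    by (intro continuous_on_compose2[OF assms(1)] continuous_intros) auto
  have "(LINT s|circ. (cmod ((y s + y (s + pi)) / 2))\<^sup>2) + (LINT s|circ. (cmod ((y s - y (s + pi)) / 2))\<^sup>2)
      = (LINT s|circ. (cmod ((y s + y (s + pi)) / 2))\<^sup>2 + (cmod ((y s - y (s + pi)) / 2))\<^sup>2)"
    by (intro Bochner_Integration.integral_add[symmetric] integrable_circ_continuous continuous_intros assms(1) sc) auto
  also have "\<dots> = (LINT s|circ. ((cmod (y s))\<^sup>2 + (cmod (y (s + pi)))\<^sup>2) / 2)"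
    by (simp only: norm_parallelogram_half)
  also have "\<dots> = ((LINT s|circ. (cmod (y s))\<^sup>2) + (LINT s|circ. (cmod (y (s + pi)))\<^sup>2)) / 2"
    by (simp only: integral_divide_zero, subst Bochner_Integration.integral_add)
       (auto intro!: integrable_circ_continuous continuous_intros assms(1) sc)
  also have "(LINT s|circ. (cmod (y (s + pi)))\<^sup>2) = (LINT s|circ. (cmod (y s))\<^sup>2)"
    by (rule integral_circ_shift[of "\<lambda>s. (cmod (y s))\<^sup>2"], intro continuous_intros assms(1))
       (simp only: assms(2))
  finally show ?thesis
    by (simp add: cis_energy add_divide_distrib[symmetric])
qed

text \<open>The modes \<open>\<plusminus>1\<close> live in the antiperiodic half of a function, which has mean zero; so only the
  half of period \<open>\<pi>\<close> needs the constraint.\<close>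

lemma half_period_gap:
  assumes y': "\<And>s. (y has_vector_derivative y' s) (at s)" and c': "continuous_on UNIV y'"
    and per: "\<And>s. y (s + 2*pi) = y s" "\<And>s. y' (s + 2*pi) = y' s"
    and E: "cis.energy (\<lambda>s. (y' s + y' (s + pi)) / 2) - cis.energy (\<lambda>s. (y s + y (s + pi)) / 2)
       \<ge> k * cis.energy (\<lambda>s. (y s + y (s + pi)) / 2)" and k: "k \<le> 3"
  shows "cis.energy y' - cis.energy y
    \<ge> k * (cis.energy y - ((cmod (cis.coef y 1))\<^sup>2 + (cmod (cis.coef y (-1)))\<^sup>2))"
proof -
  have yc: "continuous_on UNIV y"
    by (intro continuous_at_imp_continuous_on ballI has_vector_derivative_continuous[OF y'])
  define e e' where "e s = (y s + y (s + pi)) / 2" and "e' s = (y' s + y' (s + pi)) / 2" for s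
  define a a' where "a s = (y s - y (s + pi)) / 2" and "a' s = (y' s - y' (s + pi)) / 2" for s
  have ys: "((\<lambda>s. y (s + pi)) has_vector_derivative y' (s + pi)) (at s)" for s
  proof -
    have "((\<lambda>s. s + pi) has_vector_derivative 1) (at s)"
      unfolding has_real_derivative_iff_has_vector_derivative[symmetric]
      by (auto intro!: derivative_eq_intros)
    from vector_diff_chain_at[OF this y'] show ?thesis by (simp add: o_def)
  qed
  have ad: "(a has_vector_derivative a' s) (at s)" for s
    unfolding a_def[abs_def] a'_def by (auto intro!: derivative_eq_intros y' ys)
  have ysc: "continuous_on UNIV (\<lambda>s. y (s + pi))" "continuous_on UNIV (\<lambda>s. y' (s + pi))"
    by (intro continuous_on_compose2[OF yc] continuous_on_compose2[OF c'] continuous_intros; simp)+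
  have ac: "continuous_on UNIV a" "continuous_on UNIV a'" "continuous_on UNIV e"
    unfolding a_def[abs_def] a'_def[abs_def] e_def[abs_def] by (intro continuous_intros yc c' ysc; simp)+
  have aa: "a (s + pi) = - a s" "a' (s + pi) = - a' s" "e (s + pi) = e s" for s
    using per[of s] by (simp_all add: a_def a'_def e_def add.assoc minus_divide_left)
  have cpi: "cis (s + pi) = - cis s" for s by (simp add: complex_eq_iff)
  have a0: "cis.coef a 0 = 0"
    using integral_antiperiodic[of a] ac aa by (simp add: cis.coef_def)
  have e1: "cis.coef e m = 0" if "odd m" for m
  proof -
    have "(LINT s|circ. e s * (cis s powi (-m) * complex_of_real 1)) = 0"
      using that
      by (intro integral_antiperiodic continuous_intros ac) (simp_all add: aa cpi power_int_minus_left)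
    then show ?thesis by (simp add: cis.coef_def)
  qed
  have ya: "cis.coef y m = cis.coef a m" if "odd m" for m
  proof -
    have "y = (\<lambda>s. e s + a s)" by (auto simp: e_def a_def field_simps)
    then have "cis.coef y m = cis.coef e m + cis.coef a m"
      using cis.coef_add[of e a] ac square_int_continuous by metis
    with e1[OF that] show ?thesis by simp
  qed
  have a2: "a (2*pi) = a 0" "a' (2*pi) = a' 0"
    using aa(1)[of pi] aa(1)[of 0] aa(2)[of pi] aa(2)[of 0] by simp_all
  define b where "b = (cmod (cis.coef y 1))\<^sup>2 + (cmod (cis.coef y (-1)))\<^sup>2"
  have "cis.energy a' - cis.energy a \<ge> 3 * (cis.energy a - b)"
    using mean_zero_gap[OF ad ac(2) a2 a0] ya[of 1] ya[of "-1"] by (simp add: b_def)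
  moreover have "k * (cis.energy a - b) \<le> 3 * (cis.energy a - b)"
  proof (rule mult_right_mono[OF k])
    have "(\<Sum>m\<in>{1,-1}. (cmod (cis.coef a m))\<^sup>2) \<le> cis.energy a"
      by (rule cis.bessel[OF square_int_continuous[OF ac(1)]]) simp
    then show "0 \<le> cis.energy a - b"
      using ya[of 1] ya[of "-1"] by (simp add: b_def)
  qed
  moreover have "cis.energy e' - cis.energy e \<ge> k * cis.energy e"
    using E by (simp add: e_def[abs_def] e'_def[abs_def])
  moreover have "cis.energy e + cis.energy a = cis.energy y"
    unfolding e_def[abs_def] a_def[abs_def] by (rule energy_half_period_split[OF yc per(1)])
  moreover have "cis.energy e' + cis.energy a' = cis.energy y'"
    unfolding e'_def[abs_def] a'_def[abs_def] by (rule energy_half_period_split[OF c' per(2)])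
  moreover have "k * (cis.energy y - b) = k * cis.energy e + k * (cis.energy a - b)"
    unfolding \<open>cis.energy e + cis.energy a = cis.energy y\<close>[symmetric] by (simp add: algebra_simps)
  ultimately show ?thesis unfolding b_def[symmetric] by linarith
qed

section \<open>Liouville's transformation\<close>

lemma has_vector_derivative_divide_complex:
  fixes f g :: "real \<Rightarrow> complex"
  assumes f: "(f has_vector_derivative f') (at s)" and g: "(g has_vector_derivative g') (at s)"
    and nz: "g s \<noteq> 0"
  shows "((\<lambda>s. f s / g s) has_vector_derivative (f' * g s - f s * g') / (g s * g s)) (at s)"
proof -
  have "(inverse has_field_derivative - (inverse (g s) * inverse (g s))) (at (g s))"
    using DERIV_inverse[OF nz] by (simp add: power2_eq_square)
  from field_vector_diff_chain_at[OF g this]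
  have "((\<lambda>s. inverse (g s)) has_vector_derivative g' * (- (inverse (g s) * inverse (g s)))) (at s)"
    by (simp add: o_def)
  from has_vector_derivative_mult[OF f this] show ?thesis
  proof -
    have "f s * (g' * (- (inverse (g s) * inverse (g s)))) + f' * inverse (g s)
        = (f' * g s - f s * g') / (g s * g s)"
      using nz by (simp add: field_simps)
    with \<open>((\<lambda>s. f s * inverse (g s)) has_vector_derivative
        f s * (g' * (- (inverse (g s) * inverse (g s)))) + f' * inverse (g s)) (at s)\<close>
    show ?thesis by (simp only: divide_inverse[symmetric])
  qed
qed

lemma norm_product_rule:
  fixes X N q q1 :: complex
  defines "R \<equiv> Re (cnj X * N)" and "L \<equiv> Im (cnj X * N)"
  shows "(cmod (N * q + X * q1))\<^sup>2 = (cmod N)\<^sup>2 * (cmod q)\<^sup>2 + (cmod X)\<^sup>2 * (cmod q1)\<^sup>2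
    + 2 * R * (Re q * Re q1 + Im q * Im q1) + 2 * L * (Re q * Im q1 - Im q * Re q1)"
  unfolding R_def L_def cmod_power2 by (simp add: power2_eq_square algebra_simps)

context ellipse_geometry begin

text \<open>The factor \<open>(\<beta>/\<alpha>)\<^sup>2\<close> is the price for comparing the means with respect to the polar angle and the
  parameter. The number \<open>11\<close> is \<open>2 + 9\<close>: with \<open>N\<close>, \<open>F\<close> and \<open>G\<close> the energies of the completed
  square and of \<open>f\<close> and \<open>g\<close>, one has \<open>G \<le> 2 N + 8 F\<close>, so \<open>F + G \<le> 2 N + 9 F\<close>, while both \<open>N\<close> and
  \<open>(1 - \<rho>\<^sup>2) F\<close> are at most the quadratic form.\<close>

definition \<kappa> :: real where "\<kappa> = (\<beta> / \<alpha>)\<^sup>2 * (1 - \<rho>\<^sup>2) / 11"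

lemma \<rho>_square: "\<rho>\<^sup>2 < 1" "0 \<le> \<rho>\<^sup>2" using \<rho> by (auto simp: power_less_one_iff abs_square_less_1)

lemma \<kappa>_pos: "\<kappa> > 0"
  using \<rho>_square \<alpha>_pos \<alpha>\<beta> by (simp add: \<kappa>_def)

lemma \<kappa>_scale: "\<kappa> * (\<alpha> ^ 3 / \<beta>) = \<alpha> * \<beta> * ((1 - \<rho>\<^sup>2) / 11)"
  using \<alpha>_pos \<alpha>\<beta> by (simp add: \<kappa>_def power_divide field_simps eval_nat_numeral)

lemma \<kappa>_le: "\<kappa> \<le> 3"
proof -
  have "(\<beta> / \<alpha>)\<^sup>2 \<le> 1" using \<alpha>_pos \<alpha>\<beta> by (simp add: power_le_one)
  then have "(\<beta> / \<alpha>)\<^sup>2 * (1 - \<rho>\<^sup>2) \<le> 1 * 1" using \<rho>_square by (intro mult_mono) auto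
  then show ?thesis by (simp add: \<kappa>_def)
qed

text \<open>Energies in the two coordinates are comparable because \<open>r \<le> \<alpha>\<close>.\<close>

lemma energy_compare:
  fixes q :: "real \<Rightarrow> complex"
  assumes "continuous_on UNIV q"
  shows "2 * pi * cis.energy (\<lambda>s. r s * q s) \<le> (\<alpha> ^ 3 / \<beta>) * ang.W * ang.energy q"
proof -
  have "(LINT s|circ. (cmod (r s * q s))\<^sup>2) \<le> (LINT s|circ. (\<alpha> ^ 3 / \<beta>) * ((cmod (q s))\<^sup>2 * \<omega> s))"
  proof (intro integral_mono integrable_circ_continuous continuous_intros assms r_cont \<omega>_cont)
    fix s
    have "(r s)\<^sup>2 = (r s)\<^sup>2 * (r s)\<^sup>2 / (\<alpha> * \<beta>) * \<omega> s"
      using r_pos[of s] \<alpha>_pos \<alpha>\<beta> by (simp add: \<omega>_def power2_eq_square)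
    also have "\<dots> \<le> \<alpha>\<^sup>2 * \<alpha>\<^sup>2 / (\<alpha> * \<beta>) * \<omega> s"
      using r_bounds[of s] r_pos[of s] \<alpha>_pos \<alpha>\<beta> \<omega>_pos[of s]
      by (intro mult_right_mono divide_right_mono mult_mono power_mono) auto
    also have "\<alpha>\<^sup>2 * \<alpha>\<^sup>2 / (\<alpha> * \<beta>) = \<alpha> ^ 3 / \<beta>"
      using \<alpha>_pos \<alpha>\<beta> by (simp add: field_simps eval_nat_numeral)
    finally have "(r s)\<^sup>2 * (cmod (q s))\<^sup>2 \<le> (\<alpha> ^ 3 / \<beta> * \<omega> s) * (cmod (q s))\<^sup>2"
      by (intro mult_right_mono) auto
    then show "(cmod (r s * q s))\<^sup>2 \<le> (\<alpha> ^ 3 / \<beta>) * ((cmod (q s))\<^sup>2 * \<omega> s)"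
      by (simp add: norm_mult power_mult_distrib mult_ac)
  qed
  also have "\<dots> = (\<alpha> ^ 3 / \<beta>) * (ang.W * ang.energy q)"
    using ang.W_pos by (simp add: ang.energy_def)
  finally show ?thesis by (simp add: cis_energy mult_ac)
qed

lemma weighted_energy:
  fixes h :: "real \<Rightarrow> complex"
  shows "ang.W * ang.energy (\<lambda>s. h s / \<omega> s) = (LINT s|circ. (cmod (h s))\<^sup>2 / \<omega> s)"
proof -
  have "(cmod (h s / \<omega> s))\<^sup>2 * \<omega> s = (cmod (h s))\<^sup>2 / \<omega> s" for s
    using \<omega>_pos[of s] by (simp add: norm_divide power_divide power2_eq_square)
  then show ?thesis using ang.W_pos by (simp add: ang.energy_def)
qed

lemma weighted_energy0:
  fixes h :: "real \<Rightarrow> complex"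
  shows "ang.W * ang.energy h = (LINT s|circ. (cmod (h s))\<^sup>2 * \<omega> s)"
  using ang.W_pos by (simp add: ang.energy_def)

text \<open>Substituting \<open>Z = r p\<close> (Liouville's transformation) and dropping a total derivative turns
  \<open>|Z'|\<^sup>2 - |Z|\<^sup>2\<close> into the same expression for \<open>p\<close> in the angular coordinate.\<close>

lemma liouville_scalar:
  fixes p p' :: "real \<Rightarrow> complex"
  assumes p': "\<And>s. (p has_vector_derivative p' s) (at s)" and c': "continuous_on UNIV p'"
    and per: "p (2*pi) = p 0"
  shows "2 * pi * (cis.energy (\<lambda>s. (rr' s / r s) * p s + r s * p' s) - cis.energy (\<lambda>s. r s * p s))
    = \<alpha> * \<beta> * ang.W * (ang.energy (\<lambda>s. p' s / \<omega> s) - ang.energy p)"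
proof -
  have pc: "continuous_on UNIV p"
    by (intro continuous_at_imp_continuous_on ballI has_vector_derivative_continuous[OF p'])
  define G' where "G' s = ((cmod (\<eta> s))\<^sup>2 - (r s)\<^sup>2) * (cmod (p s))\<^sup>2
      + rr' s * (2 * (Re (p s) * Re (p' s) + Im (p s) * Im (p' s)))" for s
  have Gc: "continuous_on UNIV G'"
    unfolding G'_def[abs_def] by (intro continuous_intros \<eta>_cont r_cont rr'_cont pc c')
  have Gd: "((\<lambda>s. rr' s * (cmod (p s))\<^sup>2) has_vector_derivative G' s) (at s)" for s
    unfolding has_real_derivative_iff_has_vector_derivative[symmetric] cmod_power2[of "p _"] G'_def
    by (auto intro!: derivative_eq_intros rr'_deriv p' simp: power2_eq_square algebra_simps)
  have "integral\<^sup>L circ G' = 0"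
    using integral_circ_derivative[OF Gd Gc] per \<eta>_antiper by (simp add: rr'_def)
  have pt: "(cmod ((rr' s / r s) * p s + r s * p' s))\<^sup>2 - (cmod (r s * p s))\<^sup>2
      = \<alpha> * \<beta> * ((cmod (p' s))\<^sup>2 / \<omega> s - (cmod (p s))\<^sup>2 * \<omega> s) + G' s" for s
  proof -
    have "(cmod ((rr' s / r s) * p s + r s * p' s))\<^sup>2 = (rr' s / r s)\<^sup>2 * (cmod (p s))\<^sup>2 + (r s)\<^sup>2 * (cmod (p' s))\<^sup>2
      + 2 * rr' s * (Re (p s) * Re (p' s) + Im (p s) * Im (p' s))"
      using norm_product_rule[of "complex_of_real (rr' s / r s)" "p s" "complex_of_real (r s)" "p' s"] r_pos[of s]
      by (simp del: of_real_divide add: power_divide)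
    moreover have "(rr' s / r s)\<^sup>2 = (cmod (\<eta> s))\<^sup>2 - \<alpha> * \<beta> * \<omega> s"
    proof -
      have "(rr' s)\<^sup>2 = (r s)\<^sup>2 * (cmod (\<eta> s))\<^sup>2 - (\<alpha> * \<beta>)\<^sup>2" using norm_\<eta>_r[of s] by simp
      then have "(rr' s)\<^sup>2 / (r s)\<^sup>2 = (cmod (\<eta> s))\<^sup>2 - (\<alpha> * \<beta>)\<^sup>2 / (r s)\<^sup>2"
        using r_pos[of s] by (simp add: diff_divide_distrib)
      then show ?thesis by (simp add: \<omega>_def power_divide power2_eq_square)
    qed
    moreover have "(r s)\<^sup>2 * (cmod (p' s))\<^sup>2 = \<alpha> * \<beta> * ((cmod (p' s))\<^sup>2 / \<omega> s)"
      using r_pos[of s] \<alpha>_pos \<alpha>\<beta> by (simp add: \<omega>_def)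
    moreover have "(cmod (r s * p s))\<^sup>2 = (r s)\<^sup>2 * (cmod (p s))\<^sup>2"
      by (simp add: norm_mult power_mult_distrib)
    ultimately show ?thesis by (simp add: G'_def algebra_simps)
  qed
  have onz: "\<forall>s\<in>UNIV. \<omega> s \<noteq> 0" and rnz: "\<forall>s\<in>UNIV. r s \<noteq> 0"
    using \<omega>_pos r_pos by (auto simp: less_imp_neq[symmetric])
  have "2 * pi * (cis.energy (\<lambda>s. (rr' s / r s) * p s + r s * p' s) - cis.energy (\<lambda>s. r s * p s))
    = (LINT s|circ. (cmod ((rr' s / r s) * p s + r s * p' s))\<^sup>2) - (LINT s|circ. (cmod (r s * p s))\<^sup>2)"
    by (simp add: cis_energy diff_divide_distrib[symmetric])
  also have "\<dots> = (LINT s|circ. (cmod ((rr' s / r s) * p s + r s * p' s))\<^sup>2 - (cmod (r s * p s))\<^sup>2)"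
    using rnz by (intro Bochner_Integration.integral_diff[symmetric] integrable_circ_continuous
        continuous_intros r_cont rr'_cont pc c') auto
  also have "\<dots> = (LINT s|circ. \<alpha> * \<beta> * ((cmod (p' s))\<^sup>2 / \<omega> s - (cmod (p s))\<^sup>2 * \<omega> s) + G' s)"
    by (simp only: pt)
  also have "\<dots> = (LINT s|circ. \<alpha> * \<beta> * ((cmod (p' s))\<^sup>2 / \<omega> s - (cmod (p s))\<^sup>2 * \<omega> s)) + integral\<^sup>L circ G'"
    using onz by (intro Bochner_Integration.integral_add integrable_circ_continuous continuous_intros \<omega>_cont pc c' Gc)
  also have "(LINT s|circ. \<alpha> * \<beta> * ((cmod (p' s))\<^sup>2 / \<omega> s - (cmod (p s))\<^sup>2 * \<omega> s))
      = \<alpha> * \<beta> * ((LINT s|circ. (cmod (p' s))\<^sup>2 / \<omega> s) - (LINT s|circ. (cmod (p s))\<^sup>2 * \<omega> s))"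
    using onz by (subst integral_mult_right_zero, subst Bochner_Integration.integral_diff)
       (auto intro!: integrable_circ_continuous continuous_intros \<omega>_cont pc c')
  finally show ?thesis
    unfolding \<open>integral\<^sup>L circ G' = 0\<close> weighted_energy[symmetric] weighted_energy0[symmetric]
    by (simp only: right_diff_distrib mult.assoc add_0_right)
qed

text \<open>In the plane write \<open>y = \<xi> q\<close> with \<open>q = g + i f\<close>: completing the square in \<open>g\<close> leaves a
  scalar problem for the angular part \<open>f\<close> alone.\<close>

lemma liouville_planar:
  assumes q': "\<And>s. (q has_vector_derivative q' s) (at s)" and c': "continuous_on UNIV q'"
    and per: "q (2*pi) = q 0"
  shows "2 * pi * (cis.energy (\<lambda>s. \<eta> s * q s + \<xi> s * q' s) - cis.energy (\<lambda>s. \<xi> s * q s))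
    = \<alpha> * \<beta> * ang.W * (ang.energy (\<lambda>s. complex_of_real (Re (q' s) - 2 * \<omega> s * Im (q s)) / \<omega> s)
        + ang.energy (\<lambda>s. complex_of_real (Im (q' s)) / \<omega> s) - 4 * ang.energy (\<lambda>s. complex_of_real (Im (q s))))"
proof -
  have qc: "continuous_on UNIV q"
    by (intro continuous_at_imp_continuous_on ballI has_vector_derivative_continuous[OF q'])
  define G' where "G' s = ((cmod (\<eta> s))\<^sup>2 - (r s)\<^sup>2) * (cmod (q s))\<^sup>2
      + rr' s * (2 * (Re (q s) * Re (q' s) + Im (q s) * Im (q' s)))
      + 2 * \<alpha> * \<beta> * (Re (q s) * Im (q' s) + Im (q s) * Re (q' s))" for s
  have Gc: "continuous_on UNIV G'"
    unfolding G'_def[abs_def] by (intro continuous_intros \<eta>_cont r_cont rr'_cont qc c')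
  have Gd: "((\<lambda>s. rr' s * (cmod (q s))\<^sup>2 + 2 * \<alpha> * \<beta> * (Re (q s) * Im (q s))) has_vector_derivative G' s) (at s)" for s
    unfolding has_real_derivative_iff_has_vector_derivative[symmetric] cmod_power2[of "q _"] G'_def
    by (auto intro!: derivative_eq_intros rr'_deriv q' simp: power2_eq_square algebra_simps)
  have "integral\<^sup>L circ G' = 0"
    using integral_circ_derivative[OF Gd Gc] per by (simp add: rr'_def)
  let ?N = "\<lambda>s. Re (q' s) - 2 * \<omega> s * Im (q s)"
  have pt: "(cmod (\<eta> s * q s + \<xi> s * q' s))\<^sup>2 - (cmod (\<xi> s * q s))\<^sup>2
      = \<alpha> * \<beta> * ((?N s)\<^sup>2 / \<omega> s + (Im (q' s))\<^sup>2 / \<omega> s - 4 * ((Im (q s))\<^sup>2 * \<omega> s)) + G' s" for s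
  proof -
    have R: "Re (cnj (\<xi> s) * \<eta> s) = rr' s" "Im (cnj (\<xi> s) * \<eta> s) = \<alpha> * \<beta>"
      unfolding cnj_\<xi>_\<eta> by simp_all
    have "(cmod (\<eta> s * q s + \<xi> s * q' s))\<^sup>2 = (cmod (\<eta> s))\<^sup>2 * (cmod (q s))\<^sup>2 + (r s)\<^sup>2 * (cmod (q' s))\<^sup>2
      + 2 * rr' s * (Re (q s) * Re (q' s) + Im (q s) * Im (q' s))
      + 2 * (\<alpha> * \<beta>) * (Re (q s) * Im (q' s) - Im (q s) * Re (q' s))"
      using norm_product_rule[of "\<eta> s" "q s" "\<xi> s" "q' s"] unfolding R r_def .
    moreover have "(cmod (\<xi> s * q s))\<^sup>2 = (r s)\<^sup>2 * (cmod (q s))\<^sup>2"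
      by (simp add: norm_mult power_mult_distrib r_def)
    moreover have "(r s)\<^sup>2 * (cmod (q' s))\<^sup>2 = \<alpha> * \<beta> * ((Re (q' s))\<^sup>2 / \<omega> s + (Im (q' s))\<^sup>2 / \<omega> s)"
      using r_pos[of s] \<alpha>_pos \<alpha>\<beta> unfolding cmod_power2 by (simp add: \<omega>_def distrib_left)
    moreover have "\<alpha> * \<beta> * ((?N s)\<^sup>2 / \<omega> s + (Im (q' s))\<^sup>2 / \<omega> s - 4 * ((Im (q s))\<^sup>2 * \<omega> s))
        = \<alpha> * \<beta> * ((Re (q' s))\<^sup>2 / \<omega> s + (Im (q' s))\<^sup>2 / \<omega> s) - 4 * (\<alpha> * \<beta>) * (Re (q' s) * Im (q s))"
    proof -
      have "(?N s)\<^sup>2 / \<omega> s = (Re (q' s))\<^sup>2 / \<omega> s - 4 * (Re (q' s) * Im (q s)) + 4 * ((Im (q s))\<^sup>2 * \<omega> s)"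
        using \<omega>_pos[of s] by (simp add: power2_eq_square field_simps)
      then show ?thesis by (simp only: right_diff_distrib distrib_left mult_ac)
    qed
    ultimately show ?thesis unfolding G'_def by (simp only: left_diff_distrib right_diff_distrib distrib_left) argo
  qed
  have onz: "\<forall>s\<in>UNIV. \<omega> s \<noteq> 0"
    using \<omega>_pos by (auto simp: less_imp_neq[symmetric])
  have i: "integrable circ (\<lambda>s. (?N s)\<^sup>2 / \<omega> s)" "integrable circ (\<lambda>s. (Im (q' s))\<^sup>2 / \<omega> s)"
    "integrable circ (\<lambda>s. (Im (q s))\<^sup>2 * \<omega> s)"
    using onz by (intro integrable_circ_continuous continuous_intros \<omega>_cont qc c'; simp)+
  have "2 * pi * (cis.energy (\<lambda>s. \<eta> s * q s + \<xi> s * q' s) - cis.energy (\<lambda>s. \<xi> s * q s))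
    = (LINT s|circ. (cmod (\<eta> s * q s + \<xi> s * q' s))\<^sup>2) - (LINT s|circ. (cmod (\<xi> s * q s))\<^sup>2)"
    by (simp add: cis_energy diff_divide_distrib[symmetric])
  also have "\<dots> = (LINT s|circ. (cmod (\<eta> s * q s + \<xi> s * q' s))\<^sup>2 - (cmod (\<xi> s * q s))\<^sup>2)"
    by (intro Bochner_Integration.integral_diff[symmetric] integrable_circ_continuous
        continuous_intros \<xi>_cont \<eta>_cont qc c')
  also have "\<dots> = (LINT s|circ. \<alpha> * \<beta> * ((?N s)\<^sup>2 / \<omega> s + (Im (q' s))\<^sup>2 / \<omega> s - 4 * ((Im (q s))\<^sup>2 * \<omega> s)) + G' s)"
    by (simp only: pt)
  also have "\<dots> = \<alpha> * \<beta> * ((LINT s|circ. (?N s)\<^sup>2 / \<omega> s) + (LINT s|circ. (Im (q' s))\<^sup>2 / \<omega> s)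
      - 4 * (LINT s|circ. (Im (q s))\<^sup>2 * \<omega> s)) + integral\<^sup>L circ G'"
    using i integrable_circ_continuous[OF Gc] by simp
  finally show ?thesis
    using weighted_energy[of "\<lambda>s. complex_of_real (?N s)"]
      weighted_energy[of "\<lambda>s. complex_of_real (Im (q' s))"] weighted_energy0[of "\<lambda>s. complex_of_real (Im (q s))"]
    unfolding \<open>integral\<^sup>L circ G' = 0\<close> norm_of_real power2_abs
    by (simp only: right_diff_distrib distrib_left mult.assoc add_0_right mult.left_commute[of ang.W 4])
qed

text \<open>The estimate for the vertical part, transported from the angular variable \<open>p = Z / r\<close> to the
  parameter.\<close>

lemma radial_gap:
  fixes Z Z' :: "real \<Rightarrow> complex"
  assumes Z': "\<And>s. (Z has_vector_derivative Z' s) (at s)" and c': "continuous_on UNIV Z'"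
    and per: "\<And>s. Z (s + pi) = Z s" "\<And>s. Z' (s + pi) = Z' s"
    and zero: "(LINT s|circ. Z s / r s) = 0"
  shows "cis.energy Z' - cis.energy Z \<ge> \<kappa> * cis.energy Z"
proof -
  have Zc: "continuous_on UNIV Z"
    by (intro continuous_at_imp_continuous_on ballI has_vector_derivative_continuous[OF Z'])
  have rnz: "complex_of_real (r s) \<noteq> 0" for s using r_pos[of s] by simp
  define p where "p s = Z s / r s" for s
  define p' where "p' s = (Z' s - (rr' s / r s) * p s) / r s" for s
  have Zp: "Z = (\<lambda>s. r s * p s)" and Zp': "Z' = (\<lambda>s. (rr' s / r s) * p s + r s * p' s)"
    using rnz by (auto simp: p_def p'_def)
  have pd: "(p has_vector_derivative p' s) (at s)" for s
  proof -
    have "((\<lambda>s. inverse (r s) *\<^sub>R Z s) has_vector_derivative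
        (inverse (r s) *\<^sub>R Z' s + (- (inverse (r s) * (rr' s / r s) * inverse (r s))) *\<^sub>R Z s)) (at s)"
      using r_pos[of s] by (intro has_vector_derivative_scaleR Z' DERIV_inverse' r_deriv) auto
    moreover have "(\<lambda>s. inverse (r s) *\<^sub>R Z s) = p"
      by (auto simp: p_def scaleR_conv_of_real divide_inverse mult.commute)
    moreover have "inverse (r s) *\<^sub>R Z' s + (- (inverse (r s) * (rr' s / r s) * inverse (r s))) *\<^sub>R Z s = p' s"
      using rnz[of s] by (simp add: p'_def p_def scaleR_conv_of_real field_simps)
    ultimately show ?thesis by simp
  qed
  have cont: "continuous_on UNIV p" "continuous_on UNIV p'"
    unfolding p_def[abs_def] p'_def[abs_def] using rnz
    by (intro continuous_intros Zc c' r_cont rr'_cont; simp)+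
  have pp: "p (s + pi) = p s" "p' (s + pi) = p' s" for s
    by (simp_all add: p_def p'_def per r_per rr'_def)
  have p2: "p (2*pi) = p 0" using pp(1)[of pi] pp(1)[of 0] by simp
  define D where "D = ang.energy (\<lambda>s. p' s / \<omega> s) - ang.energy p"
  have D: "(1 - \<rho>\<^sup>2) / 2 * ang.energy p \<le> D"
  proof -
    have "(LINT s|circ. p s) = 0" using zero by (simp add: p_def)
    then show ?thesis unfolding D_def by (rule even_energy_gap[OF pd cont(2) pp])
  qed
  have "2 * pi * cis.energy Z \<le> (\<alpha> ^ 3 / \<beta>) * ang.W * ang.energy p"
    unfolding Zp by (rule energy_compare[OF cont(1)])
  then have "\<kappa> * (2 * pi * cis.energy Z) \<le> \<kappa> * ((\<alpha> ^ 3 / \<beta>) * ang.W * ang.energy p)"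
    using \<kappa>_pos by (intro mult_left_mono) auto
  also have "\<dots> = \<alpha> * \<beta> * ang.W * ((1 - \<rho>\<^sup>2) / 11 * ang.energy p)"
    using \<kappa>_scale by (simp only: mult.assoc[symmetric]) (simp only: mult_ac)
  also have "\<dots> \<le> \<alpha> * \<beta> * ang.W * ((1 - \<rho>\<^sup>2) / 2 * ang.energy p)"
    using \<alpha>_pos \<alpha>\<beta> ang.W_pos \<rho>_square ang.energy_nonneg[of p]
    by (intro mult_left_mono mult_right_mono divide_left_mono) auto
  also have "\<dots> \<le> \<alpha> * \<beta> * ang.W * D"
    using \<alpha>_pos \<alpha>\<beta> ang.W_pos by (intro mult_left_mono D) auto
  also have "\<dots> = 2 * pi * (cis.energy Z' - cis.energy Z)"
    unfolding D_def Zp Zp' by (rule liouville_scalar[OF pd cont(2) p2, symmetric])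
  finally have "(2 * pi) * (\<kappa> * cis.energy Z) \<le> (2 * pi) * (cis.energy Z' - cis.energy Z)"
    by (simp only: mult_ac)
  then show ?thesis by (rule mult_left_le_imp_le) simp
qed

lemma antiperiodic_energy_le:
  fixes h h' :: "real \<Rightarrow> complex"
  assumes h': "\<And>s. (h has_vector_derivative h' s) (at s)" and c': "continuous_on UNIV h'"
    and per: "\<And>s. h (s + pi) = - h s" "\<And>s. h' (s + pi) = - h' s"
  shows "ang.energy h \<le> ang.energy (\<lambda>s. h' s / \<omega> s)"
proof -
  have hc: "continuous_on UNIV h"
    by (intro continuous_at_imp_continuous_on ballI has_vector_derivative_continuous[OF h'])
  have h2: "h (2*pi) = h 0" "h' (2*pi) / \<omega> (2*pi) = h' 0 / \<omega> 0"
    using per(1)[of pi] per(1)[of 0] per(2)[of pi] per(2)[of 0] \<omega>_per[of pi] \<omega>_per[of 0] by simp_all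
  have "ang.coef h 0 = 0" by (rule coef_parity[OF hc, of "-1"]) (simp_all add: per)
  with ang.parseval[OF hc h2(1)]
  have S: "(\<lambda>k. (cmod (ang.coef h (int (Suc k))))\<^sup>2 + (cmod (ang.coef h (- int (Suc k))))\<^sup>2) sums ang.energy h"
    by simp
  show ?thesis
  proof (rule sums_le[OF _ S ang.parseval_derivative[OF h' c' h2]])
    fix k
    have "1 \<le> (real (Suc k))\<^sup>2" by simp
    then show "(cmod (ang.coef h (int (Suc k))))\<^sup>2 + (cmod (ang.coef h (- int (Suc k))))\<^sup>2
      \<le> (real (Suc k))\<^sup>2 * ((cmod (ang.coef h (int (Suc k))))\<^sup>2 + (cmod (ang.coef h (- int (Suc k))))\<^sup>2)"
      using mult_right_mono[of 1 "(real (Suc k))\<^sup>2"] by fastforce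
  qed
qed

lemma energy_Re_Im:
  assumes "continuous_on UNIV q"
  shows "ang.energy q = ang.energy (\<lambda>s. complex_of_real (Re (q s))) + ang.energy (\<lambda>s. complex_of_real (Im (q s)))"
proof -
  have "(LINT s|circ. (cmod (q s))\<^sup>2 * \<omega> s) = (LINT s|circ. (Re (q s))\<^sup>2 * \<omega> s + (Im (q s))\<^sup>2 * \<omega> s)"
    unfolding cmod_power2 distrib_right ..
  also have "\<dots> = (LINT s|circ. (Re (q s))\<^sup>2 * \<omega> s) + (LINT s|circ. (Im (q s))\<^sup>2 * \<omega> s)"
    by (intro Bochner_Integration.integral_add integrable_circ_continuous continuous_intros assms \<omega>_cont)
  finally show ?thesis by (simp add: ang.energy_def add_divide_distrib)
qed

text \<open>The constraint and the gap only see the angular part \<open>f\<close> of \<open>E / \<xi> = g + i f\<close>. The radial part \<open>g\<close>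
  is recovered from the completed square \<open>g' - 2 \<omega> f\<close>: being antiperiodic, \<open>g\<close> is dominated by its
  derivative.\<close>

lemma planar_gap:
  assumes E': "\<And>s. (E has_vector_derivative E' s) (at s)" and c': "continuous_on UNIV E'"
    and per: "\<And>s. E (s + pi) = E s" "\<And>s. E' (s + pi) = E' s"
    and zero: "(LINT s|circ. complex_of_real (Im (cnj (u s) * E s) / r s) * u s) = 0"
  shows "cis.energy E' - cis.energy E \<ge> \<kappa> * cis.energy E"
proof -
  have Ec: "continuous_on UNIV E"
    by (intro continuous_at_imp_continuous_on ballI has_vector_derivative_continuous[OF E'])
  define q where "q s = E s / \<xi> s" for s
  define q' where "q' s = (E' s - \<eta> s * q s) / \<xi> s" for s
  have Eq: "E = (\<lambda>s. \<xi> s * q s)" and Eq': "E' = (\<lambda>s. \<eta> s * q s + \<xi> s * q' s)"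
    using \<xi>_nz by (auto simp: q_def q'_def)
  have qd: "(q has_vector_derivative q' s) (at s)" for s
  proof -
    have "((\<lambda>s. E s / \<xi> s) has_vector_derivative (E' s * \<xi> s - E s * \<eta> s) / (\<xi> s * \<xi> s)) (at s)"
      by (rule has_vector_derivative_divide_complex[OF E' \<xi>_deriv \<xi>_nz])
    moreover have "(E' s * \<xi> s - E s * \<eta> s) / (\<xi> s * \<xi> s) = q' s"
      using \<xi>_nz[of s] by (simp add: q'_def q_def field_simps)
    ultimately show ?thesis by (simp add: q_def[abs_def])
  qed
  have qc: "continuous_on UNIV q" "continuous_on UNIV q'"
    unfolding q_def[abs_def] q'_def[abs_def] using \<xi>_nz
    by (intro continuous_intros Ec c' \<xi>_cont \<eta>_cont; simp)+
  have qp: "q (s + pi) = - q s" "q' (s + pi) = - q' s" for s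
    by (simp_all add: q_def q'_def per \<xi>_antiper \<eta>_antiper)
  have q2: "q (2*pi) = q 0" using qp(1)[of pi] qp(1)[of 0] by simp
  define f f' where "f s = Im (q s)" and "f' s = Im (q' s)" for s
  define g g' where "g s = Re (q s)" and "g' s = Re (q' s)" for s
  have fd: "(f has_real_derivative f' s) (at s)" "(g has_real_derivative g' s) (at s)" for s
    using qd[of s] unfolding f_def[abs_def] f'_def g_def[abs_def] g'_def
    by (auto simp: has_vector_derivative_complex_iff)
  have fc: "continuous_on UNIV f" "continuous_on UNIV f'" "continuous_on UNIV g" "continuous_on UNIV g'"
    unfolding f_def[abs_def] f'_def[abs_def] g_def[abs_def] g'_def[abs_def] by (intro continuous_intros qc)+
  have fp: "f (s + pi) = - f s" "f' (s + pi) = - f' s" "g (s + pi) = - g s" "g' (s + pi) = - g' s" for s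
    by (simp_all add: f_def f'_def g_def g'_def qp)
  have fzero: "(LINT s|circ. f s * u s) = 0"
  proof -
    have "Im (cnj (u s) * E s) / r s = f s" for s
    proof -
      have "u s * cnj (u s) = 1"
        by (simp only: complex_norm_square[symmetric] ang.norm_u power_one of_real_1)
      moreover have "cnj (u s) * E s = (u s * cnj (u s)) * (r s * q s)"
        by (simp only: Eq \<xi>_eq mult_ac)
      ultimately have "cnj (u s) * E s = r s * q s" by (simp only: mult_1_left)
      then show ?thesis using r_pos[of s] by (simp add: f_def)
    qed
    then show ?thesis using zero by simp
  qed
  let ?F = "ang.energy (\<lambda>s. complex_of_real (f s))" and ?G = "ang.energy (\<lambda>s. complex_of_real (g s))"
  let ?N = "ang.energy (\<lambda>s. complex_of_real (g' s - 2 * \<omega> s * f s) / \<omega> s)"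
  define D where "D = ?N + ang.energy (\<lambda>s. complex_of_real (f' s) / \<omega> s) - 4 * ?F"
  have FD: "(1 - \<rho>\<^sup>2) * ?F \<le> D - ?N"
    using odd_energy_gap[OF fd(1) fc(2) fp(1,2) fzero] by (simp add: D_def)
  have onz: "\<forall>s\<in>UNIV. complex_of_real (\<omega> s) \<noteq> 0"
    using \<omega>_pos by (auto simp: less_imp_neq[symmetric])
  have GN: "?G \<le> 2 * ?N + 8 * ?F"
  proof -
    have "?G \<le> ang.energy (\<lambda>s. complex_of_real (g' s) / \<omega> s)"
      by (intro antiperiodic_energy_le has_vector_derivative_of_real fd continuous_intros fc) (simp_all add: fp)
    also have "(\<lambda>s. complex_of_real (g' s) / \<omega> s)
        = (\<lambda>s. complex_of_real (g' s - 2 * \<omega> s * f s) / \<omega> s + 2 * complex_of_real (f s))"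
    proof
      fix s
      have "complex_of_real (\<omega> s) \<noteq> 0" using onz by blast
      then show "complex_of_real (g' s) / \<omega> s
          = complex_of_real (g' s - 2 * \<omega> s * f s) / \<omega> s + 2 * complex_of_real (f s)"
        by (simp add: diff_divide_distrib)
    qed
    also have "ang.energy \<dots> \<le> 2 * ?N + 2 * ang.energy (\<lambda>s. 2 * complex_of_real (f s))"
      using onz by (intro ang.energy_add_le square_int_continuous continuous_intros fc \<omega>_cont)
    also have "ang.energy (\<lambda>s. 2 * complex_of_real (f s)) = 4 * ?F"
      by (simp add: ang.energy_def norm_mult power_mult_distrib mult.assoc)
    finally show ?thesis by simp
  qed
  have N0: "0 \<le> ?N" "0 \<le> ?F" by (rule ang.energy_nonneg)+
  have q_le: "(1 - \<rho>\<^sup>2) * ang.energy q \<le> 11 * D"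
  proof -
    have "(1 - \<rho>\<^sup>2) * ang.energy q \<le> (1 - \<rho>\<^sup>2) * (2 * ?N + 9 * ?F)"
      using GN energy_Re_Im[OF qc(1)] \<rho>_square by (intro mult_left_mono) (auto simp: f_def g_def)
    also have "\<dots> = 2 * ((1 - \<rho>\<^sup>2) * ?N) + 9 * ((1 - \<rho>\<^sup>2) * ?F)" by (simp add: algebra_simps)
    also have "\<dots> \<le> 2 * ?N + 9 * (D - ?N)"
      using FD mult_right_mono[of "1 - \<rho>\<^sup>2" 1 ?N] N0 \<rho>_square by (intro add_mono mult_left_mono) auto
    also have "\<dots> \<le> 11 * D"
    proof -
      have "0 \<le> (1 - \<rho>\<^sup>2) * ?F" using \<rho>_square N0 by (intro mult_nonneg_nonneg) auto
      then have "0 \<le> D - ?N" using FD by (rule order_trans)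
      moreover have "2 * ?N + 9 * (D - ?N) = 11 * D - (2 * (D - ?N) + 9 * ?N)"
        by (simp only: right_diff_distrib)
      ultimately show ?thesis using N0(1) by simp
    qed
    finally show ?thesis .
  qed
  have "cis.energy E = cis.energy (\<lambda>s. r s * q s)"
    by (simp add: cis_energy Eq norm_mult r_def)
  then have "2 * pi * cis.energy E \<le> (\<alpha> ^ 3 / \<beta>) * ang.W * ang.energy q"
    using energy_compare[OF qc(1)] by simp
  then have "\<kappa> * (2 * pi * cis.energy E) \<le> \<kappa> * ((\<alpha> ^ 3 / \<beta>) * ang.W * ang.energy q)"
    using \<kappa>_pos by (intro mult_left_mono) auto
  also have "\<dots> = \<alpha> * \<beta> * ang.W * ((1 - \<rho>\<^sup>2) / 11 * ang.energy q)"
    using \<kappa>_scale by (simp only: mult.assoc[symmetric]) (simp only: mult_ac)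
  also have "\<dots> = \<alpha> * \<beta> * ang.W * ((1 - \<rho>\<^sup>2) * ang.energy q / 11)" by simp
  also have "\<dots> \<le> \<alpha> * \<beta> * ang.W * D"
    using \<alpha>_pos \<alpha>\<beta> ang.W_pos q_le by (intro mult_left_mono) auto
  also have "\<dots> = 2 * pi * (cis.energy E' - cis.energy E)"
    unfolding D_def Eq Eq' f_def f'_def g'_def by (rule liouville_planar[OF qd qc(2) q2, symmetric])
  finally have "(2 * pi) * (\<kappa> * cis.energy E) \<le> (2 * pi) * (cis.energy E' - cis.energy E)"
    by (simp only: mult_ac)
  then show ?thesis by (rule mult_left_le_imp_le) simp
qed

end

section \<open>Density of trigonometric sums\<close>

lemma AE_circ_negligible:
  assumes "negligible N" "\<And>s. s \<in> {0..2*pi} \<Longrightarrow> s \<notin> N \<Longrightarrow> P s"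
  shows "AE s in circ. P s"
proof -
  have "AE s in lebesgue. s \<notin> N"
    using assms(1) by (simp add: AE_not_in negligible_iff_null_sets)
  then show ?thesis
    by (subst AE_restrict_space_iff) (use assms(2) in \<open>auto elim!: eventually_mono\<close>)
qed

text \<open>The radial retraction onto the disc of radius \<open>B\<close>.\<close>

definition clamp_norm :: "nat \<Rightarrow> complex \<Rightarrow> complex" where
  "clamp_norm B z = (real B / max (real B) (cmod z)) *\<^sub>R z"

lemma clamp_norm_le: "cmod (clamp_norm B z) \<le> real B"
proof (cases "cmod z \<le> real B")
  case True
  then show ?thesis by (cases "B = 0") (auto simp: clamp_norm_def max_def)
next
  case False
  then show ?thesis by (simp add: clamp_norm_def max_def)
qed

lemma clamp_norm_diff_le: "cmod (z - clamp_norm B z) \<le> cmod z"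
proof -
  define t where "t = real B / max (real B) (cmod z)"
  have t: "0 \<le> t" "t \<le> 1" by (auto simp: t_def divide_le_eq_1)
  have "z - clamp_norm B z = (1 - t) *\<^sub>R z" by (simp add: clamp_norm_def t_def scaleR_left_diff_distrib)
  then show ?thesis using t by (simp add: mult_left_le_one_le)
qed

lemma clamp_norm_eq: "cmod z \<le> real B \<Longrightarrow> B > 0 \<Longrightarrow> clamp_norm B z = z"
  by (simp add: clamp_norm_def max_def)

lemma clamp_norm_continuous: "B > 0 \<Longrightarrow> continuous_on UNIV (clamp_norm B)"
  unfolding clamp_norm_def[abs_def] by (intro continuous_intros) (auto simp: max_def)

lemma clamp_norm_energy_tendsto:
  assumes f: "square_int f"
  shows "(\<lambda>B. cis.energy (\<lambda>s. f s - clamp_norm (Suc B) (f s))) \<longlonglongrightarrow> 0"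
proof -
  have [measurable]: "f \<in> borel_measurable circ" using f by (simp add: square_int_def)
  have [measurable]: "(\<lambda>s. clamp_norm (Suc B) (f s)) \<in> borel_measurable circ" for B
    by (rule borel_measurable_continuous_on[OF clamp_norm_continuous]) auto
  have "(\<lambda>B. LINT s|circ. (cmod (f s - clamp_norm (Suc B) (f s)))\<^sup>2) \<longlonglongrightarrow> (LINT s|circ. 0)"
  proof (rule integral_dominated_convergence)
    show "integrable circ (\<lambda>s. (cmod (f s))\<^sup>2)" using f by (simp add: square_int_def)
    show "AE s in circ. (\<lambda>B. (cmod (f s - clamp_norm (Suc B) (f s)))\<^sup>2) \<longlonglongrightarrow> 0"
    proof (rule AE_I2)
      fix s
      obtain M :: nat where M: "cmod (f s) \<le> real M" using real_arch_simple by blast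
      have "\<forall>\<^sub>F B in sequentially. (cmod (f s - clamp_norm (Suc B) (f s)))\<^sup>2 = 0"
        using eventually_ge_at_top[of M]
        by eventually_elim (subst clamp_norm_eq; use M in simp)
      then show "(\<lambda>B. (cmod (f s - clamp_norm (Suc B) (f s)))\<^sup>2) \<longlonglongrightarrow> 0"
        by (rule tendsto_eventually)
    qed
    show "AE s in circ. norm ((cmod (f s - clamp_norm (Suc B) (f s)))\<^sup>2) \<le> (cmod (f s))\<^sup>2" for B
      by (rule AE_I2) (auto intro!: power_mono clamp_norm_diff_le)
  qed measurable
  then have "(\<lambda>B. (LINT s|circ. (cmod (f s - clamp_norm (Suc B) (f s)))\<^sup>2) / (2*pi)) \<longlonglongrightarrow> (LINT s|circ. 0) / (2*pi)"
    by (intro tendsto_divide tendsto_const) auto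
  then show ?thesis by (simp add: cis_energy)
qed

lemma cutoff_tendsto_1:
  assumes "0 < s" "s < 2*pi"
  shows "(\<lambda>n. min 1 (real n * min s (2*pi - s))) \<longlonglongrightarrow> 1"
proof -
  obtain M :: nat where M: "1 / min s (2*pi - s) \<le> real M" using real_arch_simple by blast
  have pos: "min s (2*pi - s) > 0" using assms by simp
  have "\<forall>\<^sub>F n in sequentially. min 1 (real n * min s (2*pi - s)) = 1"
    using eventually_ge_at_top[of M]
  proof eventually_elim
    case (elim n)
    then have "1 / min s (2*pi - s) \<le> real n" using M by linarith
    then have "1 \<le> real n * min s (2*pi - s)" using pos by (simp only: pos_divide_le_eq)
    then show ?case by simp
  qed
  then show ?thesis by (rule tendsto_eventually)
qed

text \<open>A bounded function is an almost everywhere limit of continuous functions; multiplying by a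
  cutoff that vanishes at both ends of the period makes them periodic.\<close>

lemma trig_approx_bounded:
  assumes f: "f \<in> borel_measurable circ" and B: "B > 0" and e: "e > 0"
  shows "\<exists>T\<in>cis.trig. cis.energy (\<lambda>s. clamp_norm B (f s) - T s) < e"
proof -
  have "f measurable_on {0..2*pi}"
    using f by (simp add: measurable_on_iff_borel_measurable)
  then obtain N g where N: "negligible N" and g: "\<And>n. continuous_on UNIV (g n)"
    and lim: "\<And>s. s \<notin> N \<Longrightarrow> (\<lambda>n::nat. g n s) \<longlonglongrightarrow> (if s \<in> {0..2*pi} then f s else 0)"
    unfolding measurable_on_def by blast
  define h where "h n s = complex_of_real (min 1 (real n * min s (2*pi - s))) * clamp_norm B (g n s)" for n s
  have cB: "continuous_on UNIV (clamp_norm B)" by (rule clamp_norm_continuous[OF B])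
  have hc: "continuous_on UNIV (h n)" for n
    unfolding h_def[abs_def]
    by (intro continuous_intros continuous_on_compose2[OF cB] g) auto
  have hB: "cmod (h n s) \<le> B" if "s \<in> {0..2*pi}" for n s
  proof -
    have "0 \<le> min 1 (real n * min s (2*pi - s))" using that by auto
    then have "cmod (h n s) \<le> 1 * real B"
      unfolding h_def norm_mult norm_of_real
      by (intro mult_mono clamp_norm_le) auto
    then show ?thesis by simp
  qed
  have fm [measurable]: "(\<lambda>s. clamp_norm B (f s)) \<in> borel_measurable circ"
    by (rule borel_measurable_continuous_on[OF cB f])
  have hm [measurable]: "h n \<in> borel_measurable circ" for n
    by (rule measurable_circ_continuous[OF hc])
  have "(\<lambda>n. LINT s|circ. (cmod (clamp_norm B (f s) - h n s))\<^sup>2) \<longlonglongrightarrow> (LINT s|circ. 0)"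
  proof (rule integral_dominated_convergence)
    show "integrable circ (\<lambda>s. (2 * real B)\<^sup>2)" by (rule integrable_circ_continuous) simp
    show "AE s in circ. (\<lambda>n. (cmod (clamp_norm B (f s) - h n s))\<^sup>2) \<longlonglongrightarrow> 0"
    proof (rule AE_circ_negligible[of "insert 0 (insert (2*pi) N)"])
      show "negligible (insert 0 (insert (2*pi) N))" using N by simp
      fix s assume s: "s \<in> {0..2*pi}" "s \<notin> insert 0 (insert (2*pi) N)"
      have "(\<lambda>n. g n s) \<longlonglongrightarrow> f s" using lim[of s] s by simp
      then have "(\<lambda>n. clamp_norm B (g n s)) \<longlonglongrightarrow> clamp_norm B (f s)"
        by (rule continuous_on_tendsto_compose[OF cB]) auto
      moreover have "(\<lambda>n. complex_of_real (min 1 (real n * min s (2*pi - s)))) \<longlonglongrightarrow> complex_of_real 1"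
        using s by (intro tendsto_of_real cutoff_tendsto_1) auto
      ultimately have "(\<lambda>n. h n s) \<longlonglongrightarrow> complex_of_real 1 * clamp_norm B (f s)"
        unfolding h_def by (intro tendsto_mult)
      then have "(\<lambda>n. (cmod (clamp_norm B (f s) - h n s))\<^sup>2) \<longlonglongrightarrow> (cmod (clamp_norm B (f s) - complex_of_real 1 * clamp_norm B (f s)))\<^sup>2"
        by (intro tendsto_intros)
      then show "(\<lambda>n. (cmod (clamp_norm B (f s) - h n s))\<^sup>2) \<longlonglongrightarrow> 0" by simp
    qed
    show "AE s in circ. norm ((cmod (clamp_norm B (f s) - h n s))\<^sup>2) \<le> (2 * real B)\<^sup>2" for n
    proof (rule AE_I2)
      fix s assume "s \<in> space circ"
      then have "cmod (clamp_norm B (f s) - h n s) \<le> real B + real B"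
        using hB[of s n] clamp_norm_le[of B "f s"] norm_triangle_ineq4[of "clamp_norm B (f s)" "h n s"]
        by force
      then have "(cmod (clamp_norm B (f s) - h n s))\<^sup>2 \<le> (2 * real B)\<^sup>2"
        by (intro power_mono) auto
      then show "norm ((cmod (clamp_norm B (f s) - h n s))\<^sup>2) \<le> (2 * real B)\<^sup>2" by simp
    qed
  qed measurable
  then have "(\<lambda>n. (LINT s|circ. (cmod (clamp_norm B (f s) - h n s))\<^sup>2) / (2*pi)) \<longlonglongrightarrow> (LINT s|circ. 0) / (2*pi)"
    by (intro tendsto_divide tendsto_const) auto
  then have "(\<lambda>n. cis.energy (\<lambda>s. clamp_norm B (f s) - h n s)) \<longlonglongrightarrow> 0"
    by (simp add: cis_energy)
  then have "\<forall>\<^sub>F n in sequentially. cis.energy (\<lambda>s. clamp_norm B (f s) - h n s) < e / 4"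
    using e by (intro order_tendstoD(2)) auto
  then obtain n where n: "cis.energy (\<lambda>s. clamp_norm B (f s) - h n s) < e / 4"
    using eventually_happens trivial_limit_sequentially by blast
  obtain T where T: "T \<in> cis.trig" "\<forall>s\<in>{0..2*pi}. cmod (h n s - T s) < sqrt (e / 8)"
    using cis.trig_dense[of "h n" "sqrt (e / 8)"] continuous_on_subset[OF hc] e by (auto simp: h_def)
  have sqT: "square_int (\<lambda>s. h n s - T s)"
    by (intro square_int_diff square_int_continuous hc cis.trig_continuous T(1))
  have sqh: "square_int (\<lambda>s. clamp_norm B (f s) - h n s)"
  proof (rule square_int_diff[OF _ square_int_continuous[OF hc]])
    show "square_int (\<lambda>s. clamp_norm B (f s))"
      by (rule square_int_bound[OF square_int_continuous[of "\<lambda>_. 1::real"] fm, of B])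
         (auto intro: clamp_norm_le)
  qed
  have "cis.energy (\<lambda>s. h n s - T s) \<le> (sqrt (e / 8))\<^sup>2"
    using T(2) by (intro cis.energy_le_sup[OF sqT]) (simp add: less_imp_le)
  then have "cis.energy (\<lambda>s. h n s - T s) \<le> e / 8" using e by simp
  moreover have "cis.energy (\<lambda>s. (clamp_norm B (f s) - h n s) + (h n s - T s))
      \<le> 2 * cis.energy (\<lambda>s. clamp_norm B (f s) - h n s) + 2 * cis.energy (\<lambda>s. h n s - T s)"
    by (rule cis.energy_add_le[OF sqh sqT])
  ultimately have "cis.energy (\<lambda>s. clamp_norm B (f s) - T s) < e" using n e by simp
  with T(1) show ?thesis by blast
qed

lemma trig_approx_square_int:
  assumes f: "square_int f" and e: "e > 0"
  shows "\<exists>T\<in>cis.trig. cis.energy (\<lambda>s. f s - T s) < e"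
proof -
  have fm: "f \<in> borel_measurable circ" using f by (simp add: square_int_def)
  have "\<forall>\<^sub>F B in sequentially. cis.energy (\<lambda>s. f s - clamp_norm (Suc B) (f s)) < e / 4"
    using clamp_norm_energy_tendsto[OF f] e by (intro order_tendstoD(2)) auto
  then obtain B where B: "cis.energy (\<lambda>s. f s - clamp_norm (Suc B) (f s)) < e / 4"
    using eventually_happens trivial_limit_sequentially by blast
  obtain T where T: "T \<in> cis.trig" "cis.energy (\<lambda>s. clamp_norm (Suc B) (f s) - T s) < e / 4"
    using trig_approx_bounded[OF fm, of "Suc B" "e / 4"] e by auto
  have cm: "(\<lambda>s. clamp_norm (Suc B) (f s)) \<in> borel_measurable circ"
    by (rule borel_measurable_continuous_on[OF clamp_norm_continuous fm]) simp
  have sqc: "square_int (\<lambda>s. clamp_norm (Suc B) (f s))"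
    by (rule square_int_bound[OF square_int_continuous[of "\<lambda>_. 1::real"] cm, of "real (Suc B)"])
       (use clamp_norm_le[of "Suc B"] in auto)
  have "cis.energy (\<lambda>s. (f s - clamp_norm (Suc B) (f s)) + (clamp_norm (Suc B) (f s) - T s))
      \<le> 2 * cis.energy (\<lambda>s. f s - clamp_norm (Suc B) (f s)) + 2 * cis.energy (\<lambda>s. clamp_norm (Suc B) (f s) - T s)"
    by (intro cis.energy_add_le square_int_diff sqc f square_int_continuous cis.trig_continuous T(1))
  then have "cis.energy (\<lambda>s. f s - T s) < e" using B T(2) by simp
  with T(1) show ?thesis by blast
qed

lemma fourier_tail_tendsto_0:
  assumes "square_int f" shows "cis.tail f \<longlonglongrightarrow> 0"
  by (rule cis.tail_tendsto_0[OF assms trig_approx_square_int[OF assms]])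

text \<open>Completeness of the trigonometric system; this is what makes weak derivatives unique.\<close>

lemma energy_0_if_coef_0:
  assumes "square_int f" "\<And>m. cis.coef f m = 0"
  shows "cis.energy f = 0"
proof -
  have "cis.tail f = (\<lambda>_. cis.energy f)" by (auto simp: cis.tail_def assms(2))
  with fourier_tail_tendsto_0[OF assms(1)] show ?thesis by (simp add: LIMSEQ_const_iff)
qed

section \<open>Coercivity for weakly differentiable functions\<close>

context ellipse_geometry begin

text \<open>The derivative of the constraint at the ellipse: a planar displacement changes the direction \<open>u\<close>
  only through its component orthogonal to \<open>u\<close>, and a vertical one tilts it by \<open>z / r\<close>. A
  factor \<open>i\<close> is dropped in the first case.\<close>

definition planar_constraint :: "(real \<Rightarrow> complex) \<Rightarrow> complex" where
  "planar_constraint y = (LINT s|circ. complex_of_real (Im (cnj (u s) * y s) / r s) * u s)"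

definition radial_constraint :: "(real \<Rightarrow> complex) \<Rightarrow> complex" where
  "radial_constraint z = (LINT s|circ. z s / r s)"

end

lemma integral_norm_square_le:
  fixes f :: "real \<Rightarrow> 'a::euclidean_space"
  assumes f: "square_int f"
  shows "(LINT s|circ. norm (f s))\<^sup>2 \<le> 2 * pi * (LINT s|circ. (norm (f s))\<^sup>2)"
proof -
  let ?I = "LINT s|circ. norm (f s)" and ?m = "(LINT s|circ. norm (f s)) / (2*pi)"
  have i1: "integrable circ (\<lambda>s. norm (f s))" using integrable_square_int[OF f] by simp
  have i2: "integrable circ (\<lambda>s. (norm (f s))\<^sup>2)" using f by (simp add: square_int_def)
  have "0 \<le> (LINT s|circ. (norm (f s) - ?m)\<^sup>2)"
    by (rule integral_nonneg_AE) simp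
  also have "(\<lambda>s. (norm (f s) - ?m)\<^sup>2) = (\<lambda>s. (norm (f s))\<^sup>2 - 2 * (?m * norm (f s)) + ?m\<^sup>2)"
    by (simp add: power2_diff algebra_simps)
  also have "integral\<^sup>L circ \<dots> = (LINT s|circ. (norm (f s))\<^sup>2) - 2 * (LINT s|circ. ?m * norm (f s)) + (LINT s|circ. ?m\<^sup>2)"
    by (rule integral_three_terms) (use i1 i2 in auto)
  also have "\<dots> = (LINT s|circ. (norm (f s))\<^sup>2) - ?I\<^sup>2 / (2*pi)"
    by (simp add: measure_restrict_space power2_eq_square field_simps)
  finally show ?thesis by (simp add: field_simps)
qed

lemma cis_powi_deriv: "((\<lambda>s. cis s powi m) has_vector_derivative (\<i> * m * cis s powi m)) (at s)"
  using cis.powi_deriv[of m s] by simp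

text \<open>An approximation scheme: if all partial Fourier sums, corrected by constants tending to
  \<open>0\<close>, satisfy the gap estimate then so does the limit. For the
  derivative, Bessel's inequality points in the right direction.\<close>

lemma gap_of_partial_sums:
  fixes y g :: "real \<Rightarrow> complex" and c :: "nat \<Rightarrow> complex"
  assumes y: "square_int y" and g: "square_int g"
    and weak: "\<And>m. cis.coef g m = \<i> * m * cis.coef y m"
    and c: "c \<longlonglongrightarrow> 0"
    and gap: "\<And>N T T'. T = (\<lambda>s. (\<Sum>m\<in>{-int N..int N}. cis.coef y m * cis s powi m) + c N) \<Longrightarrow>
        (\<And>s. (T has_vector_derivative T' s) (at s)) \<Longrightarrow> continuous_on UNIV T' \<Longrightarrow>
        (\<And>s. T (s + 2*pi) = T s) \<Longrightarrow> (\<And>s. T' (s + 2*pi) = T' s) \<Longrightarrow>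
        cis.energy T' - cis.energy T \<ge> k * (cis.energy T - ((cmod (cis.coef T 1))\<^sup>2 + (cmod (cis.coef T (-1)))\<^sup>2))"
  shows "cis.energy g - cis.energy y
    \<ge> k * (cis.energy y - ((cmod (cis.coef y 1))\<^sup>2 + (cmod (cis.coef y (-1)))\<^sup>2))"
proof -
  define a where "a = cis.coef y"
  define b where "b = (cmod (a 1))\<^sup>2 + (cmod (a (-1)))\<^sup>2"
  define d where "d N m = (if m = 0 then a 0 + c N else a m)" for N m
  define T where "T N s = (\<Sum>m\<in>{-int N..int N}. d N m * cis s powi m)" for N s
  define T' where "T' N s = (\<Sum>m\<in>{-int N..int N}. (\<i> * m * a m) * cis s powi m)" for N s
  have T_eq: "T N = (\<lambda>s. (\<Sum>m\<in>{-int N..int N}. a m * cis s powi m) + c N)" for N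
  proof
    fix s
    have "T N s = (\<Sum>m\<in>{-int N..int N}. a m * cis s powi m + (if m = 0 then c N else 0))"
      unfolding T_def d_def by (intro sum.cong refl) (auto simp: distrib_right)
    then show "T N s = (\<Sum>m\<in>{-int N..int N}. a m * cis s powi m) + c N"
      by (simp add: sum.distrib)
  qed
  have energy_trig: "cis.energy (\<lambda>s. \<Sum>m\<in>F. e m * cis s powi m) = (\<Sum>m\<in>F. (cmod (e m))\<^sup>2)"
    if "finite F" for F e
  proof -
    have "cis.energy (\<lambda>s. 0 - (\<Sum>m\<in>F. e m * cis s powi m)) = (\<Sum>m\<in>F. (cmod (e m))\<^sup>2)"
      using cis.energy_diff_trig[OF square_int_continuous[of "\<lambda>_. 0"] that, of e]
      by (simp add: cis.coef_def cis.energy_def)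
    then show ?thesis by (simp add: cis.energy_def)
  qed
  have ET: "cis.energy (T N) = cis.energy y - cis.tail y N + ((cmod (a 0 + c N))\<^sup>2 - (cmod (a 0))\<^sup>2)" for N
  proof -
    have "cis.energy (T N) = (\<Sum>m\<in>{-int N..int N}. (cmod (d N m))\<^sup>2)"
      unfolding T_def by (rule energy_trig) simp
    also have "\<dots> = (\<Sum>m\<in>{-int N..int N}. (cmod (a m))\<^sup>2 + (if m = 0 then (cmod (a 0 + c N))\<^sup>2 - (cmod (a 0))\<^sup>2 else 0))"
      unfolding d_def by (intro sum.cong refl) auto
    also have "\<dots> = (\<Sum>m\<in>{-int N..int N}. (cmod (a m))\<^sup>2) + ((cmod (a 0 + c N))\<^sup>2 - (cmod (a 0))\<^sup>2)"
      by (simp add: sum.distrib)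
    finally show ?thesis by (simp add: cis.tail_def a_def)
  qed
  have EL: "(\<lambda>N. cis.energy (T N)) \<longlonglongrightarrow> cis.energy y"
  proof -
    have "(\<lambda>N. cis.energy y - cis.tail y N + ((cmod (a 0 + c N))\<^sup>2 - (cmod (a 0))\<^sup>2))
        \<longlonglongrightarrow> cis.energy y - 0 + ((cmod (a 0 + 0))\<^sup>2 - (cmod (a 0))\<^sup>2)"
      by (intro tendsto_intros fourier_tail_tendsto_0 y c)
    then show ?thesis by (simp add: ET)
  qed
  have ET': "cis.energy (T' N) \<le> cis.energy g" for N
  proof -
    have "cis.energy (T' N) = (\<Sum>m\<in>{-int N..int N}. (cmod (cis.coef g m))\<^sup>2)"
      unfolding T'_def weak a_def by (rule energy_trig) simp
    also have "\<dots> \<le> cis.energy g" by (rule cis.bessel[OF g]) simp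
    finally show ?thesis .
  qed
  have ineq: "k * (cis.energy (T N) - b) \<le> cis.energy g - cis.energy (T N)" if "N \<ge> 1" for N
  proof -
    have "cis.energy (T' N) - cis.energy (T N)
      \<ge> k * (cis.energy (T N) - ((cmod (cis.coef (T N) 1))\<^sup>2 + (cmod (cis.coef (T N) (-1)))\<^sup>2))"
    proof (rule gap)
      show "T N = (\<lambda>s. (\<Sum>m\<in>{-int N..int N}. cis.coef y m * cis s powi m) + c N)"
        by (simp add: T_eq a_def)
      show "(T N has_vector_derivative T' N s) (at s)" for s
      proof -
        have "((\<lambda>s. (\<Sum>m\<in>{-int N..int N}. a m * cis s powi m) + c N) has_vector_derivative
            (\<Sum>m\<in>{-int N..int N}. a m * (\<i> * m * cis s powi m)) + 0) (at s)"
          by (intro has_vector_derivative_add has_vector_derivative_const has_vector_derivative_sum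
              has_vector_derivative_mult_right cis_powi_deriv)
        then show ?thesis unfolding T_eq T'_def by (simp add: mult_ac)
      qed
      show "continuous_on UNIV (T' N)"
        unfolding T'_def[abs_def] by (intro continuous_intros cis.powi_cont)
      have "cis (s + 2*pi) = cis s" for s by (simp add: complex_eq_iff)
      then show "T N (s + 2*pi) = T N s" "T' N (s + 2*pi) = T' N s" for s
        by (simp_all add: T_def T'_def)
    qed
    moreover have "cis.coef (T N) m = a m" if "m \<in> {1, -1}" for m
      unfolding T_def using \<open>N \<ge> 1\<close> that by (subst cis.coef_sum) (auto simp: d_def)
    ultimately show ?thesis using ET'[of N] by (simp add: b_def)
  qed
  have "k * (cis.energy y - b) \<le> cis.energy g - cis.energy y"
  proof (rule LIMSEQ_le)
    show "(\<lambda>N. k * (cis.energy (T N) - b)) \<longlonglongrightarrow> k * (cis.energy y - b)"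
      by (intro tendsto_intros EL)
    show "(\<lambda>N. cis.energy g - cis.energy (T N)) \<longlonglongrightarrow> cis.energy g - cis.energy y"
      by (intro tendsto_intros EL)
  qed (use ineq in blast)
  then show ?thesis by (simp add: b_def a_def)
qed

text \<open>The common frame for both constraints. A real-linear functional \<open>L\<close> that is bounded in the mean
  square and bounded below on constants can be corrected by small constants, so that an estimate for
  smooth functions in the kernel of \<open>L\<close> passes to limits of Fourier sums; if \<open>L\<close> is moreover
  invariant under the half-period shift, functions of period \<open>\<pi>\<close> are enough.\<close>

lemma coercive_of_half_period_gap:
  fixes L :: "(real \<Rightarrow> complex) \<Rightarrow> complex"
  assumes y: "square_int y" and g: "square_int g"
    and weak: "\<And>m. cis.coef g m = \<i> * m * cis.coef y m"
    and zero: "L y = 0"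
    and add: "\<And>f h. square_int f \<Longrightarrow> square_int h \<Longrightarrow> L (\<lambda>s. f s + h s) = L f + L h"
    and scale: "\<And>f t. L (\<lambda>s. t *\<^sub>R f s) = t *\<^sub>R L f"
    and shift: "\<And>f. continuous_on UNIV f \<Longrightarrow> (\<And>s. f (s + 2*pi) = f s) \<Longrightarrow> L (\<lambda>s. f (s + pi)) = L f"
    and bound: "\<And>f. square_int f \<Longrightarrow> cmod (L f) \<le> K * sqrt (cis.energy f)"
    and const: "\<And>c. b * cmod c \<le> cmod (L (\<lambda>_. c))" and b: "b > 0"
    and gap: "\<And>E E'. (\<And>s. (E has_vector_derivative E' s) (at s)) \<Longrightarrow> continuous_on UNIV E' \<Longrightarrow>
        (\<And>s. E (s + pi) = E s) \<Longrightarrow> (\<And>s. E' (s + pi) = E' s) \<Longrightarrow> L E = 0 \<Longrightarrow>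
        cis.energy E' - cis.energy E \<ge> k * cis.energy E"
    and k: "k \<le> 3"
  shows "cis.energy g - cis.energy y
    \<ge> k * (cis.energy y - ((cmod (cis.coef y 1))\<^sup>2 + (cmod (cis.coef y (-1)))\<^sup>2))"
proof -
  define S where "S N s = (\<Sum>m\<in>{-int N..int N}. cis.coef y m * cis s powi m)" for N s
  have sqS: "square_int (S N)" for N
    unfolding S_def[abs_def] by (intro square_int_continuous continuous_intros cis.powi_cont)
  have sq: "square_int (\<lambda>_. c :: complex)" for c by (rule square_int_continuous) simp
  have lin: "linear (\<lambda>c. L (\<lambda>_. c))"
    by (rule linearI) (rule add[OF sq sq] scale)+
  have "inj (\<lambda>c. L (\<lambda>_. c))"
  proof (subst linear_injective_0[OF lin], intro allI impI)
    fix c assume "L (\<lambda>_. c) = 0"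
    then have "\<not> 0 < b * cmod c" using const[of c] by (simp only: norm_zero not_less)
    then have "\<not> 0 < cmod c" using mult_pos_pos[OF b] by blast
    then show "c = 0" by simp
  qed
  from linear_injective_imp_surjective[OF lin this]
  have "\<forall>N. \<exists>c. L (\<lambda>_. c) = - L (S N)" by (metis surjD)
  from choice[OF this] obtain c where c: "\<And>N. L (\<lambda>_. c N) = - L (S N)" by blast
  have S_le: "cmod (L (S N)) \<le> K * sqrt (cis.tail y N)" for N
  proof -
    have "L (\<lambda>s. (y s - S N s) + S N s) = L (\<lambda>s. y s - S N s) + L (S N)"
      by (intro add square_int_diff y sqS)
    then have "L (S N) = - L (\<lambda>s. y s - S N s)"
      using zero by (simp add: eq_neg_iff_add_eq_0 add.commute)
    then have "cmod (L (S N)) \<le> K * sqrt (cis.energy (\<lambda>s. y s - S N s))"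
      using bound[OF square_int_diff[OF y sqS]] by simp
    then show ?thesis unfolding S_def cis.energy_partial_sum[OF y] .
  qed
  have c0: "c \<longlonglongrightarrow> 0"
  proof (rule Lim_null_comparison)
    have "(\<lambda>N. K * sqrt (cis.tail y N) / b) \<longlonglongrightarrow> K * sqrt 0 / b"
      by (intro tendsto_intros fourier_tail_tendsto_0[OF y]) (use b in simp)
    then show "(\<lambda>N. K * sqrt (cis.tail y N) / b) \<longlonglongrightarrow> 0" by simp
    have "b * cmod (c N) \<le> K * sqrt (cis.tail y N)" for N
      using order_trans[OF const[of "c N"]] S_le[of N] by (simp add: c)
    then show "\<forall>\<^sub>F N in sequentially. norm (c N) \<le> K * sqrt (cis.tail y N) / b"
      using b by (intro eventuallyI) (simp add: pos_le_divide_eq mult.commute)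
  qed
  show ?thesis
  proof (rule gap_of_partial_sums[OF y g weak c0])
    fix N T T'
    assume T: "T = (\<lambda>s. (\<Sum>m\<in>{-int N..int N}. cis.coef y m * cis s powi m) + c N)"
      and T': "\<And>s. (T has_vector_derivative T' s) (at s)" "continuous_on UNIV T'"
      and per: "\<And>s. T (s + 2*pi) = T s" "\<And>s. T' (s + 2*pi) = T' s"
    have Tc: "continuous_on UNIV T"
      by (intro continuous_at_imp_continuous_on ballI has_vector_derivative_continuous[OF T'(1)])
    have Ts: "((\<lambda>s. T (s + pi)) has_vector_derivative T' (s + pi)) (at s)" for s
    proof -
      have "((\<lambda>s. s + pi) has_vector_derivative 1) (at s)"
        unfolding has_real_derivative_iff_has_vector_derivative[symmetric]
        by (auto intro!: derivative_eq_intros)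
      from vector_diff_chain_at[OF this T'(1)] show ?thesis by (simp add: o_def)
    qed
    have sc: "continuous_on UNIV (\<lambda>s. T (s + pi))" "continuous_on UNIV (\<lambda>s. T' (s + pi))"
      by (intro continuous_on_compose2[OF Tc] continuous_on_compose2[OF T'(2)] continuous_intros; simp)+
    have per': "T (s + pi + pi) = T s" "T' (s + pi + pi) = T' s" for s
      using per[of s] by (simp_all add: add.assoc)
    have "L T = L (S N) + L (\<lambda>_. c N)"
      unfolding T S_def[symmetric] by (rule add[OF sqS sq])
    then have LT: "L T = 0" by (simp add: c)
    show "cis.energy T' - cis.energy T
      \<ge> k * (cis.energy T - ((cmod (cis.coef T 1))\<^sup>2 + (cmod (cis.coef T (-1)))\<^sup>2))"
    proof (rule half_period_gap[OF T' per gap k])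
      show "((\<lambda>s. (T s + T (s + pi)) / 2) has_vector_derivative (T' s + T' (s + pi)) / 2) (at s)" for s
        by (auto intro!: derivative_eq_intros T'(1) Ts)
      show "continuous_on UNIV (\<lambda>s. (T' s + T' (s + pi)) / 2)"
        by (intro continuous_intros T'(2) sc) simp
      show "(T (s + pi) + T (s + pi + pi)) / 2 = (T s + T (s + pi)) / 2"
        "(T' (s + pi) + T' (s + pi + pi)) / 2 = (T' s + T' (s + pi)) / 2" for s
        unfolding per' by (simp_all only: add.commute)
      have "L (\<lambda>s. (1/2) *\<^sub>R (T s + T (s + pi))) = (1/2) *\<^sub>R (L T + L (\<lambda>s. T (s + pi)))"
        unfolding scale by (subst add) (auto intro: square_int_continuous Tc sc)
      also have "\<dots> = 0" using LT shift[OF Tc per(1)] by simp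
      also have "(\<lambda>s. (1/2) *\<^sub>R (T s + T (s + pi))) = (\<lambda>s. (T s + T (s + pi)) / 2)"
        by (simp add: scaleR_conv_of_real)
      finally show "L (\<lambda>s. (T s + T (s + pi)) / 2) = 0" .
    qed
  qed
qed

context ellipse_geometry begin

lemma kernel_norm_le:
  "cmod (complex_of_real (Im (cnj (u s) * z) / r s) * u s) \<le> cmod z / \<beta>"
  "cmod (z / r s) \<le> cmod z / \<beta>"
proof -
  have le: "cmod z / r s \<le> cmod z / \<beta>"
    using r_bounds(1)[of s] \<alpha>\<beta> r_pos[of s] by (intro divide_left_mono) auto
  have "\<bar>Im (cnj (u s) * z)\<bar> \<le> cmod z"
    using abs_Im_le_cmod[of "cnj (u s) * z"] by (simp add: norm_mult)
  then have "\<bar>Im (cnj (u s) * z)\<bar> / r s \<le> cmod z / r s"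
    using r_pos[of s] by (intro divide_right_mono) auto
  then have "\<bar>Im (cnj (u s) * z)\<bar> / r s \<le> cmod z / \<beta>" using le by (rule order_trans)
  then show "cmod (complex_of_real (Im (cnj (u s) * z) / r s) * u s) \<le> cmod z / \<beta>"
    by (simp only: norm_mult norm_of_real ang.norm_u mult_1_right abs_divide abs_of_pos[OF r_pos])
  show "cmod (z / r s) \<le> cmod z / \<beta>"
    using le by (simp only: norm_divide norm_of_real abs_of_pos[OF r_pos])
qed

lemma kernel_integrable:
  assumes "square_int y"
  shows "integrable circ (\<lambda>s. complex_of_real (Im (cnj (u s) * y s) / r s) * u s)"
    "integrable circ (\<lambda>s. (y s :: complex) / r s)"
proof -
  have [measurable]: "y \<in> borel_measurable circ" using assms by (simp add: square_int_def)
  have [measurable]: "u \<in> borel_measurable circ" "r \<in> borel_measurable circ"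
    by (intro measurable_circ_continuous ang.u_cont r_cont)+
  have [measurable]: "(\<lambda>s. cnj (u s)) \<in> borel_measurable circ"
    by (intro measurable_circ_continuous continuous_intros ang.u_cont)
  have [measurable]: "(\<lambda>s. Im (cnj (u s) * y s)) \<in> borel_measurable circ"
    by (rule borel_measurable_continuous_on[of Im]) (auto intro: continuous_intros)
  have i: "integrable circ (\<lambda>s. cmod (y s) / \<beta>)" using integrable_square_int[OF assms] by simp
  show "integrable circ (\<lambda>s. complex_of_real (Im (cnj (u s) * y s) / r s) * u s)"
  proof (rule Bochner_Integration.integrable_bound[OF i])
    show "AE s in circ. cmod (complex_of_real (Im (cnj (u s) * y s) / r s) * u s) \<le> norm (cmod (y s) / \<beta>)"
      using \<alpha>\<beta> by (intro AE_I2 order_trans[OF kernel_norm_le(1)]) simp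
  qed measurable
  show "integrable circ (\<lambda>s. y s / r s)"
  proof (rule Bochner_Integration.integrable_bound[OF i])
    show "AE s in circ. cmod (y s / r s) \<le> norm (cmod (y s) / \<beta>)"
      using \<alpha>\<beta> by (intro AE_I2 order_trans[OF kernel_norm_le(2)]) simp
  qed measurable
qed

lemma planar_constraint_add:
  assumes "square_int f" "square_int g"
  shows "planar_constraint (\<lambda>s. f s + g s) = planar_constraint f + planar_constraint g"
  unfolding planar_constraint_def
  by (subst Bochner_Integration.integral_add[symmetric, OF kernel_integrable(1)[OF assms(1)] kernel_integrable(1)[OF assms(2)]])
     (simp add: distrib_left distrib_right add_divide_distrib)

lemma radial_constraint_add:
  assumes "square_int f" "square_int g"
  shows "radial_constraint (\<lambda>s. f s + g s) = radial_constraint f + radial_constraint g"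
  unfolding radial_constraint_def
  by (subst Bochner_Integration.integral_add[symmetric, OF kernel_integrable(2)[OF assms(1)] kernel_integrable(2)[OF assms(2)]])
     (simp add: add_divide_distrib)

lemma constraint_bound:
  assumes y: "square_int y"
  shows "cmod (planar_constraint y) \<le> 2 * pi / \<beta> * sqrt (cis.energy y)"
    "cmod (radial_constraint y) \<le> 2 * pi / \<beta> * sqrt (cis.energy y)"
proof -
  have i: "integrable circ (\<lambda>s. cmod (y s) / \<beta>)" using integrable_square_int[OF y] by simp
  have "(LINT s|circ. cmod (y s))\<^sup>2 \<le> (2 * pi)\<^sup>2 * cis.energy y"
    using integral_norm_square_le[OF y] by (simp add: cis_energy power2_eq_square)
  then have "(LINT s|circ. cmod (y s)) \<le> sqrt ((2 * pi)\<^sup>2 * cis.energy y)"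
    by (rule real_le_rsqrt)
  then have "(LINT s|circ. cmod (y s)) \<le> 2 * pi * sqrt (cis.energy y)"
    by (simp add: real_sqrt_mult)
  then have "(LINT s|circ. cmod (y s)) / \<beta> \<le> 2 * pi * sqrt (cis.energy y) / \<beta>"
    using \<alpha>\<beta> by (intro divide_right_mono) auto
  then have I: "(LINT s|circ. cmod (y s) / \<beta>) \<le> 2 * pi / \<beta> * sqrt (cis.energy y)" by simp
  have "cmod (planar_constraint y) \<le> (LINT s|circ. cmod (complex_of_real (Im (cnj (u s) * y s) / r s) * u s))"
    unfolding planar_constraint_def by (rule integral_norm_bound)
  also have "\<dots> \<le> (LINT s|circ. cmod (y s) / \<beta>)"
    by (rule integral_mono[OF integrable_norm[OF kernel_integrable(1)[OF y]] i kernel_norm_le(1)])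
  finally show "cmod (planar_constraint y) \<le> 2 * pi / \<beta> * sqrt (cis.energy y)" using I by (rule order_trans)
  have "cmod (radial_constraint y) \<le> (LINT s|circ. cmod (y s / r s))"
    unfolding radial_constraint_def by (rule integral_norm_bound)
  also have "\<dots> \<le> (LINT s|circ. cmod (y s) / \<beta>)"
    by (rule integral_mono[OF integrable_norm[OF kernel_integrable(2)[OF y]] i kernel_norm_le(2)])
  finally show "cmod (radial_constraint y) \<le> 2 * pi / \<beta> * sqrt (cis.energy y)" using I by (rule order_trans)
qed

text \<open>Pairing the value at the constant \<open>c\<close> with \<open>i cnj c\<close> exhibits the positive form \<open>\<integral> (Im (cnj u * c))\<^sup>2 / r\<close>.
  After multiplication with \<open>r\<^sup>3\<close>, which costs \<open>\<alpha>\<^sup>3\<close>, the integrand is the square of the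
  trigonometric polynomial \<open>Im (cnj \<xi> * c)\<close> and can be integrated.\<close>

lemma planar_constraint_const:
  "\<beta>\<^sup>2 * pi / \<alpha> ^ 3 * cmod c \<le> cmod (planar_constraint (\<lambda>_. c))"
proof -
  let ?w = "\<lambda>s. Im (cnj (\<xi> s) * c)"
  have sq: "square_int (\<lambda>_. c)" by (rule square_int_continuous) simp
  have "(LINT s|circ. (?w s)\<^sup>2) = pi * ((\<alpha> * Im c)\<^sup>2 + (\<beta> * Re c)\<^sup>2)"
  proof -
    define A where "A = Complex (\<alpha> * Im c / 2) (\<beta> * Re c / 2)"
    have w: "complex_of_real (?w s) = (\<Sum>m\<in>{1,-1}. (if m = 1 then A else cnj A) * cis s powi m)" for s
      using cis.cnj_powi[of s 1] by (simp add: A_def \<xi>_def complex_eq_iff algebra_simps)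
    have "cis.energy (\<lambda>s. complex_of_real (?w s)) = 2 * (cmod A)\<^sup>2"
    proof -
      have "cis.energy (\<lambda>s. 0 - complex_of_real (?w s)) = (\<Sum>m\<in>{1,-1::int}. (cmod (if m = 1 then A else cnj A))\<^sup>2)"
        unfolding w
        using cis.energy_diff_trig[OF square_int_continuous[of "\<lambda>_. 0"], of "{1,-1}" "\<lambda>m. if m = 1 then A else cnj A"]
        by (simp add: cis.coef_def cis.energy_def)
      moreover have "(\<Sum>m\<in>{1,-1::int}. (cmod (if m = 1 then A else cnj A))\<^sup>2) = 2 * (cmod A)\<^sup>2" by simp
      ultimately show ?thesis by (simp only: cis.energy_def diff_0 norm_minus_cancel)
    qed
    moreover have "(cmod A)\<^sup>2 = ((\<alpha> * Im c)\<^sup>2 + (\<beta> * Re c)\<^sup>2) / 4"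
      unfolding cmod_power2 A_def by (simp add: power_divide add_divide_distrib)
    ultimately have "(LINT s|circ. (?w s)\<^sup>2) / (2 * pi) = ((\<alpha> * Im c)\<^sup>2 + (\<beta> * Re c)\<^sup>2) / 2"
      by (simp only: cis_energy norm_of_real power2_abs)
    then show ?thesis by (simp add: field_simps)
  qed
  moreover have "\<beta>\<^sup>2 * (cmod c)\<^sup>2 \<le> (\<alpha> * Im c)\<^sup>2 + (\<beta> * Re c)\<^sup>2"
  proof -
    have "\<beta>\<^sup>2 * (Im c)\<^sup>2 \<le> \<alpha>\<^sup>2 * (Im c)\<^sup>2" using \<alpha>\<beta> by (intro mult_right_mono power_mono) auto
    then show ?thesis unfolding cmod_power2 power_mult_distrib distrib_left by simp
  qed
  ultimately have "\<beta>\<^sup>2 * pi / \<alpha> ^ 3 * (cmod c)\<^sup>2 \<le> (LINT s|circ. (?w s)\<^sup>2 / \<alpha> ^ 3)"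
  proof -
    assume w: "(LINT s|circ. (?w s)\<^sup>2) = pi * ((\<alpha> * Im c)\<^sup>2 + (\<beta> * Re c)\<^sup>2)"
      and le: "\<beta>\<^sup>2 * (cmod c)\<^sup>2 \<le> (\<alpha> * Im c)\<^sup>2 + (\<beta> * Re c)\<^sup>2"
    have "\<beta>\<^sup>2 * pi / \<alpha> ^ 3 * (cmod c)\<^sup>2 = pi * (\<beta>\<^sup>2 * (cmod c)\<^sup>2) / \<alpha> ^ 3" by simp
    also have "\<dots> \<le> (LINT s|circ. (?w s)\<^sup>2) / \<alpha> ^ 3"
      unfolding w using \<alpha>_pos by (intro divide_right_mono mult_left_mono le) auto
    finally show ?thesis by simp
  qed
  also have "\<dots> \<le> (LINT s|circ. (Im (cnj (u s) * c))\<^sup>2 / r s)"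
  proof (intro integral_mono integrable_circ_continuous continuous_intros \<xi>_cont ang.u_cont r_cont)
    show "\<forall>s\<in>UNIV. r s \<noteq> 0" using r_pos by (auto simp: less_imp_neq[symmetric])
    fix s
    have "?w s = r s * Im (cnj (u s) * c)"
      by (simp add: \<xi>_eq algebra_simps)
    then have "(?w s)\<^sup>2 / \<alpha> ^ 3 = (r s) ^ 3 / \<alpha> ^ 3 * ((Im (cnj (u s) * c))\<^sup>2 / r s)"
      using r_pos[of s] by (simp add: power_mult_distrib eval_nat_numeral)
    also have "\<dots> \<le> 1 * ((Im (cnj (u s) * c))\<^sup>2 / r s)"
      using r_bounds[of s] r_pos[of s] \<alpha>_pos by (intro mult_right_mono) (auto intro!: power_mono)
    finally show "(?w s)\<^sup>2 / \<alpha> ^ 3 \<le> (Im (cnj (u s) * c))\<^sup>2 / r s" by simp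
  qed (use \<alpha>_pos in auto)
  also have "\<dots> = Re (planar_constraint (\<lambda>_. c) * (\<i> * cnj c))"
  proof -
    have "Re (planar_constraint (\<lambda>_. c) * (\<i> * cnj c))
        = Re (LINT s|circ. complex_of_real (Im (cnj (u s) * c) / r s) * u s * (\<i> * cnj c))"
      unfolding planar_constraint_def by (simp only: integral_mult_left_zero)
    also have "\<dots> = (LINT s|circ. Re (complex_of_real (Im (cnj (u s) * c) / r s) * u s * (\<i> * cnj c)))"
      by (rule integral_Re[symmetric]) (intro integrable_mult_left kernel_integrable sq)
    also have "(\<lambda>s. Re (complex_of_real (Im (cnj (u s) * c) / r s) * u s * (\<i> * cnj c)))
        = (\<lambda>s. (Im (cnj (u s) * c))\<^sup>2 / r s)"
      by (auto simp: power2_eq_square algebra_simps)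
    finally show ?thesis by simp
  qed
  also have "\<dots> \<le> cmod (planar_constraint (\<lambda>_. c)) * cmod c"
    using complex_Re_le_cmod[of "planar_constraint (\<lambda>_. c) * (\<i> * cnj c)"] by (simp add: norm_mult)
  finally have le: "(\<beta>\<^sup>2 * pi / \<alpha> ^ 3 * cmod c) * cmod c \<le> cmod (planar_constraint (\<lambda>_. c)) * cmod c"
    by (simp add: power2_eq_square mult_ac)
  show ?thesis
  proof (cases "c = 0")
    case False
    then have "0 < cmod c" by (simp only: zero_less_norm_iff not_False_eq_True)
    with le show ?thesis by (rule mult_right_le_imp_le)
  qed simp
qed

theorem planar_coercive:
  assumes y: "square_int y" and g: "square_int g"
    and weak: "\<And>m. cis.coef g m = \<i> * m * cis.coef y m"
    and zero: "planar_constraint y = 0"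
  shows "cis.energy g - cis.energy y
    \<ge> \<kappa> * (cis.energy y - ((cmod (cis.coef y 1))\<^sup>2 + (cmod (cis.coef y (-1)))\<^sup>2))"
proof (rule coercive_of_half_period_gap[where L = planar_constraint, OF y g weak zero planar_constraint_add
      _ _ constraint_bound(1) planar_constraint_const _ _ \<kappa>_le])
  let ?k = "\<lambda>y s. complex_of_real (Im (cnj (u s) * y s) / r s) * u s"
  show "planar_constraint (\<lambda>s. t *\<^sub>R f s) = t *\<^sub>R planar_constraint f" for t f
  proof -
    have "?k (\<lambda>s. t *\<^sub>R f s) = (\<lambda>s. complex_of_real t * ?k f s)"
      by (auto simp: scaleR_conv_of_real algebra_simps diff_divide_distrib)
    then show ?thesis
      unfolding planar_constraint_def by (simp only: integral_mult_right_zero scaleR_conv_of_real)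
  qed
  show "planar_constraint (\<lambda>s. f (s + pi)) = planar_constraint f"
    if f: "continuous_on UNIV f" "\<And>s. f (s + 2*pi) = f s" for f
  proof -
    have rnz: "\<forall>s\<in>UNIV. r s \<noteq> 0" using r_pos by (auto simp: less_imp_neq[symmetric])
    \<comment> \<open>the kernel is quadratic in \<open>u\<close>, so the sign change of \<open>u\<close> under the shift cancels\<close>
    have "complex_of_real (Im (cnj (- a) * b) / c) * (- a) = complex_of_real (Im (cnj a * b) / c) * a"
      for a b :: complex and c
    proof -
      have "Im (cnj (- a) * b) = - Im (cnj a * b)" by simp
      then show ?thesis by (simp only: minus_divide_left[symmetric] of_real_minus minus_mult_minus)
    qed
    then have "?k (\<lambda>s. f (s + pi)) = (\<lambda>s. ?k f (s + pi))" by (simp only: u_antiper r_per)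
    moreover have "(LINT s|circ. ?k f (s + pi)) = (LINT s|circ. ?k f s)"
    proof (rule integral_circ_shift)
      show "continuous_on UNIV (?k f)"
        using rnz by (intro continuous_intros f(1) ang.u_cont r_cont)
      show "?k f (s + 2*pi) = ?k f s" for s
        using u_antiper[of "s + pi"] u_antiper[of s] r_per[of "s + pi"] r_per[of s] f(2)[of s]
        by (simp add: add.assoc)
    qed
    ultimately show ?thesis unfolding planar_constraint_def by (simp only:)
  qed
  show "0 < \<beta>\<^sup>2 * pi / \<alpha> ^ 3" using \<alpha>_pos \<alpha>\<beta> by simp
  show "\<kappa> * cis.energy E \<le> cis.energy E' - cis.energy E"
    if "\<And>s. (E has_vector_derivative E' s) (at s)" "continuous_on UNIV E'"
      "\<And>s. E (s + pi) = E s" "\<And>s. E' (s + pi) = E' s" "planar_constraint E = 0" for E E'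
    using that(5) unfolding planar_constraint_def by (rule planar_gap[OF that(1-4)])
qed

theorem radial_coercive:
  assumes y: "square_int y" and g: "square_int g"
    and weak: "\<And>m. cis.coef g m = \<i> * m * cis.coef y m"
    and zero: "radial_constraint y = 0"
  shows "cis.energy g - cis.energy y
    \<ge> \<kappa> * (cis.energy y - ((cmod (cis.coef y 1))\<^sup>2 + (cmod (cis.coef y (-1)))\<^sup>2))"
proof (rule coercive_of_half_period_gap[where L = radial_constraint and b = "2 * pi / \<alpha>",
      OF y g weak zero radial_constraint_add _ _ constraint_bound(2) _ _ _ \<kappa>_le])
  have rnz: "\<forall>s\<in>UNIV. r s \<noteq> 0" using r_pos by (auto simp: less_imp_neq[symmetric])
  show "radial_constraint (\<lambda>s. t *\<^sub>R f s) = t *\<^sub>R radial_constraint f" for t f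
    unfolding radial_constraint_def
    by (simp only: scaleR_conv_of_real times_divide_eq_right[symmetric] integral_mult_right_zero)
  show "radial_constraint (\<lambda>s. f (s + pi)) = radial_constraint f"
    if f: "continuous_on UNIV f" "\<And>s. f (s + 2*pi) = f s" for f
  proof -
    have "(LINT s|circ. f (s + pi) / r s) = (LINT s|circ. f (s + pi) / r (s + pi))"
      by (simp add: r_per)
    also have "\<dots> = (LINT s|circ. f s / r s)"
    proof (rule integral_circ_shift)
      show "continuous_on UNIV (\<lambda>s. f s / r s)"
        using rnz by (intro continuous_intros f(1) r_cont) simp
      show "f (s + 2*pi) / r (s + 2*pi) = f s / r s" for s
        using r_per[of "s + pi"] r_per[of s] f(2)[of s] by (simp add: add.assoc)
    qed
    finally show ?thesis unfolding radial_constraint_def .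
  qed
  show "2 * pi / \<alpha> * cmod c \<le> cmod (radial_constraint (\<lambda>_. c))" for c
  proof -
    define R where "R = (LINT s|circ. 1 / r s)"
    have "2 * pi / \<alpha> = (LINT s|circ. 1 / \<alpha>)" by (simp add: measure_restrict_space)
    also have "\<dots> \<le> R" unfolding R_def
      using rnz r_bounds r_pos \<alpha>_pos
      by (intro integral_mono integrable_circ_continuous continuous_intros r_cont divide_left_mono) auto
    finally have R: "2 * pi / \<alpha> \<le> R" .
    have "radial_constraint (\<lambda>_. c) = c * (LINT s|circ. complex_of_real (1 / r s))"
      unfolding radial_constraint_def integral_mult_right_zero[symmetric] by simp
    also have "\<dots> = c * complex_of_real R"
      unfolding R_def by (simp only: integral_complex_of_real)
    finally have "cmod (radial_constraint (\<lambda>_. c)) = cmod c * \<bar>R\<bar>" by (simp add: norm_mult)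
    then show ?thesis using mult_left_mono[OF order_trans[OF R abs_ge_self], of "cmod c"] by (simp add: mult.commute)
  qed
  show "0 < 2 * pi / \<alpha>" using \<alpha>_pos by simp
  show "\<kappa> * cis.energy E \<le> cis.energy E' - cis.energy E"
    if "\<And>s. (E has_vector_derivative E' s) (at s)" "continuous_on UNIV E'"
      "\<And>s. E (s + pi) = E s" "\<And>s. E' (s + pi) = E' s" "radial_constraint E = 0" for E E'
    using that(5) unfolding radial_constraint_def by (rule radial_gap[OF that(1-4)])
qed

end

section \<open>Square integrable periodic functions\<close>

lemma L2_per_iff: "f \<in> L2_per \<longleftrightarrow> periodic_2pi f \<and> square_int f"
  unfolding L2_per_def square_int_def set_borel_measurable_def set_integrable_def
  by (simp add: borel_measurable_restrict_space_iff integrable_restrict_space)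

lemma L2_inner_circ: "L2_inner f g = (LINT s|circ. f s \<bullet> g s)"
  unfolding L2_inner_def by (rule set_integral_circ)

lemma L2_norm_circ: "L2_norm_per f = sqrt (LINT s|circ. (norm (f s))\<^sup>2)"
  unfolding L2_norm_per_def by (simp add: set_integral_circ)

lemma L2_norm_square: "(L2_norm_per f)\<^sup>2 = L2_inner f f"
  unfolding L2_norm_circ L2_inner_circ
  by (subst real_sqrt_pow2) (auto simp: dot_square_norm intro!: integral_nonneg_AE)

lemma L2_norm_nonneg: "L2_norm_per f \<ge> 0"
  unfolding L2_norm_circ by (intro real_sqrt_ge_zero integral_nonneg_AE) auto

lemma L2_norm_circ_square: "(L2_norm_per f)\<^sup>2 = (LINT s|circ. (norm (f s))\<^sup>2)"
  unfolding L2_norm_circ by (rule real_sqrt_pow2) (auto intro!: integral_nonneg_AE)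

lemma inner_integrable:
  fixes f g :: "real \<Rightarrow> 'a::euclidean_space"
  assumes "square_int f" "square_int g"
  shows "integrable circ (\<lambda>s. f s \<bullet> g s)"
proof (rule integrable_square_int_prod[OF assms, of _ 1])
  show "(\<lambda>s. f s \<bullet> g s) \<in> borel_measurable circ"
    using assms by (auto simp: square_int_def)
  show "norm (f s \<bullet> g s) \<le> 1 * (norm (f s) * norm (g s))" for s
    using Cauchy_Schwarz_ineq2[of "f s" "g s"] by simp
qed

lemma L2_inner_commute: "L2_inner f g = L2_inner g f"
  by (simp add: L2_inner_circ inner_commute)

lemma L2_inner_add:
  assumes "square_int f" "square_int g" "square_int h"
  shows "L2_inner (\<lambda>s. f s + g s) h = L2_inner f h + L2_inner g h"
    "L2_inner h (\<lambda>s. f s + g s) = L2_inner h f + L2_inner h g"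
  using assms by (simp_all add: L2_inner_circ inner_add_left inner_add_right inner_integrable)

lemma L2_inner_diff:
  assumes "square_int f" "square_int g" "square_int h"
  shows "L2_inner (\<lambda>s. f s - g s) h = L2_inner f h - L2_inner g h"
    "L2_inner h (\<lambda>s. f s - g s) = L2_inner h f - L2_inner h g"
  using assms by (simp_all add: L2_inner_circ inner_diff_left inner_diff_right inner_integrable)

lemma L2_inner_scaleR:
  "L2_inner (\<lambda>s. c *\<^sub>R f s) h = c * L2_inner f h"
  "L2_inner h (\<lambda>s. c *\<^sub>R f s) = c * L2_inner h f"
  by (simp_all add: L2_inner_circ)

lemma L2_inner_nonneg: "L2_inner f f \<ge> 0"
  by (metis L2_norm_square zero_le_power2)

lemma L2_Cauchy_Schwarz:
  assumes f: "square_int f" and g: "square_int g"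
  shows "\<bar>L2_inner f g\<bar> \<le> L2_norm_per f * L2_norm_per g"
proof -
  let ?A = "L2_inner f f" and ?B = "L2_inner f g" and ?C = "L2_inner g g"
  have q: "0 \<le> ?A - 2 * t * ?B + t\<^sup>2 * ?C" for t
  proof -
    have "0 \<le> L2_inner (\<lambda>s. f s - t *\<^sub>R g s) (\<lambda>s. f s - t *\<^sub>R g s)" by (rule L2_inner_nonneg)
    also have "\<dots> = ?A - 2 * t * ?B + t\<^sup>2 * ?C"
      using f g by (simp add: L2_inner_diff square_int_scaleR square_int_diff L2_inner_scaleR
          L2_inner_commute[of g f] power2_eq_square algebra_simps)
    finally show ?thesis .
  qed
  have "?B\<^sup>2 \<le> ?A * ?C"
  proof (cases "?C = 0")
    case True
    have "?B = 0"
    proof (rule ccontr)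
      assume "?B \<noteq> 0"
      then have "2 * ((?A + 1) / (2 * ?B)) * ?B = ?A + 1" by simp
      with q[of "(?A + 1) / (2 * ?B)"] True show False by simp
    qed
    with True show ?thesis by simp
  next
    case False
    then have C: "?C > 0" using L2_inner_nonneg[of g] by simp
    define t where "t = ?B / ?C"
    have tC: "t * ?C = ?B" using C by (simp add: t_def)
    have "0 \<le> (?A - 2 * t * ?B + t\<^sup>2 * ?C) * ?C"
      using q[of t] C by (intro mult_nonneg_nonneg) simp_all
    also have "\<dots> = ?A * ?C - 2 * (t * ?C) * ?B + (t * ?C) * (t * ?C)"
      by (simp add: power2_eq_square algebra_simps)
    also have "\<dots> = ?A * ?C - ?B\<^sup>2" unfolding tC by (simp add: power2_eq_square)
    finally show ?thesis by simp
  qed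
  then have "?B\<^sup>2 \<le> (L2_norm_per f * L2_norm_per g)\<^sup>2"
    by (simp add: power_mult_distrib L2_norm_square)
  then have "\<bar>?B\<bar> \<le> \<bar>L2_norm_per f * L2_norm_per g\<bar>" by (simp only: abs_le_square_iff)
  then show ?thesis by (simp add: L2_norm_nonneg)
qed

section \<open>Weak derivatives\<close>

lemma test_function_continuous:
  assumes "test_function \<phi>"
  shows "continuous_on UNIV \<phi>" "continuous_on UNIV (deriv \<phi>)"
    "\<And>s. (\<phi> has_real_derivative deriv \<phi> s) (at s)" "\<phi> (2*pi) = \<phi> 0"
proof -
  have d: "((deriv ^^ k) \<phi>) differentiable_on UNIV" for k
    using assms by (auto simp: test_function_def)
  show "continuous_on UNIV \<phi>" "continuous_on UNIV (deriv \<phi>)"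
    using d[of 0] d[of 1] by (auto dest: differentiable_imp_continuous_on)
  have "\<phi> differentiable at s" for s
    using d[of 0] by (auto simp: differentiable_on_def)
  then show "(\<phi> has_real_derivative deriv \<phi> s) (at s)" for s
    by (simp add: DERIV_deriv_iff_real_differentiable)
  have "\<phi> (0 + 2*pi) = \<phi> 0" using assms unfolding test_function_def periodic_2pi_def by blast
  then show "\<phi> (2*pi) = \<phi> 0" by simp
qed

lemma integrable_scaleR_test:
  fixes f :: "real \<Rightarrow> 'a::euclidean_space" and \<phi> :: "real \<Rightarrow> real"
  assumes "square_int f" "continuous_on UNIV \<phi>"
  shows "integrable circ (\<lambda>s. \<phi> s *\<^sub>R f s)"
  by (rule integrable_square_int_prod[OF square_int_continuous[OF assms(2)] assms(1), of _ 1])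
     (use assms measurable_circ_continuous[OF assms(2)] in \<open>auto simp: square_int_def\<close>)

lemma has_weak_deriv_circ:
  "has_weak_deriv f g \<longleftrightarrow> (\<forall>\<phi>. test_function \<phi> \<longrightarrow>
      (LINT s|circ. deriv \<phi> s *\<^sub>R f s) = - (LINT s|circ. \<phi> s *\<^sub>R g s))"
  unfolding has_weak_deriv_def by (simp add: set_integral_circ)

lemma has_weak_deriv_add:
  assumes "has_weak_deriv f f'" "has_weak_deriv g g'"
    "square_int f" "square_int g" "square_int f'" "square_int g'"
  shows "has_weak_deriv (\<lambda>s. f s + g s) (\<lambda>s. f' s + g' s)"
  unfolding has_weak_deriv_circ
proof (intro allI impI)
  fix \<phi> assume \<phi>: "test_function \<phi>"
  note c = test_function_continuous[OF \<phi>]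
  show "(LINT s|circ. deriv \<phi> s *\<^sub>R (f s + g s)) = - (LINT s|circ. \<phi> s *\<^sub>R (f' s + g' s))"
    using assms(1,2) \<phi> assms(3-6) c
    by (simp add: has_weak_deriv_circ scaleR_add_right integrable_scaleR_test)
qed

lemma has_weak_deriv_scaleR:
  fixes f f' :: "real \<Rightarrow> 'a::euclidean_space"
  assumes "has_weak_deriv f f'"
  shows "has_weak_deriv (\<lambda>s. c *\<^sub>R f s) (\<lambda>s. c *\<^sub>R f' s)"
  unfolding has_weak_deriv_circ
proof (intro allI impI)
  fix \<phi> assume \<phi>: "test_function \<phi>"
  have comm: "(LINT s|circ. k s *\<^sub>R c *\<^sub>R h s) = c *\<^sub>R (LINT s|circ. k s *\<^sub>R h s)"
    for k :: "real \<Rightarrow> real" and h :: "real \<Rightarrow> 'a"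
    unfolding integral_scaleR_right[symmetric] by (simp only: scaleR_scaleR mult.commute)
  show "(LINT s|circ. deriv \<phi> s *\<^sub>R c *\<^sub>R f s) = - (LINT s|circ. \<phi> s *\<^sub>R c *\<^sub>R f' s)"
  proof -
    have "(LINT s|circ. deriv \<phi> s *\<^sub>R f s) = - (LINT s|circ. \<phi> s *\<^sub>R f' s)"
      using assms \<phi> by (simp add: has_weak_deriv_circ)
    then show ?thesis by (simp only: comm scaleR_minus_right)
  qed
qed

lemma has_weak_deriv_smooth:
  fixes f f' :: "real \<Rightarrow> 'a::euclidean_space"
  assumes f': "\<And>s. (f has_vector_derivative f' s) (at s)" and c: "continuous_on UNIV f'"
    and p: "f (2*pi) = f 0"
  shows "has_weak_deriv f f'"
  unfolding has_weak_deriv_circ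
proof (intro allI impI)
  fix \<phi> assume \<phi>: "test_function \<phi>"
  note t = test_function_continuous[OF \<phi>]
  have fc: "continuous_on UNIV f"
    by (intro continuous_at_imp_continuous_on ballI has_vector_derivative_continuous[OF f'])
  have "(LINT s|circ. \<phi> s *\<^sub>R f' s + deriv \<phi> s *\<^sub>R f s) = \<phi> (2*pi) *\<^sub>R f (2*pi) - \<phi> 0 *\<^sub>R f 0"
    by (intro integral_circ_derivative[of "\<lambda>s. \<phi> s *\<^sub>R f s"] has_vector_derivative_scaleR f' t
        continuous_intros c fc)
  then have "(LINT s|circ. \<phi> s *\<^sub>R f' s) + (LINT s|circ. deriv \<phi> s *\<^sub>R f s) = 0"
    using integrable_scaleR_test[OF square_int_continuous[OF c] t(1)]
      integrable_scaleR_test[OF square_int_continuous[OF fc] t(2)] by (simp add: t(4) p)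
  then show "(LINT s|circ. deriv \<phi> s *\<^sub>R f s) = - (LINT s|circ. \<phi> s *\<^sub>R f' s)"
    by (simp add: eq_neg_iff_add_eq_0 add.commute)
qed

lemma trig_deriv:
  "((\<lambda>s. a * cos (n * s) + b * sin (n * s)) has_real_derivative
     (b * n) * cos (n * s) + (- a * n) * sin (n * s)) (at s)"
  by (auto intro!: derivative_eq_intros simp: algebra_simps)

lemma iterated_trig_deriv:
  fixes n :: real
  shows "\<exists>a' b'. (deriv ^^ k) (\<lambda>s. a * cos (n * s) + b * sin (n * s)) = (\<lambda>s. a' * cos (n * s) + b' * sin (n * s))"
proof (induction k)
  case 0 show ?case by auto
next
  case (Suc k)
  then obtain a' b' where e: "(deriv ^^ k) (\<lambda>s. a * cos (n * s) + b * sin (n * s))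
    = (\<lambda>s. a' * cos (n * s) + b' * sin (n * s))" by blast
  have "(deriv ^^ Suc k) (\<lambda>s. a * cos (n * s) + b * sin (n * s))
    = deriv (\<lambda>s. a' * cos (n * s) + b' * sin (n * s))"
    by (simp only: funpow.simps o_def e)
  also have "\<dots> = (\<lambda>s. (b' * n) * cos (n * s) + (- a' * n) * sin (n * s))"
    by (rule ext) (rule DERIV_imp_deriv[OF trig_deriv])
  finally show ?case by blast
qed

lemma test_function_trig:
  "test_function (\<lambda>s. a * cos (real_of_int n * s) + b * sin (real_of_int n * s))"
  unfolding test_function_def
proof (intro conjI allI)
  have "real_of_int n * (s + 2*pi) = real_of_int n * s + 2 * pi * real_of_int n" for s
    by (simp add: algebra_simps)
  then have "cos (real_of_int n * (s + 2*pi)) = cos (real_of_int n * s)"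
    "sin (real_of_int n * (s + 2*pi)) = sin (real_of_int n * s)" for s
    using iffD2[OF sin_cos_eq_iff exI, of "real_of_int n * (s + 2*pi)" "real_of_int n * s" n] by simp_all
  then show "periodic_2pi (\<lambda>s. a * cos (real_of_int n * s) + b * sin (real_of_int n * s))"
    by (simp only: periodic_2pi_def simp_thms)
  fix k
  obtain a' b' where e: "(deriv ^^ k) (\<lambda>s. a * cos (real_of_int n * s) + b * sin (real_of_int n * s))
      = (\<lambda>s. a' * cos (real_of_int n * s) + b' * sin (real_of_int n * s))"
    using iterated_trig_deriv by blast
  show "(deriv ^^ k) (\<lambda>s. a * cos (real_of_int n * s) + b * sin (real_of_int n * s)) differentiable_on UNIV"
    unfolding e differentiable_on_def
    using trig_deriv[of a' "real_of_int n" b'] real_differentiable_def by blast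
qed

lemma weak_deriv_trig:
  assumes "has_weak_deriv f g"
  shows "(LINT s|circ. ((b * n) * cos (real_of_int n * s) + (- a * n) * sin (real_of_int n * s)) *\<^sub>R f s)
     = - (LINT s|circ. (a * cos (real_of_int n * s) + b * sin (real_of_int n * s)) *\<^sub>R g s)"
proof -
  have "deriv (\<lambda>s. a * cos (real_of_int n * s) + b * sin (real_of_int n * s)) s
      = (b * n) * cos (real_of_int n * s) + (- a * n) * sin (real_of_int n * s)" for s
    by (rule DERIV_imp_deriv[OF trig_deriv])
  then have d: "deriv (\<lambda>s. a * cos (real_of_int n * s) + b * sin (real_of_int n * s))
      = (\<lambda>s. (b * n) * cos (real_of_int n * s) + (- a * n) * sin (real_of_int n * s))" by (rule ext)
  show ?thesis
    using assms[unfolded has_weak_deriv_circ, rule_format, OF test_function_trig[of a n b]] unfolding d .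
qed

lemma cis_powi_eq: "cis s powi (-m) = cos (real_of_int m * s) - \<i> * sin (real_of_int m * s)"
  by (simp add: cis_power_int complex_eq_iff)

lemma square_int_linear:
  assumes P: "bounded_linear (P :: 'a::euclidean_space \<Rightarrow> complex)" and f: "square_int f"
  shows "square_int (\<lambda>s. P (f s))"
proof -
  obtain K where K: "\<And>x. norm (P x) \<le> norm x * K" using bounded_linear.bounded[OF P] by blast
  have "continuous_on UNIV P" using bounded_linear.continuous_on[OF P continuous_on_id] by simp
  then have "(\<lambda>s. P (f s)) \<in> borel_measurable circ"
    by (rule borel_measurable_continuous_on) (use f in \<open>simp add: square_int_def\<close>)
  then show ?thesis by (rule square_int_bound[OF f, of _ K]) (use K in \<open>simp add: mult.commute\<close>)
qed

text \<open>Testing against \<open>cos (m s)\<close> and \<open>sin (m s)\<close> determines the Fourier coefficients of the weak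
  derivative.\<close>

lemma weak_deriv_coef:
  fixes f g :: "real \<Rightarrow> 'a::euclidean_space"
  assumes w: "has_weak_deriv f g" and f: "square_int f" and g: "square_int g"
    and P: "bounded_linear (P :: 'a \<Rightarrow> complex)"
  shows "cis.coef (\<lambda>s. P (g s)) m = \<i> * m * cis.coef (\<lambda>s. P (f s)) m"
proof -
  interpret P: bounded_linear P by (rule P)
  let ?c = "\<lambda>s. cos (real_of_int m * s)" and ?s = "\<lambda>s. sin (real_of_int m * s)"
  have cont: "continuous_on UNIV ?c" "continuous_on UNIV ?s" by (intro continuous_intros)+
  have ci: "continuous_on UNIV (\<lambda>s. complex_of_real (?c s))" "continuous_on UNIV (\<lambda>s. complex_of_real (?s s))"
    by (intro continuous_intros)+
  have tr: "P (LINT s|circ. \<phi> s *\<^sub>R h s) = (LINT s|circ. P (h s) * \<phi> s)"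
    if "square_int h" "continuous_on UNIV \<phi>" for h and \<phi> :: "real \<Rightarrow> real"
    using integral_bounded_linear[OF P integrable_scaleR_test[OF that]]
    by (simp add: P.scaleR scaleR_conv_of_real mult.commute)
  have pull: "(LINT s|circ. P (f s) * complex_of_real (k * \<phi> s)) = k * (LINT s|circ. P (f s) * complex_of_real (\<phi> s))"
    for k and \<phi> :: "real \<Rightarrow> real"
  proof -
    have "(\<lambda>s. P (f s) * complex_of_real (k * \<phi> s)) = (\<lambda>s. complex_of_real k * (P (f s) * complex_of_real (\<phi> s)))"
      by (simp add: mult_ac)
    then show ?thesis by (simp only: integral_mult_right_zero)
  qed
  have "(LINT s|circ. (- of_int m * ?s s) *\<^sub>R f s) = - (LINT s|circ. ?c s *\<^sub>R g s)"
    using weak_deriv_trig[OF w, of 0 m 1] by simp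
  then have "P (LINT s|circ. (- of_int m * ?s s) *\<^sub>R f s) = - P (LINT s|circ. ?c s *\<^sub>R g s)"
    by (simp add: linear_neg[OF bounded_linear.linear[OF P]])
  then have "(LINT s|circ. P (f s) * complex_of_real (- of_int m * ?s s)) = - (LINT s|circ. P (g s) * ?c s)"
    unfolding tr[OF g cont(1)] tr[OF f continuous_on_mult[OF continuous_on_const cont(2)]] .
  then have 1: "(LINT s|circ. P (g s) * ?c s) = m * (LINT s|circ. P (f s) * ?s s)"
    unfolding pull by simp
  have "(LINT s|circ. (of_int m * ?c s) *\<^sub>R f s) = - (LINT s|circ. ?s s *\<^sub>R g s)"
    using weak_deriv_trig[OF w, of 1 m 0] by simp
  then have "P (LINT s|circ. (of_int m * ?c s) *\<^sub>R f s) = - P (LINT s|circ. ?s s *\<^sub>R g s)"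
    by (simp add: linear_neg[OF bounded_linear.linear[OF P]])
  then have "(LINT s|circ. P (f s) * complex_of_real (of_int m * ?c s)) = - (LINT s|circ. P (g s) * ?s s)"
    unfolding tr[OF g cont(2)] tr[OF f continuous_on_mult[OF continuous_on_const cont(1)]] .
  then have 2: "(LINT s|circ. P (g s) * ?s s) = - (m * (LINT s|circ. P (f s) * ?c s))"
    unfolding pull by simp
  have co: "cis.coef (\<lambda>s. P (h s)) m = ((LINT s|circ. P (h s) * ?c s) - \<i> * (LINT s|circ. P (h s) * ?s s)) / cis.W"
    if h: "square_int h" for h
  proof -
    have "(LINT s|circ. P (h s) * (cis s powi (-m) * complex_of_real 1))
        = (LINT s|circ. P (h s) * ?c s - \<i> * (P (h s) * ?s s))"
      unfolding cis_powi_eq by (simp add: algebra_simps)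
    also have "\<dots> = (LINT s|circ. P (h s) * ?c s) - (LINT s|circ. \<i> * (P (h s) * ?s s))"
      by (intro Bochner_Integration.integral_diff integrable_mult_right integrable_mult_continuous
          square_int_linear[OF P h] ci)
    finally show ?thesis by (simp add: cis.coef_def)
  qed
  show ?thesis unfolding co[OF f] co[OF g] 1 2 by (simp add: field_simps)
qed

definition planar :: "real^3 \<Rightarrow> complex" where "planar v = Complex (v $ 1) (v $ 2)"
definition vertical :: "real^3 \<Rightarrow> complex" where "vertical v = complex_of_real (v $ 3)"

lemma planar_alt: "planar v = complex_of_real (v $ 1) + \<i> * complex_of_real (v $ 2)"
  by (simp add: planar_def complex_eq_iff)

lemma bounded_linear_component: "bounded_linear (\<lambda>v :: real^3. complex_of_real (v $ j))"
  by (rule bounded_linear_compose[OF bounded_linear_of_real bounded_linear_vec_nth])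

lemma bounded_linear_planar: "bounded_linear planar"
proof -
  have "planar = (\<lambda>v. complex_of_real (v $ 1) + \<i> * complex_of_real (v $ 2))"
    by (rule ext) (rule planar_alt)
  moreover have "bounded_linear (\<lambda>v :: real^3. complex_of_real (v $ 1) + \<i> * complex_of_real (v $ 2))"
    by (rule bounded_linear_add[OF bounded_linear_component
        bounded_linear_compose[OF bounded_linear_mult_right bounded_linear_component]])
  ultimately show ?thesis by simp
qed

lemma bounded_linear_vertical: "bounded_linear vertical"
  unfolding vertical_def[abs_def] by (rule bounded_linear_component)

lemma norm_planar_vertical: "(norm (v :: real^3))\<^sup>2 = (cmod (planar v))\<^sup>2 + (cmod (vertical v))\<^sup>2"
  unfolding power2_norm_eq_inner inner_vec_def sum_3 planar_def vertical_def
  by (simp add: inner_complex_def)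

lemma L2_norm_energy:
  fixes f :: "real \<Rightarrow> real^3"
  assumes f: "square_int f"
  shows "L2_inner f f = 2 * pi * (cis.energy (\<lambda>s. planar (f s)) + cis.energy (\<lambda>s. vertical (f s)))"
proof -
  have "L2_inner f f = (LINT s|circ. (cmod (planar (f s)))\<^sup>2 + (cmod (vertical (f s)))\<^sup>2)"
    unfolding L2_inner_circ by (simp add: dot_square_norm norm_planar_vertical)
  also have "\<dots> = (LINT s|circ. (cmod (planar (f s)))\<^sup>2) + (LINT s|circ. (cmod (vertical (f s)))\<^sup>2)"
    using square_int_linear[OF bounded_linear_planar f] square_int_linear[OF bounded_linear_vertical f]
    by (intro Bochner_Integration.integral_add) (auto simp: square_int_def)
  finally show ?thesis by (simp add: cis_energy add_divide_distrib[symmetric])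
qed

text \<open>The difference of two weak derivatives has vanishing Fourier coefficients, so the unspecified
  choice made by \<open>weak_deriv\<close> does not affect the action.\<close>

lemma weak_deriv_norm_unique:
  fixes f g g' :: "real \<Rightarrow> real^3"
  assumes w: "has_weak_deriv f g" "has_weak_deriv f g'" and f: "square_int f"
    and g: "square_int g" "square_int g'"
  shows "L2_inner g g = L2_inner g' g'"
proof -
  define d where "d s = g s - g' s" for s
  have d: "square_int d" unfolding d_def[abs_def] by (intro square_int_diff g)
  have w0: "has_weak_deriv (\<lambda>s. f s + (-1) *\<^sub>R f s) (\<lambda>s. g s + (-1) *\<^sub>R g' s)"
    by (intro has_weak_deriv_add has_weak_deriv_scaleR w f g square_int_scaleR)
  then have w0: "has_weak_deriv (\<lambda>_. 0) d" by (simp add: d_def[abs_def])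
  have z: "square_int (\<lambda>_. 0 :: real^3)" by (rule square_int_continuous) simp
  have "cis.energy (\<lambda>s. P (d s)) = 0" if P: "bounded_linear P" for P :: "real^3 \<Rightarrow> complex"
  proof (rule energy_0_if_coef_0[OF square_int_linear[OF P d]])
    show "cis.coef (\<lambda>s. P (d s)) m = 0" for m
      using weak_deriv_coef[OF w0 z d P, of m] linear_0[OF bounded_linear.linear[OF P]]
      by (simp add: cis.coef_def)
  qed
  then have "L2_inner d d = 0"
    using L2_norm_energy[OF d] bounded_linear_planar bounded_linear_vertical by simp
  moreover have "\<bar>L2_inner g' d\<bar> \<le> L2_norm_per g' * L2_norm_per d"
    by (rule L2_Cauchy_Schwarz[OF g(2) d])
  ultimately have "L2_inner g' d = 0"
    using L2_norm_square[of d] by simp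
  have "L2_inner g g = L2_inner (\<lambda>s. g' s + d s) (\<lambda>s. g' s + d s)" by (simp add: d_def)
  also have "\<dots> = L2_inner g' g' + 2 * L2_inner g' d + L2_inner d d"
    using g(2) d by (simp add: L2_inner_add square_int_add L2_inner_commute[of d g'])
  finally show ?thesis using \<open>L2_inner d d = 0\<close> \<open>L2_inner g' d = 0\<close> by simp
qed

lemma weak_deriv_H1:
  assumes "f \<in> H1_per"
  shows "square_int f" "square_int (weak_deriv f)" "has_weak_deriv f (weak_deriv f)"
    "periodic_2pi f" "periodic_2pi (weak_deriv f)"
proof -
  have "\<exists>g. g \<in> L2_per \<and> has_weak_deriv f g" using assms by (auto simp: H1_per_def)
  then have "weak_deriv f \<in> L2_per \<and> has_weak_deriv f (weak_deriv f)"
    unfolding weak_deriv_def by (rule someI_ex)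
  with assms show "square_int f" "square_int (weak_deriv f)" "has_weak_deriv f (weak_deriv f)"
    "periodic_2pi f" "periodic_2pi (weak_deriv f)"
    by (auto simp: H1_per_def L2_per_iff)
qed

lemma action_eq:
  assumes "f \<in> L2_per" "g \<in> L2_per" "has_weak_deriv f g"
  shows "action f = 1/2 * (L2_inner g g - L2_inner f f)"
proof -
  have "f \<in> H1_per" using assms by (auto simp: H1_per_def)
  note w = weak_deriv_H1[OF this]
  have "(LINT s|circ. (norm (weak_deriv f s))\<^sup>2 - (norm (f s))\<^sup>2)
      = (LINT s|circ. (norm (weak_deriv f s))\<^sup>2) - (LINT s|circ. (norm (f s))\<^sup>2)"
    using w by (intro Bochner_Integration.integral_diff) (auto simp: square_int_def)
  also have "\<dots> = L2_inner (weak_deriv f) (weak_deriv f) - L2_inner f f"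
    by (simp add: L2_inner_circ dot_square_norm)
  also have "L2_inner (weak_deriv f) (weak_deriv f) = L2_inner g g"
    using assms by (intro weak_deriv_norm_unique[OF w(3) assms(3) w(1,2)]) (simp add: L2_per_iff)
  finally show ?thesis unfolding action_def by (simp add: set_integral_circ)
qed

section \<open>The second variation\<close>

lemma L2_inner_expand:
  fixes a b c d :: "real \<Rightarrow> 'a::euclidean_space" and \<mu> :: real
  assumes "square_int a" "square_int b" "square_int c" "square_int d"
  defines "F \<equiv> \<lambda>s. a s + \<mu> *\<^sub>R b s + \<mu>\<^sup>2 *\<^sub>R c s + d s"
  shows "L2_inner F F = L2_inner a a + 2 * \<mu> * L2_inner a b + \<mu>\<^sup>2 * (L2_inner b b + 2 * L2_inner a c)
    + (2 * \<mu> ^ 3 * L2_inner b c + \<mu> ^ 4 * L2_inner c c + L2_inner d d + 2 * L2_inner a d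
       + 2 * \<mu> * L2_inner b d + 2 * \<mu>\<^sup>2 * L2_inner c d)"
proof -
  note sb = square_int_scaleR[OF assms(2), of \<mu>] and sc = square_int_scaleR[OF assms(3), of "\<mu>\<^sup>2"]
  note sab = square_int_add[OF assms(1) sb]
  note sabc = square_int_add[OF sab sc]
  have left: "L2_inner F h = L2_inner a h + \<mu> * L2_inner b h + \<mu>\<^sup>2 * L2_inner c h + L2_inner d h"
    if "square_int h" for h
    unfolding F_def L2_inner_add(1)[OF sabc assms(4) that] L2_inner_add(1)[OF sab sc that]
      L2_inner_add(1)[OF assms(1) sb that] L2_inner_scaleR ..
  have right: "L2_inner h F = L2_inner h a + \<mu> * L2_inner h b + \<mu>\<^sup>2 * L2_inner h c + L2_inner h d"
    if "square_int h" for h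
    using left[OF that] by (simp only: L2_inner_commute[of h])
  have "square_int F" unfolding F_def by (rule square_int_add[OF sabc assms(4)])
  then show ?thesis
    unfolding left[OF \<open>square_int F\<close>] right[OF assms(1)] right[OF assms(2)] right[OF assms(3)] right[OF assms(4)]
      L2_inner_commute[of b a] L2_inner_commute[of c a] L2_inner_commute[of d a]
      L2_inner_commute[of c b] L2_inner_commute[of d b] L2_inner_commute[of d c]
    by (simp add: algebra_simps eval_nat_numeral)
qed

text \<open>All terms beyond the second order are bounded by the Cauchy--Schwarz inequality; a remainder of size
  \<open>o(\<mu>\<^sup>2)\<close> in the norm contributes \<open>o(\<mu>\<^sup>2)\<close> although it is paired with \<open>a\<close>, which is not small.\<close>

lemma quadratic_expansion_smallo:
  fixes a b c :: "real \<Rightarrow> 'a::euclidean_space" and d :: "real \<Rightarrow> real \<Rightarrow> 'a"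
  assumes sq: "square_int a" "square_int b" "square_int c" and d: "\<forall>\<^sub>F \<mu> in at 0. square_int (d \<mu>)"
    and small: "((\<lambda>\<mu>. L2_norm_per (d \<mu>) / \<mu>\<^sup>2) \<longlongrightarrow> 0) (at 0)"
  shows "(\<lambda>\<mu>. L2_inner (\<lambda>s. a s + \<mu> *\<^sub>R b s + \<mu>\<^sup>2 *\<^sub>R c s + d \<mu> s) (\<lambda>s. a s + \<mu> *\<^sub>R b s + \<mu>\<^sup>2 *\<^sub>R c s + d \<mu> s)
      - (L2_inner a a + 2 * \<mu> * L2_inner a b + \<mu>\<^sup>2 * (L2_inner b b + 2 * L2_inner a c))) \<in> o[at 0](\<lambda>\<mu>. \<mu>\<^sup>2)"
    (is "?f \<in> _")
proof -
  define q where "q \<mu> = L2_norm_per (d \<mu>) / \<mu>\<^sup>2" for \<mu>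
  define e where "e \<mu> = 2 * \<bar>\<mu>\<bar> * \<bar>L2_inner b c\<bar> + \<mu>\<^sup>2 * L2_inner c c + (q \<mu>)\<^sup>2 * \<mu>\<^sup>2
    + 2 * L2_norm_per a * q \<mu> + 2 * \<bar>\<mu>\<bar> * L2_norm_per b * q \<mu> + 2 * \<mu>\<^sup>2 * L2_norm_per c * q \<mu>" for \<mu>
  have "(e \<longlongrightarrow> 2 * \<bar>0\<bar> * \<bar>L2_inner b c\<bar> + 0\<^sup>2 * L2_inner c c + 0\<^sup>2 * 0\<^sup>2
    + 2 * L2_norm_per a * 0 + 2 * \<bar>0\<bar> * L2_norm_per b * 0 + 2 * 0\<^sup>2 * L2_norm_per c * 0) (at 0)"
    unfolding e_def[abs_def] by (intro tendsto_intros small[folded q_def])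
  then have e0: "(e \<longlongrightarrow> 0) (at 0)" by simp
  have bound: "\<forall>\<^sub>F \<mu> in at 0. norm (?f \<mu> / \<mu>\<^sup>2) \<le> e \<mu>"
    using d eventually_neq_at_within[of 0 0 UNIV]
  proof (rule eventually_elim2)
    fix \<mu> :: real assume dm: "square_int (d \<mu>)" and nz: "\<mu> \<noteq> 0"
    define n where "n = L2_norm_per (d \<mu>)"
    have n: "n = \<mu>\<^sup>2 * q \<mu>" using nz by (simp add: n_def q_def)
    have cs: "\<bar>L2_inner h (d \<mu>)\<bar> \<le> L2_norm_per h * n" if "square_int h" for h
      unfolding n_def by (rule L2_Cauchy_Schwarz[OF that dm])
    have t1: "\<bar>2 * \<mu> ^ 3 * L2_inner b c\<bar> \<le> \<mu>\<^sup>2 * (2 * \<bar>\<mu>\<bar> * \<bar>L2_inner b c\<bar>)"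
      by (simp add: abs_mult power3_eq_cube power2_eq_square)
    have t2: "\<bar>\<mu> ^ 4 * L2_inner c c\<bar> \<le> \<mu>\<^sup>2 * (\<mu>\<^sup>2 * L2_inner c c)"
      using L2_inner_nonneg[of c] by (simp add: abs_mult eval_nat_numeral)
    have t3: "\<bar>L2_inner (d \<mu>) (d \<mu>)\<bar> \<le> \<mu>\<^sup>2 * ((q \<mu>)\<^sup>2 * \<mu>\<^sup>2)"
    proof -
      have "L2_inner (d \<mu>) (d \<mu>) = n\<^sup>2" unfolding n_def by (rule L2_norm_square[symmetric])
      then show ?thesis unfolding n by (simp add: power2_eq_square)
    qed
    have t4: "\<bar>2 * L2_inner a (d \<mu>)\<bar> \<le> \<mu>\<^sup>2 * (2 * L2_norm_per a * q \<mu>)"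
    proof -
      have "\<bar>2 * L2_inner a (d \<mu>)\<bar> = 2 * \<bar>L2_inner a (d \<mu>)\<bar>" by (simp add: abs_mult)
      also have "\<dots> \<le> 2 * (L2_norm_per a * n)" by (intro mult_left_mono cs sq) auto
      finally show ?thesis unfolding n by (simp add: mult_ac)
    qed
    have t5: "\<bar>2 * \<mu> * L2_inner b (d \<mu>)\<bar> \<le> \<mu>\<^sup>2 * (2 * \<bar>\<mu>\<bar> * L2_norm_per b * q \<mu>)"
    proof -
      have "\<bar>2 * \<mu> * L2_inner b (d \<mu>)\<bar> = 2 * \<bar>\<mu>\<bar> * \<bar>L2_inner b (d \<mu>)\<bar>" by (simp add: abs_mult)
      also have "\<dots> \<le> 2 * \<bar>\<mu>\<bar> * (L2_norm_per b * n)" by (intro mult_left_mono cs sq) auto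
      finally show ?thesis unfolding n by (simp add: mult_ac)
    qed
    have t6: "\<bar>2 * \<mu>\<^sup>2 * L2_inner c (d \<mu>)\<bar> \<le> \<mu>\<^sup>2 * (2 * \<mu>\<^sup>2 * L2_norm_per c * q \<mu>)"
    proof -
      have "\<bar>2 * \<mu>\<^sup>2 * L2_inner c (d \<mu>)\<bar> = 2 * \<mu>\<^sup>2 * \<bar>L2_inner c (d \<mu>)\<bar>" by (simp add: abs_mult)
      also have "\<dots> \<le> 2 * \<mu>\<^sup>2 * (L2_norm_per c * n)" by (intro mult_left_mono cs sq) auto
      finally show ?thesis unfolding n by (simp add: mult_ac)
    qed
    have "?f \<mu> = 2 * \<mu> ^ 3 * L2_inner b c + \<mu> ^ 4 * L2_inner c c + L2_inner (d \<mu>) (d \<mu>) + 2 * L2_inner a (d \<mu>)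
       + 2 * \<mu> * L2_inner b (d \<mu>) + 2 * \<mu>\<^sup>2 * L2_inner c (d \<mu>)"
      unfolding L2_inner_expand[OF sq dm] by (rule add_diff_cancel_left')
    also have "\<bar>\<dots>\<bar> \<le> \<mu>\<^sup>2 * e \<mu>"
      unfolding e_def distrib_left by (intro order_trans[OF abs_triangle_ineq] add_mono t1 t2 t3 t4 t5 t6)
    finally show "norm (?f \<mu> / \<mu>\<^sup>2) \<le> e \<mu>"
      using nz by (simp add: abs_divide divide_le_eq mult.commute)
  qed
  show ?thesis
  proof (rule smalloI_tendsto)
    show "((\<lambda>\<mu>. ?f \<mu> / \<mu>\<^sup>2) \<longlongrightarrow> 0) (at 0)" by (rule Lim_null_comparison[OF bound e0])
    show "\<forall>\<^sub>F \<mu> in at (0::real). \<mu>\<^sup>2 \<noteq> 0" by (auto simp: eventually_at_filter)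
  qed
qed

section \<open>Linearisation of the constraint\<close>

definition normalize_deriv :: "'a::real_inner \<Rightarrow> 'a \<Rightarrow> 'a" where
  "normalize_deriv a h = (h - ((a \<bullet> h) / (norm a)\<^sup>2) *\<^sub>R a) /\<^sub>R norm a"

lemma normalize_deriv_bound:
  assumes "a \<noteq> 0"
  shows "norm (normalize_deriv a h) \<le> 2 * norm h / norm a"
proof -
  have A: "norm a > 0" using assms by simp
  have "norm (((a \<bullet> h) / (norm a)\<^sup>2) *\<^sub>R a) = \<bar>a \<bullet> h\<bar> / norm a"
    using A by (simp add: power2_eq_square)
  also have "\<dots> \<le> norm h"
    using Cauchy_Schwarz_ineq2[of a h] A by (simp add: divide_le_eq mult.commute)
  finally have "norm (h - ((a \<bullet> h) / (norm a)\<^sup>2) *\<^sub>R a) \<le> 2 * norm h"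
    using norm_triangle_ineq4[of h "((a \<bullet> h) / (norm a)\<^sup>2) *\<^sub>R a"] by simp
  then have "norm (h - ((a \<bullet> h) / (norm a)\<^sup>2) *\<^sub>R a) / norm a \<le> 2 * norm h / norm a"
    using A by (intro divide_right_mono) auto
  then show ?thesis unfolding normalize_deriv_def by (simp add: divide_inverse mult.commute)
qed

lemma normalize_deriv_add: "normalize_deriv a (h + k) = normalize_deriv a h + normalize_deriv a k"
  by (simp add: normalize_deriv_def inner_add_right add_divide_distrib scaleR_add_left scaleR_diff_right scaleR_add_right)

lemma normalize_deriv_scaleR: "normalize_deriv a (t *\<^sub>R h) = t *\<^sub>R normalize_deriv a h"
  by (simp add: normalize_deriv_def scaleR_diff_right mult_ac)

text \<open>With unit vectors \<open>ea\<close>, \<open>eb\<close> and lengths \<open>A\<close>, \<open>B\<close> of \<open>a\<close>, \<open>b\<close> the Taylor remainder is exactly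
  \<open>((A - B) / A) (eb - ea) - (\<delta> / A) ea\<close>, where \<open>\<delta>\<close> is the remainder of the norm. Both terms are quadratic
  in the increment, however large it is.\<close>

lemma normalize_remainder:
  fixes a b :: "'a::real_inner"
  assumes a: "a \<noteq> 0"
  shows "norm (b /\<^sub>R norm b - a /\<^sub>R norm a - normalize_deriv a (b - a)) \<le> 5/2 * (norm (b - a))\<^sup>2 / (norm a)\<^sup>2"
proof (cases "b = 0")
  case True
  then show ?thesis using a by (simp add: normalize_deriv_def power2_norm_eq_inner)
next
  case False
  define A B h where "A = norm a" and "B = norm b" and "h = b - a"
  define t where "t = (a \<bullet> h) / A"
  define ea eb where "ea = a /\<^sub>R A" and "eb = b /\<^sub>R B"
  have pos: "A > 0" "B > 0" using a False by (auto simp: A_def B_def)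
  have n: "norm ea = 1" "norm eb = 1" using a False by (auto simp: ea_def eb_def A_def B_def)
  have BA: "\<bar>A - B\<bar> \<le> norm h"
    unfolding A_def B_def h_def using norm_triangle_ineq3[of a b] by (simp add: norm_minus_commute)
  have Bsq: "B\<^sup>2 = A\<^sup>2 + 2 * (A * t) + (norm h)\<^sup>2"
  proof -
    have "b = a + h" by (simp add: h_def)
    then have "B\<^sup>2 = A\<^sup>2 + 2 * (a \<bullet> h) + (norm h)\<^sup>2"
      by (simp add: A_def B_def power2_norm_eq_inner inner_add_left inner_add_right inner_commute)
    then show ?thesis using pos by (simp add: t_def)
  qed
  define \<delta> where "\<delta> = B - A - t"
  have d_up: "\<delta> \<le> (norm h)\<^sup>2 / (2 * A)"
  proof -
    have "0 \<le> (B - A)\<^sup>2" by simp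
    then have "2 * A * \<delta> \<le> (norm h)\<^sup>2"
      using Bsq by (simp add: \<delta>_def power2_eq_square algebra_simps)
    then show ?thesis using pos by (simp add: le_divide_eq mult.commute)
  qed
  have d_low: "0 \<le> \<delta>"
  proof -
    have "a \<bullet> b \<le> A * B" unfolding A_def B_def by (rule norm_cauchy_schwarz)
    moreover have "a \<bullet> b = A * (A + t)"
      using pos by (simp add: t_def h_def inner_diff_right distrib_left power2_norm_eq_inner[symmetric] A_def power2_eq_square)
    ultimately have "A * (A + t) \<le> A * B" by simp
    then show ?thesis using pos by (simp add: \<delta>_def)
  qed
  have step: "eb - ea = ((A - B) / A) *\<^sub>R eb + h /\<^sub>R A"
  proof -
    have "h = B *\<^sub>R eb - A *\<^sub>R ea" using pos by (simp add: h_def ea_def eb_def)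
    then have "h /\<^sub>R A = (B / A) *\<^sub>R eb - ea"
      using pos by (simp add: scaleR_diff_right divide_inverse_commute)
    moreover have "((A - B) / A) *\<^sub>R eb + (B / A) *\<^sub>R eb = eb"
      using pos by (simp add: scaleR_add_left[symmetric] add_divide_distrib[symmetric])
    ultimately show ?thesis by (metis add_diff_eq)
  qed
  have diff: "norm (eb - ea) \<le> 2 * norm h / A"
  proof -
    have "norm (eb - ea) \<le> norm (((A - B) / A) *\<^sub>R eb) + norm (h /\<^sub>R A)"
      unfolding step by (rule norm_triangle_ineq)
    also have "\<dots> = \<bar>A - B\<bar> / A + norm h / A"
      using pos n by (simp add: divide_inverse_commute abs_mult)
    also have "\<dots> \<le> norm h / A + norm h / A" using BA pos by (intro add_mono divide_right_mono) auto
    finally show ?thesis by simp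
  qed
  have deriv: "normalize_deriv a h = h /\<^sub>R A - (t / A) *\<^sub>R ea"
    unfolding normalize_deriv_def ea_def t_def A_def[symmetric]
    by (simp add: scaleR_diff_right power2_eq_square divide_inverse mult_ac)
  \<comment> \<open>both factors of the first term are of first order, and \<open>\<delta>\<close> is the second order error of \<open>norm b\<close>\<close>
  have "eb - ea - normalize_deriv a h = ((A - B) / A) *\<^sub>R (eb - ea) - (\<delta> / A) *\<^sub>R ea"
  proof -
    have "eb - ea - normalize_deriv a h = ((A - B) / A) *\<^sub>R eb + (t / A) *\<^sub>R ea"
      unfolding step deriv by simp
    moreover have "t / A = - ((A - B) / A) - \<delta> / A"
      by (simp add: \<delta>_def diff_divide_distrib)
    ultimately show ?thesis by (simp add: scaleR_diff_right scaleR_diff_left)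
  qed
  then have "norm (eb - ea - normalize_deriv a h) \<le> norm (((A - B) / A) *\<^sub>R (eb - ea)) + norm ((\<delta> / A) *\<^sub>R ea)"
    by (simp only: norm_triangle_ineq4)
  also have "\<dots> = \<bar>A - B\<bar> * norm (eb - ea) / A + \<delta> / A"
    using pos n d_low by (simp add: abs_divide)
  also have "\<dots> \<le> norm h * (2 * norm h / A) / A + (norm h)\<^sup>2 / (2 * A) / A"
    using BA diff d_up pos by (intro add_mono divide_right_mono mult_mono) auto
  also have "\<dots> = 5/2 * (norm h)\<^sup>2 / A\<^sup>2"
    using pos by (simp add: power2_eq_square field_simps)
  finally show ?thesis by (simp add: ea_def eb_def h_def A_def B_def)
qed

lemma ellipse_alt: "ellipse \<alpha> \<beta> s = (\<alpha> * cos s) *\<^sub>R axis 1 1 + (\<beta> * sin s) *\<^sub>R axis 2 1"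
  unfolding ellipse_def vec_eq_iff forall_3 by (simp add: axis_def)

lemma ellipse_continuous: "continuous_on UNIV (ellipse \<alpha> \<beta>)"
  unfolding ellipse_alt[abs_def] by (intro continuous_intros)

text \<open>Letting \<open>\<mu> \<rightarrow> 0\<close> removes the constant term; dividing by \<open>\<mu>\<close> and letting \<open>\<mu> \<rightarrow> 0\<close> again removes the
  other coefficient.\<close>

lemma affine_smallo_imp_zero:
  fixes p q :: "'a::real_normed_vector"
  assumes b: "\<forall>\<^sub>F \<mu> in at 0. norm (p + \<mu> *\<^sub>R q) \<le> \<bar>\<mu>\<bar> * G \<mu>" and G: "(G \<longlongrightarrow> 0) (at 0)"
  shows "q = 0"
proof -
  have 1: "((\<lambda>\<mu>. norm (p + \<mu> *\<^sub>R q)) \<longlongrightarrow> norm (p + 0 *\<^sub>R q)) (at 0)" by (intro tendsto_intros)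
  have 2: "((\<lambda>\<mu>. \<bar>\<mu>\<bar> * G \<mu>) \<longlongrightarrow> \<bar>0\<bar> * 0) (at 0)" by (intro tendsto_intros G)
  have "norm (p + 0 *\<^sub>R q) \<le> \<bar>0\<bar> * 0" by (rule tendsto_le[OF trivial_limit_at 2 1 b])
  then have p: "p = 0" by simp
  have "\<forall>\<^sub>F \<mu> in at 0. norm q \<le> G \<mu>"
    using b eventually_neq_at_within[of 0 0 UNIV]
  proof eventually_elim
    case (elim \<mu>)
    then have "\<bar>\<mu>\<bar> * norm q \<le> \<bar>\<mu>\<bar> * G \<mu>" using p by simp
    with elim show ?case by simp
  qed
  then have "norm q \<le> 0" by (rule tendsto_le[OF trivial_limit_at G tendsto_const])
  then show ?thesis by simp
qed

context ellipse_geometry begin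

lemma planar_ellipse: "planar (ellipse \<alpha> \<beta> s) = \<xi> s" "ellipse \<alpha> \<beta> s $ 3 = 0"
  by (simp_all add: planar_def ellipse_def \<xi>_def complex_eq_iff)

lemma norm_ellipse: "norm (ellipse \<alpha> \<beta> s) = r s"
proof -
  have "(norm (ellipse \<alpha> \<beta> s))\<^sup>2 = (r s)\<^sup>2"
    unfolding norm_planar_vertical by (simp add: planar_ellipse vertical_def r_def)
  then show ?thesis using r_pos[of s] by (simp add: power2_eq_iff_nonneg)
qed

lemma ellipse_nz: "ellipse \<alpha> \<beta> s \<noteq> 0"
  using norm_ellipse[of s] r_pos[of s] by auto

definition linearized :: "(real \<Rightarrow> real^3) \<Rightarrow> real^3" where
  "linearized x = (LINT s|circ. normalize_deriv (ellipse \<alpha> \<beta> s) (x s))"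

lemma normalize_deriv_ellipse_le: "norm (normalize_deriv (ellipse \<alpha> \<beta> s) h) \<le> 2 / \<beta> * norm h"
proof -
  have "norm (normalize_deriv (ellipse \<alpha> \<beta> s) h) \<le> 2 * norm h / r s"
    using normalize_deriv_bound[OF ellipse_nz, of s h] by (simp add: norm_ellipse)
  also have "\<dots> \<le> 2 * norm h / \<beta>"
    using r_bounds(1)[of s] \<alpha>\<beta> r_pos[of s] by (intro divide_left_mono) auto
  finally show ?thesis by simp
qed

lemma linearized_integrable:
  assumes "square_int x"
  shows "integrable circ (\<lambda>s. normalize_deriv (ellipse \<alpha> \<beta> s) (x s))"
proof (rule Bochner_Integration.integrable_bound)
  show "integrable circ (\<lambda>s. 2 / \<beta> * norm (x s))"
    using integrable_square_int[OF assms] by simp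
  have [measurable]: "x \<in> borel_measurable circ" using assms by (simp add: square_int_def)
  have [measurable]: "ellipse \<alpha> \<beta> \<in> borel_measurable circ"
    by (rule measurable_circ_continuous[OF ellipse_continuous])
  show "(\<lambda>s. normalize_deriv (ellipse \<alpha> \<beta> s) (x s)) \<in> borel_measurable circ"
    unfolding normalize_deriv_def by measurable
  show "AE s in circ. norm (normalize_deriv (ellipse \<alpha> \<beta> s) (x s)) \<le> norm (2 / \<beta> * norm (x s))"
    using \<alpha>\<beta> by (intro AE_I2 order_trans[OF normalize_deriv_ellipse_le]) simp
qed

lemma linearized_add:
  assumes "square_int x" "square_int y"
  shows "linearized (\<lambda>s. x s + y s) = linearized x + linearized y"
  unfolding linearized_def normalize_deriv_add
  by (rule Bochner_Integration.integral_add[OF linearized_integrable[OF assms(1)] linearized_integrable[OF assms(2)]])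

lemma linearized_scaleR: "linearized (\<lambda>s. t *\<^sub>R x s) = t *\<^sub>R linearized x"
  unfolding linearized_def normalize_deriv_scaleR by simp

lemma linearized_norm_le:
  assumes x: "square_int x"
  shows "norm (linearized x) \<le> 2 / \<beta> * (sqrt (2 * pi) * L2_norm_per x)"
proof -
  have "norm (linearized x) \<le> (LINT s|circ. norm (normalize_deriv (ellipse \<alpha> \<beta> s) (x s)))"
    unfolding linearized_def by (rule integral_norm_bound)
  also have "\<dots> \<le> (LINT s|circ. 2 / \<beta> * norm (x s))"
    using integrable_square_int[OF x]
    by (intro integral_mono integrable_norm linearized_integrable[OF x] normalize_deriv_ellipse_le) auto
  also have "\<dots> = 2 / \<beta> * (LINT s|circ. norm (x s))" by simp
  also have "\<dots> \<le> 2 / \<beta> * sqrt (2 * pi * (LINT s|circ. (norm (x s))\<^sup>2))"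
    using \<alpha>\<beta> by (intro mult_left_mono real_le_rsqrt integral_norm_square_le x) auto
  also have "sqrt (2 * pi * (LINT s|circ. (norm (x s))\<^sup>2)) = sqrt (2 * pi) * L2_norm_per x"
    by (simp add: real_sqrt_mult L2_norm_circ)
  finally show ?thesis .
qed

lemma integrable_normalized:
  fixes Y :: "real \<Rightarrow> real^3"
  assumes [measurable]: "Y \<in> borel_measurable circ"
  shows "integrable circ (\<lambda>s. Y s /\<^sub>R norm (Y s))"
proof (rule Bochner_Integration.integrable_bound[OF integrable_circ_continuous[of "\<lambda>_. 1::real"]])
  show "continuous_on UNIV (\<lambda>_::real. 1::real)" by (rule continuous_on_const)
  show "(\<lambda>s. Y s /\<^sub>R norm (Y s)) \<in> borel_measurable circ" by measurable
  have "norm (sgn v) \<le> norm (1::real)" for v :: "real^3" by (simp add: norm_sgn)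
  then show "AE s in circ. norm (Y s /\<^sub>R norm (Y s)) \<le> norm (1::real)"
    unfolding sgn_div_norm by (rule AE_I2)
qed

lemma constraint_expansion:
  assumes h: "square_int (\<lambda>s. X s - ellipse \<alpha> \<beta> s)"
  shows "norm (constraint_integral X - constraint_integral (ellipse \<alpha> \<beta>)
      - linearized (\<lambda>s. X s - ellipse \<alpha> \<beta> s))
    \<le> 5 / (2 * \<beta>\<^sup>2) * (L2_norm_per (\<lambda>s. X s - ellipse \<alpha> \<beta> s))\<^sup>2"
proof -
  let ?X0 = "ellipse \<alpha> \<beta>"
  have me: "?X0 \<in> borel_measurable circ" by (rule measurable_circ_continuous[OF ellipse_continuous])
  have "(\<lambda>s. (X s - ?X0 s) + ?X0 s) \<in> borel_measurable circ"
    using h me by (intro borel_measurable_add) (auto simp: square_int_def)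
  then have mX: "X \<in> borel_measurable circ" by simp
  note int = integrable_normalized
  let ?R = "\<lambda>s. X s /\<^sub>R norm (X s) - ?X0 s /\<^sub>R norm (?X0 s) - normalize_deriv (?X0 s) (X s - ?X0 s)"
  have iR: "integrable circ ?R"
    by (intro Bochner_Integration.integrable_diff int mX me linearized_integrable h)
  have "integral\<^sup>L circ ?R = constraint_integral X - constraint_integral ?X0 - linearized (\<lambda>s. X s - ?X0 s)"
    unfolding constraint_integral_def set_integral_circ linearized_def
      Bochner_Integration.integral_diff[OF Bochner_Integration.integrable_diff[OF int[OF mX] int[OF me]]
        linearized_integrable[OF h]] Bochner_Integration.integral_diff[OF int[OF mX] int[OF me]] ..
  then have "norm (constraint_integral X - constraint_integral ?X0 - linearized (\<lambda>s. X s - ?X0 s))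
      = norm (integral\<^sup>L circ ?R)"
    by (rule arg_cong[OF sym])
  also have "\<dots> \<le> (LINT s|circ. norm (?R s))" by (rule integral_norm_bound)
  also have "\<dots> \<le> (LINT s|circ. 5 / (2 * \<beta>\<^sup>2) * (norm (X s - ?X0 s))\<^sup>2)"
  proof (rule integral_mono[OF integrable_norm[OF iR]])
    have "integrable circ (\<lambda>s. (norm (X s - ?X0 s))\<^sup>2)"
      using h unfolding square_int_def by (rule conjunct2)
    then show "integrable circ (\<lambda>s. 5 / (2 * \<beta>\<^sup>2) * (norm (X s - ?X0 s))\<^sup>2)"
      by (rule integrable_mult_right)
    fix s
    have \<beta>: "\<beta>\<^sup>2 \<le> (norm (?X0 s))\<^sup>2" "0 < \<beta>\<^sup>2"
      using r_bounds(1)[of s] \<alpha>\<beta>(2) by (simp_all add: norm_ellipse power_mono)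
    have weaken: "5/2 * n / a \<le> 5 / (2 * b) * n" if "b \<le> a" "0 < b" "0 \<le> n" for a b n :: real
    proof -
      have "5/2 * n / a \<le> 5/2 * n / b" using that by (intro divide_left_mono mult_pos_pos) simp_all
      then show ?thesis by simp
    qed
    note normalize_remainder[OF ellipse_nz, of "X s" s]
    also have "5/2 * (norm (X s - ?X0 s))\<^sup>2 / (norm (?X0 s))\<^sup>2 \<le> 5 / (2 * \<beta>\<^sup>2) * (norm (X s - ?X0 s))\<^sup>2"
      by (rule weaken[OF \<beta> zero_le_power2])
    finally show "norm (?R s) \<le> 5 / (2 * \<beta>\<^sup>2) * (norm (X s - ?X0 s))\<^sup>2" .
  qed
  also have "\<dots> = 5 / (2 * \<beta>\<^sup>2) * (L2_norm_per (\<lambda>s. X s - ?X0 s))\<^sup>2"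
    unfolding L2_norm_circ_square by (rule integral_mult_right_zero)
  finally show ?thesis .
qed

lemma L2_norm_add_square_le:
  fixes f g :: "real \<Rightarrow> real^3"
  assumes "square_int f" "square_int g"
  shows "(L2_norm_per (\<lambda>s. f s + g s))\<^sup>2 \<le> 2 * (L2_norm_per f)\<^sup>2 + 2 * (L2_norm_per g)\<^sup>2"
proof -
  have i: "integrable circ (\<lambda>s. (norm (f s))\<^sup>2)" "integrable circ (\<lambda>s. (norm (g s))\<^sup>2)"
    "integrable circ (\<lambda>s. (norm (f s + g s))\<^sup>2)"
    using assms square_int_add[OF assms] by (auto simp: square_int_def)
  have "(LINT s|circ. (norm (f s + g s))\<^sup>2) \<le> (LINT s|circ. 2 * (norm (f s))\<^sup>2 + 2 * (norm (g s))\<^sup>2)"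
    using i by (intro integral_mono norm_add_square_le) auto
  then show ?thesis using i by (simp add: L2_norm_circ_square)
qed

lemma L2_norm_scaleR_square: "(L2_norm_per (\<lambda>s. t *\<^sub>R f s))\<^sup>2 = t\<^sup>2 * (L2_norm_per f)\<^sup>2"
  by (simp add: L2_norm_circ_square power_mult_distrib)

text \<open>Collecting the error terms shows that \<open>p + \<mu> q = o(\<mu>)\<close>, where \<open>p\<close> is the value of the constraint at
  the ellipse and \<open>q\<close> its derivative in the direction \<open>x\<^sub>1\<close>. Hence the constraint on \<open>X\<close> alone forces
  both to vanish.\<close>

theorem linearized_constraint_vanishes:
  assumes x: "square_int x\<^sub>1" "square_int x\<^sub>2"
    and R: "\<forall>\<^sub>F \<mu> in at 0. square_int (R \<mu>)"
    and small: "((\<lambda>\<mu>. L2_norm_per (R \<mu>) / \<mu>\<^sup>2) \<longlongrightarrow> 0) (at 0)"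
    and con: "(\<lambda>\<mu>. norm (constraint_integral (\<lambda>s. ellipse \<alpha> \<beta> s + \<mu> *\<^sub>R x\<^sub>1 s + \<mu>\<^sup>2 *\<^sub>R x\<^sub>2 s + R \<mu> s)))
      \<in> o[at 0](\<lambda>\<mu>. \<mu>)"
  shows "linearized x\<^sub>1 = 0"
proof -
  let ?X = "\<lambda>\<mu> s. ellipse \<alpha> \<beta> s + \<mu> *\<^sub>R x\<^sub>1 s + \<mu>\<^sup>2 *\<^sub>R x\<^sub>2 s + R \<mu> s"
  define k where "k \<mu> = norm (constraint_integral (?X \<mu>)) / \<mu>" for \<mu>
  define q where "q \<mu> = L2_norm_per (R \<mu>) / \<mu>\<^sup>2" for \<mu>
  define C D where "C = 2 / \<beta> * sqrt (2 * pi)" and "D = 5 / (2 * \<beta>\<^sup>2)"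
  define H where "H \<mu> = norm (linearized x\<^sub>2) + C * q \<mu>
    + D * (2 * (2 * (L2_norm_per x\<^sub>1)\<^sup>2 + 2 * (\<mu>\<^sup>2 * (L2_norm_per x\<^sub>2)\<^sup>2)) + 2 * (\<mu>\<^sup>2 * (q \<mu>)\<^sup>2))" for \<mu>
  define G where "G \<mu> = \<bar>k \<mu>\<bar> + \<bar>\<mu>\<bar> * H \<mu>" for \<mu>
  have k0: "(k \<longlongrightarrow> 0) (at 0)" unfolding k_def[abs_def] by (rule smalloD_tendsto[OF con])
  have q0: "(q \<longlongrightarrow> 0) (at 0)" unfolding q_def[abs_def] by (rule small)
  have "(H \<longlongrightarrow> norm (linearized x\<^sub>2) + C * 0
    + D * (2 * (2 * (L2_norm_per x\<^sub>1)\<^sup>2 + 2 * (0\<^sup>2 * (L2_norm_per x\<^sub>2)\<^sup>2)) + 2 * (0\<^sup>2 * 0\<^sup>2))) (at 0)"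
    unfolding H_def[abs_def]
    by (intro tendsto_add tendsto_mult tendsto_power tendsto_const tendsto_ident_at q0)
  from tendsto_add[OF tendsto_rabs_zero[OF k0] tendsto_mult[OF tendsto_rabs_zero[OF tendsto_ident_at] this]]
  have G0: "(G \<longlongrightarrow> 0) (at 0)" unfolding G_def[abs_def] by (simp only: mult_zero_left add_0_left)
  have "\<forall>\<^sub>F \<mu> in at 0. norm (constraint_integral (ellipse \<alpha> \<beta>) + \<mu> *\<^sub>R linearized x\<^sub>1) \<le> \<bar>\<mu>\<bar> * G \<mu>"
    using R eventually_neq_at_within[of 0 0 UNIV]
  proof eventually_elim
    case (elim \<mu>)
    then have Rm: "square_int (R \<mu>)" and nz: "\<mu> \<noteq> 0" by blast+
    define h where "h s = (\<mu> *\<^sub>R x\<^sub>1 s + \<mu>\<^sup>2 *\<^sub>R x\<^sub>2 s) + R \<mu> s" for s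
    note sq = square_int_scaleR[OF x(1), of \<mu>] square_int_scaleR[OF x(2), of "\<mu>\<^sup>2"]
    note sq12 = square_int_add[OF sq]
    have hX: "(\<lambda>s. ?X \<mu> s - ellipse \<alpha> \<beta> s) = h" by (auto simp: h_def)
    have sqh: "square_int h" unfolding h_def[abs_def] by (rule square_int_add[OF sq12 Rm])
    have lin: "linearized h = \<mu> *\<^sub>R linearized x\<^sub>1 + \<mu>\<^sup>2 *\<^sub>R linearized x\<^sub>2 + linearized (R \<mu>)"
      unfolding h_def[abs_def] linearized_add[OF sq12 Rm] linearized_add[OF sq] linearized_scaleR ..
    have n: "L2_norm_per (R \<mu>) = \<mu>\<^sup>2 * q \<mu>" using nz by (simp add: q_def)
    have m2: "\<mu>\<^sup>2 = \<bar>\<mu>\<bar> * \<bar>\<mu>\<bar>" by (simp add: power2_eq_square)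
    have alg: "2 * (2 * (m * a) + 2 * (m\<^sup>2 * b)) + 2 * (m * t)\<^sup>2 = m * (2 * (2 * a + 2 * (m * b)) + 2 * (m * t\<^sup>2))"
      for m a b t :: real by (simp add: power2_eq_square algebra_simps)
    have Nh: "(L2_norm_per h)\<^sup>2 \<le> \<mu>\<^sup>2 * (2 * (2 * (L2_norm_per x\<^sub>1)\<^sup>2 + 2 * (\<mu>\<^sup>2 * (L2_norm_per x\<^sub>2)\<^sup>2)) + 2 * (\<mu>\<^sup>2 * (q \<mu>)\<^sup>2))"
    proof -
      have "(L2_norm_per h)\<^sup>2 \<le> 2 * (L2_norm_per (\<lambda>s. \<mu> *\<^sub>R x\<^sub>1 s + \<mu>\<^sup>2 *\<^sub>R x\<^sub>2 s))\<^sup>2 + 2 * (L2_norm_per (R \<mu>))\<^sup>2"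
        unfolding h_def[abs_def] by (rule L2_norm_add_square_le[OF sq12 Rm])
      also have "\<dots> \<le> 2 * (2 * (\<mu>\<^sup>2 * (L2_norm_per x\<^sub>1)\<^sup>2) + 2 * ((\<mu>\<^sup>2)\<^sup>2 * (L2_norm_per x\<^sub>2)\<^sup>2)) + 2 * (\<mu>\<^sup>2 * q \<mu>)\<^sup>2"
        unfolding n using L2_norm_add_square_le[OF sq]
        by (intro add_mono mult_left_mono) (auto simp: L2_norm_scaleR_square)
      also have "\<dots> = \<mu>\<^sup>2 * (2 * (2 * (L2_norm_per x\<^sub>1)\<^sup>2 + 2 * (\<mu>\<^sup>2 * (L2_norm_per x\<^sub>2)\<^sup>2)) + 2 * (\<mu>\<^sup>2 * (q \<mu>)\<^sup>2))"
        by (rule alg)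
      finally show ?thesis .
    qed
    define rem where "rem = constraint_integral (?X \<mu>) - constraint_integral (ellipse \<alpha> \<beta>) - linearized h"
    have rem: "norm rem \<le> D * (L2_norm_per h)\<^sup>2"
    proof -
      have "square_int (\<lambda>s. ?X \<mu> s - ellipse \<alpha> \<beta> s)" unfolding hX by (rule sqh)
      from constraint_expansion[OF this] show ?thesis unfolding hX D_def rem_def .
    qed
    have "constraint_integral (ellipse \<alpha> \<beta>) + \<mu> *\<^sub>R linearized x\<^sub>1
        = constraint_integral (?X \<mu>) - \<mu>\<^sup>2 *\<^sub>R linearized x\<^sub>2 - linearized (R \<mu>) - rem"
    proof -
      have "p + a = c - b - l - (c - p - (a + b + l))" for a b c l p :: "real^3"
        by (simp add: algebra_simps)
      then show ?thesis unfolding rem_def lin by this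
    qed
    then have "norm (constraint_integral (ellipse \<alpha> \<beta>) + \<mu> *\<^sub>R linearized x\<^sub>1)
        = norm (constraint_integral (?X \<mu>) - \<mu>\<^sup>2 *\<^sub>R linearized x\<^sub>2 - linearized (R \<mu>) - rem)"
      by (rule arg_cong)
    also have "\<dots> \<le> norm (constraint_integral (?X \<mu>)) + norm (\<mu>\<^sup>2 *\<^sub>R linearized x\<^sub>2)
        + norm (linearized (R \<mu>)) + norm rem"
      by (intro order_trans[OF norm_triangle_ineq4] add_mono order_refl)
    also have "\<dots> \<le> \<bar>\<mu>\<bar> * \<bar>k \<mu>\<bar> + \<bar>\<mu>\<bar> * (\<bar>\<mu>\<bar> * norm (linearized x\<^sub>2)) + \<bar>\<mu>\<bar> * (\<bar>\<mu>\<bar> * (C * q \<mu>))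
        + \<bar>\<mu>\<bar> * (\<bar>\<mu>\<bar> * (D * (2 * (2 * (L2_norm_per x\<^sub>1)\<^sup>2 + 2 * (\<mu>\<^sup>2 * (L2_norm_per x\<^sub>2)\<^sup>2)) + 2 * (\<mu>\<^sup>2 * (q \<mu>)\<^sup>2))))"
    proof (intro add_mono)
      show "norm (constraint_integral (?X \<mu>)) \<le> \<bar>\<mu>\<bar> * \<bar>k \<mu>\<bar>"
        using nz by (simp add: k_def)
      show "norm (\<mu>\<^sup>2 *\<^sub>R linearized x\<^sub>2) \<le> \<bar>\<mu>\<bar> * (\<bar>\<mu>\<bar> * norm (linearized x\<^sub>2))"
        by (simp add: power2_eq_square)
      show "norm (linearized (R \<mu>)) \<le> \<bar>\<mu>\<bar> * (\<bar>\<mu>\<bar> * (C * q \<mu>))"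
      proof -
        have "norm (linearized (R \<mu>)) \<le> C * L2_norm_per (R \<mu>)"
          using linearized_norm_le[OF Rm] by (simp add: C_def)
        also have "\<dots> = \<bar>\<mu>\<bar> * (\<bar>\<mu>\<bar> * (C * q \<mu>))" unfolding n m2 by (simp only: mult_ac)
        finally show ?thesis .
      qed
      have "norm rem \<le> D * (\<mu>\<^sup>2 * (2 * (2 * (L2_norm_per x\<^sub>1)\<^sup>2 + 2 * (\<mu>\<^sup>2 * (L2_norm_per x\<^sub>2)\<^sup>2)) + 2 * (\<mu>\<^sup>2 * (q \<mu>)\<^sup>2)))"
        using rem Nh by (rule order_trans[OF _ mult_left_mono]) (simp add: D_def)
      also have "\<dots> = \<mu>\<^sup>2 * (D * (2 * (2 * (L2_norm_per x\<^sub>1)\<^sup>2 + 2 * (\<mu>\<^sup>2 * (L2_norm_per x\<^sub>2)\<^sup>2)) + 2 * (\<mu>\<^sup>2 * (q \<mu>)\<^sup>2)))"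
        by (simp only: mult.left_commute)
      finally show "norm rem \<le> \<bar>\<mu>\<bar> * (\<bar>\<mu>\<bar> * (D * (2 * (2 * (L2_norm_per x\<^sub>1)\<^sup>2 + 2 * (\<mu>\<^sup>2 * (L2_norm_per x\<^sub>2)\<^sup>2)) + 2 * (\<mu>\<^sup>2 * (q \<mu>)\<^sup>2))))"
        unfolding m2 by (simp only: mult.assoc)
    qed
    also have "\<dots> = \<bar>\<mu>\<bar> * G \<mu>" unfolding G_def H_def distrib_left[of "\<bar>\<mu>\<bar>"] add.assoc ..
    finally show ?case .
  qed
  then show ?thesis by (rule affine_smallo_imp_zero[OF _ G0])
qed

text \<open>For a planar displacement \<open>h = u * (cnj u * h)\<close> the component \<open>Re (cnj u * h)\<close> in the direction of the
  position vector is projected away, and \<open>i Im (cnj u * h)\<close> is left.\<close>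

lemma linearized_split:
  assumes x: "square_int x"
  shows "planar (linearized x) = \<i> * planar_constraint (\<lambda>s. planar (x s))"
    "vertical (linearized x) = radial_constraint (\<lambda>s. vertical (x s))"
proof -
  have "planar (normalize_deriv (ellipse \<alpha> \<beta> s) h) = \<i> * (complex_of_real (Im (cnj (u s) * planar h) / r s) * u s)" for s h
  proof -
    interpret P: bounded_linear planar by (rule bounded_linear_planar)
    have dot: "ellipse \<alpha> \<beta> s \<bullet> h = r s * Re (cnj (u s) * planar h)"
    proof -
      have "ellipse \<alpha> \<beta> s \<bullet> h = Re (cnj (\<xi> s) * planar h)"
        unfolding inner_vec_def sum_3 by (simp add: ellipse_def planar_def \<xi>_def)
      also have "cnj (\<xi> s) * planar h = r s * (cnj (u s) * planar h)"
        by (simp only: \<xi>_eq complex_cnj_mult complex_cnj_complex_of_real mult.assoc)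
      finally show ?thesis by (simp only: Re_complex_of_real times_complex.simps Im_complex_of_real mult_zero_left diff_zero)
    qed
    have "u s * cnj (u s) = 1"
      by (simp only: complex_norm_square[symmetric] ang.norm_u power_one of_real_1)
    then have ph: "planar h = u s * (cnj (u s) * planar h)"
      by (simp only: mult.assoc[symmetric] mult_1_left)
    have radial: "((r s * Re (cnj (u s) * planar h)) / (r s)\<^sup>2) *\<^sub>R \<xi> s = complex_of_real (Re (cnj (u s) * planar h)) * u s"
      using r_pos[of s] by (simp add: \<xi>_eq scaleR_conv_of_real power2_eq_square)
    have "cnj (u s) * planar h - complex_of_real (Re (cnj (u s) * planar h)) = \<i> * Im (cnj (u s) * planar h)"
      by (simp add: complex_eq_iff)
    then have tangential: "u s * (cnj (u s) * planar h) - u s * complex_of_real (Re (cnj (u s) * planar h))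
        = u s * (\<i> * Im (cnj (u s) * planar h))"
      by (simp only: right_diff_distrib[symmetric])
    have "planar h - complex_of_real (Re (cnj (u s) * planar h)) * u s = u s * (\<i> * Im (cnj (u s) * planar h))"
      using tangential unfolding ph[symmetric] by (simp only: mult.commute[of "u s" "complex_of_real _"])
    then have "planar (normalize_deriv (ellipse \<alpha> \<beta> s) h) = (u s * (\<i> * Im (cnj (u s) * planar h))) /\<^sub>R r s"
      unfolding normalize_deriv_def norm_ellipse dot P.scaleR P.diff planar_ellipse radial by (rule arg_cong)
    then show ?thesis
      by (simp only: scaleR_conv_of_real of_real_inverse of_real_divide of_real_mult divide_inverse mult_ac)
  qed
  then show "planar (linearized x) = \<i> * planar_constraint (\<lambda>s. planar (x s))"
    unfolding linearized_def planar_constraint_def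
    using integral_bounded_linear[OF bounded_linear_planar linearized_integrable[OF x]]
    by (simp only: integral_mult_right_zero)
  have "vertical (normalize_deriv (ellipse \<alpha> \<beta> s) h) = vertical h / r s" for s h
    unfolding vertical_def normalize_deriv_def norm_ellipse
    by (simp only: vector_scaleR_component vector_minus_component planar_ellipse(2) mult_zero_left mult_zero_right diff_zero
        real_scaleR_def of_real_mult of_real_inverse divide_inverse mult.commute)
  then show "vertical (linearized x) = radial_constraint (\<lambda>s. vertical (x s))"
    unfolding linearized_def radial_constraint_def
    using integral_bounded_linear[OF bounded_linear_vertical linearized_integrable[OF x]]
    by (simp only:)
qed

end

section \<open>Removing the first Fourier modes\<close>

lemma cis_W: "cis.W = 2 * pi"
  by (simp add: cis.W_def measure_restrict_space)

lemma integral_scaleR_linear: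
  fixes x :: "real \<Rightarrow> 'a::euclidean_space" and \<phi> :: "real \<Rightarrow> real"
  assumes P: "bounded_linear (P :: 'a \<Rightarrow> complex)" and "square_int x" "continuous_on UNIV \<phi>"
  shows "P (LINT s|circ. \<phi> s *\<^sub>R x s) = (LINT s|circ. P (x s) * \<phi> s)"
proof -
  interpret P: bounded_linear P by (rule P)
  show ?thesis
    using integral_bounded_linear[OF P integrable_scaleR_test[OF assms(2,3)]]
    by (simp add: P.scaleR scaleR_conv_of_real mult.commute)
qed

lemma coef_first:
  fixes h :: "real \<Rightarrow> complex"
  assumes h: "square_int h"
  shows "cis.coef h 1 = ((LINT s|circ. h s * complex_of_real (cos s)) - \<i> * (LINT s|circ. h s * complex_of_real (sin s))) / (2 * pi)"
    "cis.coef h (-1) = ((LINT s|circ. h s * complex_of_real (cos s)) + \<i> * (LINT s|circ. h s * complex_of_real (sin s))) / (2 * pi)"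
proof -
  have c: "continuous_on UNIV (\<lambda>s. complex_of_real (cos s))" "continuous_on UNIV (\<lambda>s. complex_of_real (sin s))"
    by (intro continuous_intros)+
  have i: "integrable circ (\<lambda>s. h s * complex_of_real (cos s))" "integrable circ (\<lambda>s. \<i> * (h s * complex_of_real (sin s)))"
    by (intro integrable_mult_right integrable_mult_continuous[OF h] c)+
  have p: "cis s powi (-1) = complex_of_real (cos s) - \<i> * complex_of_real (sin s)" "cis s powi (- (-1)) = complex_of_real (cos s) + \<i> * complex_of_real (sin s)" for s
    unfolding cis_powi_eq by (simp_all only: of_int_1 of_int_minus mult_minus_left mult_1_left cos_minus sin_minus
        of_real_minus mult_minus_right diff_minus_eq_add)
  have "(LINT s|circ. h s * (cis s powi (-1) * complex_of_real 1)) = (LINT s|circ. h s * complex_of_real (cos s) - \<i> * (h s * complex_of_real (sin s)))"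
    unfolding p by (simp add: algebra_simps)
  also have "\<dots> = (LINT s|circ. h s * complex_of_real (cos s)) - (LINT s|circ. \<i> * (h s * complex_of_real (sin s)))"
    by (rule Bochner_Integration.integral_diff[OF i])
  finally show "cis.coef h 1 = ((LINT s|circ. h s * complex_of_real (cos s)) - \<i> * (LINT s|circ. h s * complex_of_real (sin s))) / (2 * pi)"
    by (simp add: cis.coef_def cis_W)
  have "(LINT s|circ. h s * (cis s powi (- (-1)) * complex_of_real 1)) = (LINT s|circ. h s * complex_of_real (cos s) + \<i> * (h s * complex_of_real (sin s)))"
    unfolding p by (simp add: algebra_simps)
  also have "\<dots> = (LINT s|circ. h s * complex_of_real (cos s)) + (LINT s|circ. \<i> * (h s * complex_of_real (sin s)))"
    by (rule Bochner_Integration.integral_add[OF i])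
  finally show "cis.coef h (-1) = ((LINT s|circ. h s * complex_of_real (cos s)) + \<i> * (LINT s|circ. h s * complex_of_real (sin s))) / (2 * pi)"
    by (simp add: cis.coef_def cis_W)
qed

lemma fourier_coeff_cis: "fourier_coeff n f $ j = cis.coef (\<lambda>s. complex_of_real (f s $ j)) n"
proof -
  have "cis s powi (-n) = cis (- (of_int n * s))" for s
    by (simp add: cis_power_int)
  then show ?thesis
    unfolding fourier_coeff_def set_integral_circ cis.coef_def cis_W by simp
qed

text \<open>Removal of the first modes in terms of real integrals, which keeps the values in space and makes
  the same formula apply to the planar and to the vertical part.\<close>

definition strip_first_modes :: "(real \<Rightarrow> real^3) \<Rightarrow> real \<Rightarrow> real^3" where
  "strip_first_modes x s = x s - (cos s *\<^sub>R ((1 / pi) *\<^sub>R (LINT t|circ. cos t *\<^sub>R x t))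
      + sin s *\<^sub>R ((1 / pi) *\<^sub>R (LINT t|circ. sin t *\<^sub>R x t)))"

lemma strip_first_modes_linear:
  assumes P: "bounded_linear (P :: real^3 \<Rightarrow> complex)" and x: "square_int x"
  shows "P (strip_first_modes x s) = P (x s) - (\<Sum>m\<in>{1,-1}. cis.coef (\<lambda>s. P (x s)) m * cis s powi m)"
proof -
  interpret P: bounded_linear P by (rule P)
  define c where "c = (LINT t|circ. P (x t) * complex_of_real (cos t))"
  define d where "d = (LINT t|circ. P (x t) * complex_of_real (sin t))"
  have tr: "P (LINT t|circ. cos t *\<^sub>R x t) = c" "P (LINT t|circ. sin t *\<^sub>R x t) = d"
    unfolding c_def d_def by (intro integral_scaleR_linear P x continuous_intros)+
  have co: "cis.coef (\<lambda>s. P (x s)) 1 = (c - \<i> * d) / (2 * pi)" "cis.coef (\<lambda>s. P (x s)) (-1) = (c + \<i> * d) / (2 * pi)"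
    unfolding c_def d_def by (rule coef_first[OF square_int_linear[OF P x]])+
  have p: "cis s powi 1 = complex_of_real (cos s) + \<i> * complex_of_real (sin s)"
    "cis s powi (-1) = complex_of_real (cos s) - \<i> * complex_of_real (sin s)"
    using cis_powi_eq[of s "-1"] cis_powi_eq[of s 1]
    by (simp_all only: of_int_1 of_int_minus mult_minus_left mult_1_left cos_minus sin_minus
        of_real_minus mult_minus_right diff_minus_eq_add minus_minus)
  have two: "(\<Sum>m\<in>{1,-1}. F m) = F 1 + F (-1)" for F :: "int \<Rightarrow> complex" by simp
  have alg: "(a - \<i> * b) / (2 * w) * (C + \<i> * S) + (a + \<i> * b) / (2 * w) * (C - \<i> * S) = C * (1 / w * a) + S * (1 / w * b)"
    if "w \<noteq> 0" for a b w C S :: complex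
    using that by (simp add: field_simps)
  have "(\<Sum>m\<in>{1,-1}. cis.coef (\<lambda>s. P (x s)) m * cis s powi m)
      = (c - \<i> * d) / (2 * pi) * (complex_of_real (cos s) + \<i> * complex_of_real (sin s))
        + (c + \<i> * d) / (2 * pi) * (complex_of_real (cos s) - \<i> * complex_of_real (sin s))"
    unfolding two co p ..
  also have "\<dots> = complex_of_real (cos s) * (1 / pi * c) + complex_of_real (sin s) * (1 / pi * d)"
    using alg[of pi] by simp
  finally have S: "(\<Sum>m\<in>{1,-1}. cis.coef (\<lambda>s. P (x s)) m * cis s powi m)
      = complex_of_real (cos s) * (1 / pi * c) + complex_of_real (sin s) * (1 / pi * d)" .
  show ?thesis
    unfolding strip_first_modes_def P.diff P.add P.scaleR tr S unfolding scaleR_conv_of_real by simp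
qed

lemma strip_first_modes_square_int:
  assumes "square_int x" shows "square_int (strip_first_modes x)"
  unfolding strip_first_modes_def[abs_def]
  by (intro square_int_diff assms square_int_continuous continuous_intros)

lemma coef_strip:
  assumes P: "bounded_linear (P :: real^3 \<Rightarrow> complex)" and x: "square_int x" and n: "n \<in> {1, -1}"
  shows "cis.coef (\<lambda>s. P (strip_first_modes x s)) n = 0"
proof -
  let ?a = "cis.coef (\<lambda>s. P (x s))"
  have eq: "(\<lambda>s. P (strip_first_modes x s)) = (\<lambda>s. P (x s) + (\<Sum>m\<in>{1,-1}. (- ?a m) * cis s powi m))"
    by (simp only: strip_first_modes_linear[OF P x] mult_minus_left sum_negf add_uminus_conv_diff)
  have "cis.coef (\<lambda>s. P (strip_first_modes x s)) n
      = ?a n + cis.coef (\<lambda>s. \<Sum>m\<in>{1,-1}. (- ?a m) * cis s powi m) n"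
    unfolding eq by (rule cis.coef_add[OF square_int_linear[OF P x] cis.square_int_trig_sum])
  moreover have "cis.coef (\<lambda>s. \<Sum>m\<in>{1,-1}. (- ?a m) * cis s powi m) n = - ?a n"
    by (subst cis.coef_sum) (simp_all only: finite.intros n if_True)
  ultimately show ?thesis by (simp only: add.right_inverse)
qed

lemma energy_strip:
  assumes P: "bounded_linear (P :: real^3 \<Rightarrow> complex)" and x: "square_int x"
  shows "cis.energy (\<lambda>s. P (strip_first_modes x s))
    = cis.energy (\<lambda>s. P (x s)) - ((cmod (cis.coef (\<lambda>s. P (x s)) 1))\<^sup>2 + (cmod (cis.coef (\<lambda>s. P (x s)) (-1)))\<^sup>2)"
  unfolding strip_first_modes_linear[OF P x]
  by (subst cis.energy_diff_trig[OF square_int_linear[OF P x]]) simp_all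

lemma strip_first_modes_mem:
  assumes "x \<in> L2_per" shows "strip_first_modes x \<in> no_first_modes"
proof -
  have x: "square_int x" "periodic_2pi x" using assms by (auto simp: L2_per_iff)
  have "periodic_2pi (strip_first_modes x)"
    using x(2) by (simp add: periodic_2pi_def strip_first_modes_def)
  then have "strip_first_modes x \<in> L2_per"
    using strip_first_modes_square_int[OF x(1)] by (simp add: L2_per_iff)
  moreover have "fourier_coeff n (strip_first_modes x) = 0" if "n \<in> {1, -1}" for n
    unfolding vec_eq_iff fourier_coeff_cis
    using coef_strip[OF bounded_linear_component x(1) that] by simp
  ultimately show ?thesis by (simp add: no_first_modes_def)
qed

lemma no_first_modes_orthogonal:
  assumes k: "k \<in> no_first_modes"
  shows "L2_inner (\<lambda>s. cos s *\<^sub>R v + sin s *\<^sub>R w) k = 0"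
proof -
  have sq: "square_int k" using k by (simp add: no_first_modes_def L2_per_iff)
  have cc: "continuous_on UNIV (cos :: real \<Rightarrow> real)" "continuous_on UNIV (sin :: real \<Rightarrow> real)"
    by (intro continuous_intros)+
  have zero: "(LINT s|circ. cos s *\<^sub>R k s) = 0 \<and> (LINT s|circ. sin s *\<^sub>R k s) = 0"
    unfolding vec_eq_iff all_conj_distrib[symmetric]
  proof
    fix j
    let ?P = "\<lambda>v :: real^3. complex_of_real (v $ j)"
    note P = bounded_linear_component[of j]
    define c where "c = (LINT t|circ. ?P (k t) * complex_of_real (cos t))"
    define d where "d = (LINT t|circ. ?P (k t) * complex_of_real (sin t))"
    have "fourier_coeff 1 k $ j = 0" "fourier_coeff (-1) k $ j = 0"
      using k by (simp_all add: no_first_modes_def)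
    then have "(c - \<i> * d) / (2 * pi) = 0" "(c + \<i> * d) / (2 * pi) = 0"
      unfolding fourier_coeff_cis coef_first[OF square_int_linear[OF P sq]] c_def d_def by this+
    then have e: "c - \<i> * d = 0" "c + \<i> * d = 0"
      by simp_all
    have "c + c = (c - \<i> * d) + (c + \<i> * d)" by simp
    then have c0: "c = 0" unfolding e by simp
    have d0: "d = 0" using e(2) unfolding c0 by simp
    have "?P (LINT s|circ. cos s *\<^sub>R k s) = c" "?P (LINT s|circ. sin s *\<^sub>R k s) = d"
      unfolding c_def d_def by (rule integral_scaleR_linear[OF P sq cc(1)], rule integral_scaleR_linear[OF P sq cc(2)])
    then show "(LINT s|circ. cos s *\<^sub>R k s) $ j = 0 $ j \<and> (LINT s|circ. sin s *\<^sub>R k s) $ j = 0 $ j"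
      unfolding c0 d0 by simp
  qed
  have i: "integrable circ (\<lambda>s. cos s *\<^sub>R k s)" "integrable circ (\<lambda>s. sin s *\<^sub>R k s)"
    by (intro integrable_scaleR_test sq cc)+
  have "L2_inner (\<lambda>s. cos s *\<^sub>R v + sin s *\<^sub>R w) k = (LINT s|circ. v \<bullet> (cos s *\<^sub>R k s) + w \<bullet> (sin s *\<^sub>R k s))"
    unfolding L2_inner_circ by (simp add: inner_add_left)
  also have "\<dots> = (LINT s|circ. v \<bullet> (cos s *\<^sub>R k s)) + (LINT s|circ. w \<bullet> (sin s *\<^sub>R k s))"
    by (intro Bochner_Integration.integral_add integrable_inner_right i)
  also have "\<dots> = v \<bullet> (LINT s|circ. cos s *\<^sub>R k s) + w \<bullet> (LINT s|circ. sin s *\<^sub>R k s)"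
    by (simp only: integral_inner_right i)
  finally show ?thesis using zero by simp
qed

text \<open>Both \<open>proj_no_first_modes x\<close> and the explicit function with the first modes removed differ
  from \<open>x\<close> by something orthogonal to the subspace; so the norm of the former is at most that of
  the latter.\<close>

lemma proj_norm_le:
  assumes x: "x \<in> L2_per"
  shows "(L2_norm_per (proj_no_first_modes x))\<^sup>2 \<le> (L2_norm_per (strip_first_modes x))\<^sup>2"
proof -
  let ?h = "strip_first_modes x" and ?p = "proj_no_first_modes x"
  have sx: "square_int x" using x by (simp add: L2_per_iff)
  have orth: "L2_inner (\<lambda>s. x s - ?h s) k = 0" if "k \<in> no_first_modes" for k
  proof -
    have "(\<lambda>s. x s - ?h s) = (\<lambda>s. cos s *\<^sub>R ((1 / pi) *\<^sub>R (LINT t|circ. cos t *\<^sub>R x t))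
        + sin s *\<^sub>R ((1 / pi) *\<^sub>R (LINT t|circ. sin t *\<^sub>R x t)))"
      by (rule ext) (simp only: strip_first_modes_def diff_diff_eq2 add_diff_cancel_left')
    then show ?thesis by (simp only: no_first_modes_orthogonal[OF that])
  qed
  have "\<exists>h. h \<in> no_first_modes \<and> (\<forall>k \<in> no_first_modes. L2_inner (\<lambda>s. x s - h s) k = 0)"
    using strip_first_modes_mem[OF x] orth by blast
  from someI_ex[OF this] have p: "?p \<in> no_first_modes" "\<And>k. k \<in> no_first_modes \<Longrightarrow> L2_inner (\<lambda>s. x s - ?p s) k = 0"
    unfolding proj_no_first_modes_def by blast+
  have sq: "square_int ?h" "square_int ?p"
    using strip_first_modes_square_int[OF sx] p(1) by (auto simp: no_first_modes_def L2_per_iff)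
  have "L2_inner x ?p = L2_inner ?p ?p"
    using p(2)[OF p(1)] by (simp add: L2_inner_diff sx sq)
  moreover have "L2_inner x ?p = L2_inner ?h ?p"
    using orth[OF p(1)] by (simp add: L2_inner_diff sx sq)
  ultimately have "(L2_norm_per ?p)\<^sup>2 = L2_inner ?h ?p" by (simp add: L2_norm_square)
  also have "\<dots> \<le> L2_norm_per ?h * L2_norm_per ?p"
    using L2_Cauchy_Schwarz[OF sq] by (rule order_trans[OF abs_ge_self])
  finally have "L2_norm_per ?p * L2_norm_per ?p \<le> L2_norm_per ?h * L2_norm_per ?p"
    by (simp only: power2_eq_square)
  then have "L2_norm_per ?p \<le> L2_norm_per ?h"
    using L2_norm_nonneg[of ?p] L2_norm_nonneg[of ?h] by (cases "L2_norm_per ?p = 0") auto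
  then show ?thesis by (intro power_mono L2_norm_nonneg)
qed

section \<open>The second variation at the ellipse\<close>

definition ellipse' :: "real \<Rightarrow> real \<Rightarrow> real \<Rightarrow> real^3" where
  "ellipse' \<alpha> \<beta> s = (- \<alpha> * sin s) *\<^sub>R axis 1 1 + (\<beta> * cos s) *\<^sub>R axis 2 1"

lemma ellipse'_continuous: "continuous_on UNIV (ellipse' \<alpha> \<beta>)"
  unfolding ellipse'_def[abs_def] by (intro continuous_intros)

lemma ellipse_weak_deriv: "has_weak_deriv (ellipse \<alpha> \<beta>) (ellipse' \<alpha> \<beta>)"
proof (rule has_weak_deriv_smooth[OF _ ellipse'_continuous])
  show "(ellipse \<alpha> \<beta> has_vector_derivative ellipse' \<alpha> \<beta> s) (at s)" for s
  proof -
    have "((\<lambda>s. \<alpha> * cos s) has_real_derivative - \<alpha> * sin s) (at s)"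
      "((\<lambda>s. \<beta> * sin s) has_real_derivative \<beta> * cos s) (at s)"
      by (auto intro!: derivative_eq_intros)
    from has_vector_derivative_add[OF has_vector_derivative_scaleR[OF this(1) has_vector_derivative_const]
        has_vector_derivative_scaleR[OF this(2) has_vector_derivative_const]]
    show ?thesis unfolding ellipse_alt[abs_def] ellipse'_def by simp
  qed
  show "ellipse \<alpha> \<beta> (2 * pi) = ellipse \<alpha> \<beta> 0" by (simp add: ellipse_alt)
qed

lemma ellipse_L2: "ellipse \<alpha> \<beta> \<in> L2_per" "ellipse' \<alpha> \<beta> \<in> L2_per"
  unfolding L2_per_iff
  by (auto intro!: square_int_continuous ellipse_continuous ellipse'_continuous
      simp: periodic_2pi_def ellipse_alt ellipse'_def)

text \<open>The ellipse solves \<open>X'' = - X\<close>, hence is a critical point of the action.\<close>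

lemma ellipse_critical:
  fixes x g :: "real \<Rightarrow> real^3"
  assumes w: "has_weak_deriv x g" and x: "square_int x" and g: "square_int g"
  shows "L2_inner (ellipse' \<alpha> \<beta>) g = L2_inner (ellipse \<alpha> \<beta>) x"
proof -
  have cc: "continuous_on UNIV (cos :: real \<Rightarrow> real)" "continuous_on UNIV (sin :: real \<Rightarrow> real)"
    by (intro continuous_intros)+
  have 1: "(LINT s|circ. cos s *\<^sub>R x s) = - (LINT s|circ. sin s *\<^sub>R g s)"
    using weak_deriv_trig[OF w, of 1 1 0] by simp
  have "(LINT s|circ. (- sin s) *\<^sub>R x s) = - (LINT s|circ. cos s *\<^sub>R g s)"
    using weak_deriv_trig[OF w, of 0 1 1] by simp
  then have 2: "(LINT s|circ. sin s *\<^sub>R x s) = (LINT s|circ. cos s *\<^sub>R g s)" by simp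
  have inner: "L2_inner (\<lambda>s. (a * \<phi> s) *\<^sub>R v + (b * \<psi> s) *\<^sub>R w) f
      = a * (v \<bullet> (LINT s|circ. \<phi> s *\<^sub>R f s)) + b * (w \<bullet> (LINT s|circ. \<psi> s *\<^sub>R f s))"
    if f: "square_int f" and c: "continuous_on UNIV \<phi>" "continuous_on UNIV \<psi>"
    for a b v w and \<phi> \<psi> :: "real \<Rightarrow> real" and f :: "real \<Rightarrow> real^3"
  proof -
    note i = integrable_scaleR_test[OF f c(1)] integrable_scaleR_test[OF f c(2)]
    have "L2_inner (\<lambda>s. (a * \<phi> s) *\<^sub>R v + (b * \<psi> s) *\<^sub>R w) f
        = (LINT s|circ. a * (v \<bullet> (\<phi> s *\<^sub>R f s)) + b * (w \<bullet> (\<psi> s *\<^sub>R f s)))"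
      unfolding L2_inner_circ by (simp add: inner_add_left mult.assoc)
    also have "\<dots> = (LINT s|circ. a * (v \<bullet> (\<phi> s *\<^sub>R f s))) + (LINT s|circ. b * (w \<bullet> (\<psi> s *\<^sub>R f s)))"
      by (intro Bochner_Integration.integral_add integrable_mult_right integrable_inner_right i)
    also have "\<dots> = a * (v \<bullet> (LINT s|circ. \<phi> s *\<^sub>R f s)) + b * (w \<bullet> (LINT s|circ. \<psi> s *\<^sub>R f s))"
      by (simp only: integral_mult_right_zero integral_inner_right i)
    finally show ?thesis .
  qed
  have "L2_inner (ellipse' \<alpha> \<beta>) g = - \<alpha> * (axis 1 1 \<bullet> (LINT s|circ. sin s *\<^sub>R g s)) + \<beta> * (axis 2 1 \<bullet> (LINT s|circ. cos s *\<^sub>R g s))"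
    unfolding ellipse'_def[abs_def] by (rule inner[OF g cc(2,1)])
  moreover have "L2_inner (ellipse \<alpha> \<beta>) x = \<alpha> * (axis 1 1 \<bullet> (LINT s|circ. cos s *\<^sub>R x s)) + \<beta> * (axis 2 1 \<bullet> (LINT s|circ. sin s *\<^sub>R x s))"
    unfolding ellipse_alt[abs_def] by (rule inner[OF x cc])
  ultimately show ?thesis unfolding 1 2 by simp
qed

lemma H1_norm_ge: "L2_norm_per f \<le> H1_norm f" "L2_norm_per (weak_deriv f) \<le> H1_norm f"
  unfolding H1_norm_def by (rule real_sqrt_sum_squares_ge1 real_sqrt_sum_squares_ge2)+

lemma periodic_add: "periodic_2pi f \<Longrightarrow> periodic_2pi g \<Longrightarrow> periodic_2pi (\<lambda>s. f s + g s)"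
  by (simp add: periodic_2pi_def)

lemma periodic_scaleR: "periodic_2pi f \<Longrightarrow> periodic_2pi (\<lambda>s. c *\<^sub>R f s)"
  by (simp add: periodic_2pi_def)

text \<open>The actions of \<open>X \<mu>\<close> and its expansion are differences of two squared norms, each of which expands
  to second order. By criticality of the ellipse the two mixed terms \<open>2 \<mu>\<^sup>2 \<langle>X\<^sub>0, x\<^sub>2\<rangle>\<close> agree and cancel.\<close>

lemma second_variation:
  fixes X R :: "real \<Rightarrow> real \<Rightarrow> real^3"
  assumes x1: "x\<^sub>1 \<in> H1_per" and x2: "x\<^sub>2 \<in> H1_per"
    and X: "\<And>\<mu>. X \<mu> = (\<lambda>s. ellipse \<alpha> \<beta> s + \<mu> *\<^sub>R x\<^sub>1 s + \<mu>\<^sup>2 *\<^sub>R x\<^sub>2 s + R \<mu> s)"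
    and R: "\<forall>\<^sub>F \<mu> in at 0. R \<mu> \<in> H1_per"
    and small: "((\<lambda>\<mu>. H1_norm (R \<mu>) / \<mu>\<^sup>2) \<longlongrightarrow> 0) (at 0)"
  shows "has_second_variation (ellipse \<alpha> \<beta>) X (action x\<^sub>1)"
proof -
  let ?e = "ellipse \<alpha> \<beta>" and ?e' = "ellipse' \<alpha> \<beta>"
  define g1 g2 where "g1 = weak_deriv x\<^sub>1" and "g2 = weak_deriv x\<^sub>2"
  note w1 = weak_deriv_H1[OF x1, folded g1_def] and w2 = weak_deriv_H1[OF x2, folded g2_def]
  have se: "square_int ?e" "square_int ?e'" and pe: "periodic_2pi ?e" "periodic_2pi ?e'"
    using ellipse_L2 by (simp_all add: L2_per_iff)
  have lim: "((\<lambda>\<mu>. L2_norm_per (F \<mu>) / \<mu>\<^sup>2) \<longlongrightarrow> 0) (at 0)" if le: "\<And>\<mu>. L2_norm_per (F \<mu>) \<le> H1_norm (R \<mu>)"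
    for F :: "real \<Rightarrow> real \<Rightarrow> real^3"
  proof (rule Lim_null_comparison[OF always_eventually[OF allI] small])
    fix \<mu>
    show "norm (L2_norm_per (F \<mu>) / \<mu>\<^sup>2) \<le> H1_norm (R \<mu>) / \<mu>\<^sup>2"
      using divide_right_mono[OF le zero_le_power2, of \<mu> \<mu>] L2_norm_nonneg[of "F \<mu>"] by simp
  qed
  have sqR: "\<forall>\<^sub>F \<mu> in at 0. square_int (R \<mu>)" "\<forall>\<^sub>F \<mu> in at 0. square_int (weak_deriv (R \<mu>))"
    by (rule eventually_mono[OF R], erule weak_deriv_H1)+
  define f where "f \<mu> = L2_inner (X \<mu>) (X \<mu>)
      - (L2_inner ?e ?e + 2 * \<mu> * L2_inner ?e x\<^sub>1 + \<mu>\<^sup>2 * (L2_inner x\<^sub>1 x\<^sub>1 + 2 * L2_inner ?e x\<^sub>2))" for \<mu>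
  define G where "G \<mu> s = ?e' s + \<mu> *\<^sub>R g1 s + \<mu>\<^sup>2 *\<^sub>R g2 s + weak_deriv (R \<mu>) s" for \<mu> s
  define f' where "f' \<mu> = L2_inner (G \<mu>) (G \<mu>)
      - (L2_inner ?e' ?e' + 2 * \<mu> * L2_inner ?e' g1 + \<mu>\<^sup>2 * (L2_inner g1 g1 + 2 * L2_inner ?e' g2))" for \<mu>
  have fo: "f \<in> o[at 0](\<lambda>\<mu>. \<mu>\<^sup>2)"
    unfolding f_def[abs_def] X
    by (rule quadratic_expansion_smallo[OF se(1) w1(1) w2(1) sqR(1) lim[OF H1_norm_ge(1)]])
  have f'o: "f' \<in> o[at 0](\<lambda>\<mu>. \<mu>\<^sup>2)"
    unfolding f'_def[abs_def] G_def[abs_def]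
    by (rule quadratic_expansion_smallo[OF se(2) w1(2) w2(2) sqR(2) lim[OF H1_norm_ge(2)]])
  have crit: "L2_inner ?e' g2 = L2_inner ?e x\<^sub>2"
    by (rule ellipse_critical[OF w2(3,1,2)])
  have a0: "action ?e = 1/2 * (L2_inner ?e' ?e' - L2_inner ?e ?e)"
    by (rule action_eq[OF ellipse_L2 ellipse_weak_deriv])
  have a1: "action x\<^sub>1 = 1/2 * (L2_inner g1 g1 - L2_inner x\<^sub>1 x\<^sub>1)"
    using w1 by (intro action_eq) (simp_all add: L2_per_iff)
  have alg: "1/2 * (G - Y) - (1/2 * (a' - a) + m * (b' - b) + m\<^sup>2 * (1/2 * (c' - c)))
      = 1/2 * ((G - (a' + 2 * m * b' + m\<^sup>2 * (c' + 2 * k))) - (Y - (a + 2 * m * b + m\<^sup>2 * (c + 2 * k))))"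
    for G Y a a' b b' c c' k m :: real
    by (simp add: field_simps)
  have ev: "\<forall>\<^sub>F \<mu> in at 0. action (X \<mu>) - (action ?e + \<mu> * (L2_inner ?e' g1 - L2_inner ?e x\<^sub>1) + \<mu>\<^sup>2 * action x\<^sub>1)
      = 1/2 * (f' \<mu> - f \<mu>)"
    using R
  proof eventually_elim
    case (elim \<mu>)
    note wR = weak_deriv_H1[OF elim]
    note s1 = square_int_scaleR[OF w1(1), of \<mu>] square_int_scaleR[OF w1(2), of \<mu>]
    note s2 = square_int_scaleR[OF w2(1), of "\<mu>\<^sup>2"] square_int_scaleR[OF w2(2), of "\<mu>\<^sup>2"]
    note t1 = square_int_add[OF se(1) s1(1)] square_int_add[OF se(2) s1(2)]
    note t2 = square_int_add[OF t1(1) s2(1)] square_int_add[OF t1(2) s2(2)]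
    note t3 = square_int_add[OF t2(1) wR(1)] square_int_add[OF t2(2) wR(2)]
    have "has_weak_deriv (X \<mu>) (G \<mu>)"
      unfolding X G_def[abs_def]
      by (intro has_weak_deriv_add has_weak_deriv_scaleR ellipse_weak_deriv w1 w2 wR se s1 s2 t1 t2)
    moreover have "X \<mu> \<in> L2_per" "G \<mu> \<in> L2_per"
      unfolding L2_per_iff X G_def[abs_def]
      by (intro conjI periodic_add periodic_scaleR pe w1 w2 wR t3)+
    ultimately have aX: "action (X \<mu>) = 1/2 * (L2_inner (G \<mu>) (G \<mu>) - L2_inner (X \<mu>) (X \<mu>))"
      by (intro action_eq)
    show ?case unfolding f_def f'_def a0 a1 crit aX by (rule alg)
  qed
  have "(\<lambda>\<mu>. 1/2 * (f' \<mu> - f \<mu>)) \<in> o[at 0](\<lambda>\<mu>. \<mu>\<^sup>2)"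
    by (rule iffD2[OF landau_o.small.cmult_in_iff sum_in_smallo(2)[OF f'o fo]]) simp
  then have "(\<lambda>\<mu>. action (X \<mu>) - (action ?e + \<mu> * (L2_inner ?e' g1 - L2_inner ?e x\<^sub>1) + \<mu>\<^sup>2 * action x\<^sub>1))
      \<in> o[at 0](\<lambda>\<mu>. \<mu>\<^sup>2)"
    by (rule iffD2[OF landau_o.small.in_cong[OF ev]])
  then show ?thesis
    unfolding has_second_variation_def by (rule exI)
qed

theorem proposition2p1:
  fixes \<alpha> \<beta> :: real
  assumes "\<alpha> \<ge> \<beta>" and "\<beta> > 0"
  shows "\<exists>c>0. \<forall>(X :: real \<Rightarrow> real \<Rightarrow> real^3) x\<^sub>1 x\<^sub>2.
      x\<^sub>1 \<in> H1_per \<longrightarrow> x\<^sub>2 \<in> H1_per \<longrightarrow>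
      (\<forall>\<^sub>F \<mu> in at 0. X \<mu> \<in> H1_per) \<longrightarrow>
      (\<lambda>\<mu>. H1_norm (\<lambda>s. X \<mu> s - (ellipse \<alpha> \<beta> s + \<mu> *\<^sub>R x\<^sub>1 s + \<mu>\<^sup>2 *\<^sub>R x\<^sub>2 s)))
        \<in> o[at 0](\<lambda>\<mu>. \<mu>\<^sup>2) \<longrightarrow>
      (\<lambda>\<mu>. norm (constraint_integral (X \<mu>))) \<in> o[at 0](\<lambda>\<mu>. \<mu>) \<longrightarrow>
      has_second_variation (ellipse \<alpha> \<beta>) X (action x\<^sub>1) \<and>
      action x\<^sub>1 \<ge> c * (L2_norm_per (proj_no_first_modes x\<^sub>1))\<^sup>2"
proof -
  interpret ellipse_geometry \<alpha> \<beta> by unfold_locales (use assms in auto)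
  show ?thesis
  proof (intro exI[of _ "\<kappa> / 2"] conjI allI impI)
    show "\<kappa> / 2 > 0" using \<kappa>_pos by simp
    fix X :: "real \<Rightarrow> real \<Rightarrow> real^3" and x\<^sub>1 x\<^sub>2
    assume x1: "x\<^sub>1 \<in> H1_per" and x2: "x\<^sub>2 \<in> H1_per" and XH: "\<forall>\<^sub>F \<mu> in at 0. X \<mu> \<in> H1_per"
      and small: "(\<lambda>\<mu>. H1_norm (\<lambda>s. X \<mu> s - (ellipse \<alpha> \<beta> s + \<mu> *\<^sub>R x\<^sub>1 s + \<mu>\<^sup>2 *\<^sub>R x\<^sub>2 s))) \<in> o[at 0](\<lambda>\<mu>. \<mu>\<^sup>2)"
      and con: "(\<lambda>\<mu>. norm (constraint_integral (X \<mu>))) \<in> o[at 0](\<lambda>\<mu>. \<mu>)"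
    define R where "R \<mu> s = X \<mu> s - (ellipse \<alpha> \<beta> s + \<mu> *\<^sub>R x\<^sub>1 s + \<mu>\<^sup>2 *\<^sub>R x\<^sub>2 s)" for \<mu> s
    have X: "X \<mu> = (\<lambda>s. ellipse \<alpha> \<beta> s + \<mu> *\<^sub>R x\<^sub>1 s + \<mu>\<^sup>2 *\<^sub>R x\<^sub>2 s + R \<mu> s)" for \<mu>
      by (rule ext) (simp add: R_def)
    note w1 = weak_deriv_H1[OF x1] and w2 = weak_deriv_H1[OF x2]
    have se: "square_int (ellipse \<alpha> \<beta>)" "square_int (ellipse' \<alpha> \<beta>)"
      and pe: "periodic_2pi (ellipse \<alpha> \<beta>)" "periodic_2pi (ellipse' \<alpha> \<beta>)"
      using ellipse_L2 by (simp_all add: L2_per_iff)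
    \<comment> \<open>the remainder inherits a weak derivative from \<open>X \<mu>\<close>, the ellipse, \<open>x\<^sub>1\<close> and \<open>x\<^sub>2\<close>\<close>
    have RH: "\<forall>\<^sub>F \<mu> in at 0. R \<mu> \<in> H1_per"
      using XH
    proof eventually_elim
      case (elim \<mu>)
      note wX = weak_deriv_H1[OF elim]
      note s1 = square_int_scaleR[OF w1(1), of \<mu>] square_int_scaleR[OF w1(2), of \<mu>]
      note s2 = square_int_scaleR[OF w2(1), of "\<mu>\<^sup>2"] square_int_scaleR[OF w2(2), of "\<mu>\<^sup>2"]
      note t1 = square_int_add[OF se(1) s1(1)] square_int_add[OF se(2) s1(2)]
      note t2 = square_int_add[OF t1(1) s2(1)] square_int_add[OF t1(2) s2(2)]
      note t3 = square_int_scaleR[OF t2(1), of "-1"] square_int_scaleR[OF t2(2), of "-1"]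
      let ?T = "\<lambda>s. ellipse \<alpha> \<beta> s + \<mu> *\<^sub>R x\<^sub>1 s + \<mu>\<^sup>2 *\<^sub>R x\<^sub>2 s"
      let ?T' = "\<lambda>s. ellipse' \<alpha> \<beta> s + \<mu> *\<^sub>R weak_deriv x\<^sub>1 s + \<mu>\<^sup>2 *\<^sub>R weak_deriv x\<^sub>2 s"
      have w: "has_weak_deriv (\<lambda>s. X \<mu> s + (-1) *\<^sub>R ?T s) (\<lambda>s. weak_deriv (X \<mu>) s + (-1) *\<^sub>R ?T' s)"
        by (intro has_weak_deriv_add has_weak_deriv_scaleR ellipse_weak_deriv w1 w2 wX se s1 s2 t1 t2 t3)
      have m: "(\<lambda>s. X \<mu> s + (-1) *\<^sub>R ?T s) \<in> L2_per" "(\<lambda>s. weak_deriv (X \<mu>) s + (-1) *\<^sub>R ?T' s) \<in> L2_per"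
        unfolding L2_per_iff
        by (intro conjI periodic_add periodic_scaleR pe w1 w2 wX square_int_add t3)+
      have e: "R \<mu> = (\<lambda>s. X \<mu> s + (-1) *\<^sub>R ?T s)" by (rule ext) (simp add: R_def)
      show ?case unfolding H1_per_def e
      proof (rule CollectI, rule conjI[OF m(1)])
        show "\<exists>g\<in>L2_per. has_weak_deriv (\<lambda>s. X \<mu> s + (-1) *\<^sub>R ?T s) g"
          by (rule bexI[OF _ m(2)]) (rule w)
      qed
    qed
    have lim: "((\<lambda>\<mu>. H1_norm (R \<mu>) / \<mu>\<^sup>2) \<longlongrightarrow> 0) (at 0)"
      unfolding R_def[abs_def] by (rule smalloD_tendsto[OF small])
    show "has_second_variation (ellipse \<alpha> \<beta>) X (action x\<^sub>1)"
      by (rule second_variation[OF x1 x2 X RH lim])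
    have "linearized x\<^sub>1 = 0"
    proof (rule linearized_constraint_vanishes[OF w1(1) w2(1)])
      show "\<forall>\<^sub>F \<mu> in at 0. square_int (R \<mu>)"
        using RH by (rule eventually_mono) (rule weak_deriv_H1(1))
      show "((\<lambda>\<mu>. L2_norm_per (R \<mu>) / \<mu>\<^sup>2) \<longlongrightarrow> 0) (at 0)"
      proof (rule Lim_null_comparison[OF always_eventually[OF allI] lim])
        fix \<mu>
        show "norm (L2_norm_per (R \<mu>) / \<mu>\<^sup>2) \<le> H1_norm (R \<mu>) / \<mu>\<^sup>2"
          using divide_right_mono[OF H1_norm_ge(1) zero_le_power2, of "R \<mu>" \<mu>] L2_norm_nonneg[of "R \<mu>"] by simp
      qed
      show "(\<lambda>\<mu>. norm (constraint_integral (\<lambda>s. ellipse \<alpha> \<beta> s + \<mu> *\<^sub>R x\<^sub>1 s + \<mu>\<^sup>2 *\<^sub>R x\<^sub>2 s + R \<mu> s))) \<in> o[at 0](\<lambda>\<mu>. \<mu>)"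
        using con unfolding X[symmetric] .
    qed
    then have zero: "planar_constraint (\<lambda>s. planar (x\<^sub>1 s)) = 0" "radial_constraint (\<lambda>s. vertical (x\<^sub>1 s)) = 0"
      using linearized_split[OF w1(1)] by (simp_all add: planar_def vertical_def complex_eq_iff)
    let ?g = "weak_deriv x\<^sub>1"
    let ?N = "\<lambda>P. cis.energy (\<lambda>s. P (strip_first_modes x\<^sub>1 s))"
    have gaps: "cis.energy (\<lambda>s. planar (?g s)) - cis.energy (\<lambda>s. planar (x\<^sub>1 s)) \<ge> \<kappa> * ?N planar"
      "cis.energy (\<lambda>s. vertical (?g s)) - cis.energy (\<lambda>s. vertical (x\<^sub>1 s)) \<ge> \<kappa> * ?N vertical"
      unfolding energy_strip[OF bounded_linear_planar w1(1)] energy_strip[OF bounded_linear_vertical w1(1)]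
      by (rule planar_coercive[OF square_int_linear[OF bounded_linear_planar w1(1)]
            square_int_linear[OF bounded_linear_planar w1(2)]
            weak_deriv_coef[OF w1(3,1,2) bounded_linear_planar] zero(1)]
          radial_coercive[OF square_int_linear[OF bounded_linear_vertical w1(1)]
            square_int_linear[OF bounded_linear_vertical w1(2)]
            weak_deriv_coef[OF w1(3,1,2) bounded_linear_vertical] zero(2)])+
    have "\<kappa> / 2 * (L2_norm_per (proj_no_first_modes x\<^sub>1))\<^sup>2 \<le> \<kappa> / 2 * (L2_norm_per (strip_first_modes x\<^sub>1))\<^sup>2"
      using \<kappa>_pos w1 by (intro mult_left_mono proj_norm_le) (simp_all add: L2_per_iff)
    also have "\<dots> = pi * (\<kappa> * ?N planar + \<kappa> * ?N vertical)"
      unfolding L2_norm_square L2_norm_energy[OF strip_first_modes_square_int[OF w1(1)]]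
      by (simp add: distrib_left)
    also have "\<dots> \<le> pi * ((cis.energy (\<lambda>s. planar (?g s)) - cis.energy (\<lambda>s. planar (x\<^sub>1 s)))
        + (cis.energy (\<lambda>s. vertical (?g s)) - cis.energy (\<lambda>s. vertical (x\<^sub>1 s))))"
      by (intro mult_left_mono add_mono gaps) simp
    also have "\<dots> = 1/2 * (L2_inner ?g ?g - L2_inner x\<^sub>1 x\<^sub>1)"
      unfolding L2_norm_energy[OF w1(1)] L2_norm_energy[OF w1(2)] by (simp add: algebra_simps)
    also have "\<dots> = action x\<^sub>1"
      using w1 by (intro action_eq[symmetric]) (simp_all add: L2_per_iff)
    finally show "action x\<^sub>1 \<ge> \<kappa> / 2 * (L2_norm_per (proj_no_first_modes x\<^sub>1))\<^sup>2" .
  qed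
qed

end
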